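(* Let $\mathbf{C}$ be a locally finitely presentable category and let $$d_{X,Y}\colon\Gamma(\Sigma X,Y)\to ST\bigl(\Gamma(X,STY)+X+Y\bigr)$$ be an incremental structural law over a distributive law $\delta\colon TS\to ST$, with $S=\Sigma^*$. Let $T'$ be the free monad on $X\mapsto\Gamma(X,SX)$, and let $S(T\oplus T')$ be the composite monad given by the induced distributive law $d_{/\delta}\colon(T\oplus T')S\to S(T\oplus T')$. Then there is an isomorphism $S(T\oplus T')\text{-}\mathbf{Alg}\cong(\delta,d)\text{-}\mathbf{Alg}$ of categories over $\mathbf{C}$. More precisely, for any $S(T\oplus T')$-algebra $X$, precomposing its structure map $S(T\oplus T')X\to X$ with the canonical morphisms from $SX$, $TX$ and $\Gamma(X,X)$ into $S(T\oplus T')X$ equips $X$ with $(\delta,d)$-algebra structure. This assignment extends to a functor $S(T\oplus T')\text{-}\mathbf{Alg}\to(\delta,d)\text{-}\mathbf{Alg}$ over $\mathbf{C}$, which is an isomorphism of categories.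
   Context: Incremental structural law: a monad distributive law $\delta\colon TS\to ST$ with $S=\Sigma^*$ the free monad on a finitary endofunctor $\Sigma$ and $T$ constant-free ($\eta^T_\emptyset\colon\emptyset\to T\emptyset$ iso); a functor $\Gamma\colon\mathbf{C}^2\to\mathbf{C}$ cocontinuous in its first argument and finitary in its second; and a natural transformation $d_{X,Y}\colon\Gamma(\Sigma X,Y)\to ST(\Gamma(X,STY)+X+Y)$. The coproduct $T\oplus T'$ of monads is assumed to exist (automatic if $T$ is finitary), with injections $in_1,in_2$. $\eta_\Sigma\colon\Sigma\to S$ and $\eta_{\Gamma_S,X}\colon\Gamma(X,SX)\to T'X$ are the canonical transformations into free monads. $M\text{-}\mathbf{Alg}$ denotes monad algebras. A $(\delta,d)$-algebra is an object $X$ with morphisms $\mathbf{a}\colon SX\to X$, $\mathbf{b}\colon TX\to X$, $\mathbf{c}\colon\Gamma(X,X)\to X$, the first two being monad algebra structures, such that (d1) $\mathbf{b}\circ T\mathbf{a}=\mathbf{a}\circ S\mathbf{b}\circ\delta_X\colon TSX\to X$, and (d2) $\mathbf{c}\circ\Gamma(\mathbf{a}\circ\eta_{\Sigma,X},X)=\mathbf{a}\circ S\mathbf{b}\circ ST[\mathbf{c},\mathrm{id}_X]\circ ST(\Gamma(X,\mathbf{a}\circ S\mathbf{b})+[\mathrm{id}_X,\mathrm{id}_X])\circ d_{X,X}\colon\Gamma(\Sigma X,X)\to X$. Morphisms are morphisms of underlying objects that are $S$-, $T$- and $\Gamma\Delta$-algebra morphisms ($\Gamma\Delta\colon X\mapsto\Gamma(X,X)$).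 Canonical morphisms: $S\eta^{T\oplus T'}_X\colon SX\to S(T\oplus T')X$; $TX\xrightarrow{in_1}(T\oplus T')X\xrightarrow{\eta^S}S(T\oplus T')X$; and $\Gamma(X,X)\xrightarrow{\Gamma(X,\eta^S_X)}\Gamma(X,SX)\xrightarrow{\eta_{\Gamma_S,X}}T'X\xrightarrow{in_2}(T\oplus T')X\xrightarrow{\eta^S}S(T\oplus T')X$. The induced distributive law $d_{/\delta}$: Regard $ST$ as the composite monad given by $\delta$. For each object $Y$, let $L_Y=\Gamma(-,STY)+(-)$, a cocontinuous endofunctor with right adjoint $R_Y$. Let $K_Y=ST(-+Y)$, a monad with unit $A\to A+Y\to ST(A+Y)$ and multiplication $ST(ST(A+Y)+Y)\to STST(A+Y)\to ST(A+Y)$ given by $ST[\mathrm{id},\eta^{ST}_{A+Y}\circ in_2]$ followed by $\mu^{ST}$. Then $R_YK_YL_Y$ is a monad via the adjunction. Define $h_{X,Y}\colon L_Y\Sigma X\to K_YL_YX=ST(\Gamma(X,STY)+X+Y)$: on the summand $\Sigma X$ it is $\Sigma X\xrightarrow{\eta_\Sigma}SX\xrightarrow{S\eta^T_X}STX\xrightarrow{ST in_2}ST(\Gamma(X,STY)+X+Y)$; on the summand $\Gamma(\Sigma X,STY)$ it is the composite of $d_{X,STY}\colon\Gamma(\Sigma X,STY)\to ST(A+STY)$ with $A=\Gamma(X,STSTY)+X$, then $ST[\eta^{ST}_{A+Y}\circ in_1,\,ST in_2]\colon ST(A+STY)\to STST(A+Y)$, then $\mu^{ST}_{A+Y}$,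 then $ST(\Gamma(X,\mu^{ST}_Y)+X+Y)$. For fixed $Y$, the transposes $\Sigma X\to R_YK_YL_YX$ of $h_{X,Y}$ extend to a unique monad morphism $S\to R_YK_YL_Y$; transposing back yields $\bar h_{X,Y}\colon L_YSX\to K_YL_YX$. Let $\hat d_{X,Y}$ be the composite $\Gamma(SX,SY)\xrightarrow{\Gamma(SX,S\eta^T_Y)}\Gamma(SX,STY)\xrightarrow{in_1}L_YSX\xrightarrow{\bar h_{X,Y}}ST(\Gamma(X,STY)+X+Y)$. A $(T\oplus T')$-algebra is the same as an object $X$ with a $T$-algebra structure $\mathbf{b}\colon TX\to X$ and a morphism $\mathbf{c}\colon\Gamma(X,SX)\to X$. Given such, equip $SX$ with the $T$-algebra structure $TSX\xrightarrow{\delta_X}STX\xrightarrow{S\mathbf{b}}SX$ and with $$\Gamma(SX,SSX)\xrightarrow{\Gamma(SX,\mu^S_X)}\Gamma(SX,SX)\xrightarrow{\hat d_{X,X}}ST(\Gamma(X,STX)+X+X)\xrightarrow{ST(\Gamma(X,S\mathbf{b})+[\mathrm{id},\mathrm{id}])}ST(\Gamma(X,SX)+X)\xrightarrow{ST[\mathbf{c},\mathrm{id}]}STX\xrightarrow{S\mathbf{b}}SX.$$ This lifts the monad $S$ to $(T\oplus T')\text{-}\mathbf{Alg}$, and $d_{/\delta}$ is the distributive law corresponding to this lifting by Beck's theorem: $(d_{/\delta})_X$ is $(T\oplus T')S\eta^{T\oplus T'}_X$ followed by the algebra structure $(T\oplus T')S(T\oplus T')X\to S(T\oplus T')X$ of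 the lifting applied to the free algebra $(T\oplus T')X$. *)

theory Defs
  imports Main "HOL-Library.FuncSet" "HOL-Library.Equipollence"
begin

section \<open>Categories, functors, natural transformations\<close>

text \<open>
  Everything is relative to explicit carriers: the components of the records below are total
  functions, but only their values on \<open>Ob C\<close> and \<open>Arr C\<close> are meaningful.
  \<open>g \<cdot> f\<close> is \<open>g\<close> after \<open>f\<close>.
\<close>

record ('o, 'a) cat =
  Ob  :: "'o set"
  Arr :: "'a set"
  Dom :: "'a \<Rightarrow> 'o"
  Cod :: "'a \<Rightarrow> 'o"
  Idn :: "'o \<Rightarrow> 'a"  ("idn\<index>")
  Cmp :: "'a \<Rightarrow> 'a \<Rightarrow> 'a"  (infixl "\<cdot>\<index>" 70)

definition hom :: "('o, 'a) cat \<Rightarrow> 'o \<Rightarrow> 'o \<Rightarrow> 'a set" where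
  "hom C X Y = {f \<in> Arr C. Dom C f = X \<and> Cod C f = Y}"

locale category =
  fixes C :: "('o, 'a) cat" (structure)
  assumes Dom_Ob: "f \<in> Arr C \<Longrightarrow> Dom C f \<in> Ob C"
    and Cod_Ob: "f \<in> Arr C \<Longrightarrow> Cod C f \<in> Ob C"
    and Idn_hom: "X \<in> Ob C \<Longrightarrow> idn X \<in> hom C X X"
    and Cmp_hom: "\<lbrakk>f \<in> hom C X Y; g \<in> hom C Y Z\<rbrakk> \<Longrightarrow> g \<cdot> f \<in> hom C X Z"
    and Idn_left: "f \<in> hom C X Y \<Longrightarrow> idn Y \<cdot> f = f"
    and Idn_right: "f \<in> hom C X Y \<Longrightarrow> f \<cdot> idn X = f"
    and Cmp_assoc: "\<lbrakk>f \<in> hom C W X; g \<in> hom C X Y; h \<in> hom C Y Z\<rbrakk> \<Longrightarrow>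
                      h \<cdot> (g \<cdot> f) = (h \<cdot> g) \<cdot> f"

definition iso_arr :: "('o, 'a) cat \<Rightarrow> 'a \<Rightarrow> bool" where
  "iso_arr C f \<longleftrightarrow> f \<in> Arr C \<and>
     (\<exists>g \<in> hom C (Cod C f) (Dom C f).
        g \<cdot>\<^bsub>C\<^esub> f = idn\<^bsub>C\<^esub> (Dom C f) \<and> f \<cdot>\<^bsub>C\<^esub> g = idn\<^bsub>C\<^esub> (Cod C f))"

definition initial_ob :: "('o, 'a) cat \<Rightarrow> 'o \<Rightarrow> bool" where
  "initial_ob C I \<longleftrightarrow> I \<in> Ob C \<and> (\<forall>X \<in> Ob C. \<exists>!f. f \<in> hom C I X)"

definition prod_cat :: "('o, 'a) cat \<Rightarrow> ('p, 'b) cat \<Rightarrow> ('o \<times> 'p, 'a \<times> 'b) cat" where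
  "prod_cat C D = \<lparr>
     Ob = Ob C \<times> Ob D,
     Arr = Arr C \<times> Arr D,
     Dom = (\<lambda>(f, g). (Dom C f, Dom D g)),
     Cod = (\<lambda>(f, g). (Cod C f, Cod D g)),
     Idn = (\<lambda>(X, Y). (idn\<^bsub>C\<^esub> X, idn\<^bsub>D\<^esub> Y)),
     Cmp = (\<lambda>(f', g') (f, g). (f' \<cdot>\<^bsub>C\<^esub> f, g' \<cdot>\<^bsub>D\<^esub> g)) \<rparr>"

text \<open>\<open>F \<diamondop> X\<close> is the object part, \<open>F \<star> f\<close> the arrow part of a functor.\<close>

record ('o, 'a, 'p, 'b) ftor =
  fob :: "'o \<Rightarrow> 'p"  (infixr "\<diamondop>" 90)
  far :: "'a \<Rightarrow> 'b"  (infixr "\<star>" 90)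

type_synonym ('o, 'a) endo = "('o, 'a, 'o, 'a) ftor"

definition is_functor ::
  "('o, 'a) cat \<Rightarrow> ('p, 'b) cat \<Rightarrow> ('o, 'a, 'p, 'b, 'z) ftor_scheme \<Rightarrow> bool" where
  "is_functor C D F \<longleftrightarrow>
     (\<forall>X \<in> Ob C. F \<diamondop> X \<in> Ob D \<and> F \<star> idn\<^bsub>C\<^esub> X = idn\<^bsub>D\<^esub> (F \<diamondop> X)) \<and>
     (\<forall>X Y. \<forall>f \<in> hom C X Y. F \<star> f \<in> hom D (F \<diamondop> X) (F \<diamondop> Y)) \<and>
     (\<forall>X Y Z. \<forall>f \<in> hom C X Y. \<forall>g \<in> hom C Y Z. F \<star> (g \<cdot>\<^bsub>C\<^esub> f) = F \<star> g \<cdot>\<^bsub>D\<^esub> F \<star> f)"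

definition ftor_comp ::
  "('p, 'b, 'q, 'c, 'z) ftor_scheme \<Rightarrow> ('o, 'a, 'p, 'b, 'y) ftor_scheme \<Rightarrow> ('o, 'a, 'q, 'c) ftor" where
  "ftor_comp G F = \<lparr> fob = (\<lambda>X. G \<diamondop> F \<diamondop> X), far = (\<lambda>f. G \<star> F \<star> f) \<rparr>"

definition nat_trans ::
  "('o, 'a) cat \<Rightarrow> ('p, 'b) cat \<Rightarrow> ('o, 'a, 'p, 'b, 'z) ftor_scheme \<Rightarrow>
   ('o, 'a, 'p, 'b, 'y) ftor_scheme \<Rightarrow> ('o \<Rightarrow> 'b) \<Rightarrow> bool" where
  "nat_trans C D F G \<alpha> \<longleftrightarrow>
     (\<forall>X \<in> Ob C. \<alpha> X \<in> hom D (F \<diamondop> X) (G \<diamondop> X)) \<and>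
     (\<forall>X Y. \<forall>f \<in> hom C X Y. \<alpha> Y \<cdot>\<^bsub>D\<^esub> F \<star> f = G \<star> f \<cdot>\<^bsub>D\<^esub> \<alpha> X)"

definition id_ftor :: "('o, 'a) endo" where
  "id_ftor = \<lparr> fob = (\<lambda>X. X), far = (\<lambda>f. f) \<rparr>"

text \<open>
  An adjunction \<open>L \<stileturn> R\<close> between endofunctors, presented by unit, counit and the triangle identities.
\<close>

record ('o, 'a) adj =
  radj :: "('o, 'a) endo"
  aunit :: "'o \<Rightarrow> 'a"
  acounit :: "'o \<Rightarrow> 'a"

definition is_adjunction ::
  "('o, 'a) cat \<Rightarrow> ('o, 'a) endo \<Rightarrow> ('o, 'a) adj \<Rightarrow> bool" where
  "is_adjunction C L A \<longleftrightarrow>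
     is_functor C C L \<and> is_functor C C (radj A) \<and>
     nat_trans C C id_ftor (ftor_comp (radj A) L) (aunit A) \<and>
     nat_trans C C (ftor_comp L (radj A)) id_ftor (acounit A) \<and>
     (\<forall>X \<in> Ob C. acounit A (L \<diamondop> X) \<cdot>\<^bsub>C\<^esub> L \<star> aunit A X = idn\<^bsub>C\<^esub> (L \<diamondop> X)) \<and>
     (\<forall>X \<in> Ob C. radj A \<star> acounit A X \<cdot>\<^bsub>C\<^esub> aunit A (radj A \<diamondop> X) = idn\<^bsub>C\<^esub> (radj A \<diamondop> X))"

definition adjunction_of :: "('o, 'a) cat \<Rightarrow> ('o, 'a) endo \<Rightarrow> ('o, 'a) adj" where
  "adjunction_of C L = (SOME A. is_adjunction C L A)"


section \<open>Binary coproducts\<close>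

definition is_coproduct :: "('o, 'a) cat \<Rightarrow> 'o \<Rightarrow> 'o \<Rightarrow> 'o \<Rightarrow> 'a \<Rightarrow> 'a \<Rightarrow> bool" where
  "is_coproduct C X Y Q i j \<longleftrightarrow>
     i \<in> hom C X Q \<and> j \<in> hom C Y Q \<and>
     (\<forall>Z. \<forall>f \<in> hom C X Z. \<forall>g \<in> hom C Y Z.
        \<exists>!h. h \<in> hom C Q Z \<and> h \<cdot>\<^bsub>C\<^esub> i = f \<and> h \<cdot>\<^bsub>C\<^esub> j = g)"

definition coproduct_of :: "('o, 'a) cat \<Rightarrow> 'o \<Rightarrow> 'o \<Rightarrow> 'o \<times> 'a \<times> 'a" where
  "coproduct_of C X Y = (SOME t. case t of (Q, i, j) \<Rightarrow> is_coproduct C X Y Q i j)"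

definition coprod_ob :: "('o, 'a) cat \<Rightarrow> 'o \<Rightarrow> 'o \<Rightarrow> 'o"  (infixl "\<oplus>\<index>" 65) where
  "X \<oplus>\<^bsub>C\<^esub> Y = fst (coproduct_of C X Y)"

definition inl :: "('o, 'a) cat \<Rightarrow> 'o \<Rightarrow> 'o \<Rightarrow> 'a"  ("inl\<index>") where
  "inl\<^bsub>C\<^esub> X Y = fst (snd (coproduct_of C X Y))"

definition inr :: "('o, 'a) cat \<Rightarrow> 'o \<Rightarrow> 'o \<Rightarrow> 'a"  ("inr\<index>") where
  "inr\<^bsub>C\<^esub> X Y = snd (snd (coproduct_of C X Y))"

definition copair :: "('o, 'a) cat \<Rightarrow> 'a \<Rightarrow> 'a \<Rightarrow> 'a"  ("\<lbrace>_, _\<rbrace>\<index>") where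
  "\<lbrace>f, g\<rbrace>\<^bsub>C\<^esub> = (THE h. h \<in> hom C (Dom C f \<oplus>\<^bsub>C\<^esub> Dom C g) (Cod C f) \<and>
      h \<cdot>\<^bsub>C\<^esub> inl\<^bsub>C\<^esub> (Dom C f) (Dom C g) = f \<and> h \<cdot>\<^bsub>C\<^esub> inr\<^bsub>C\<^esub> (Dom C f) (Dom C g) = g)"

definition coprod_arr :: "('o, 'a) cat \<Rightarrow> 'a \<Rightarrow> 'a \<Rightarrow> 'a"  (infixl "\<boxplus>\<index>" 75) where
  "f \<boxplus>\<^bsub>C\<^esub> g = \<lbrace>inl\<^bsub>C\<^esub> (Cod C f) (Cod C g) \<cdot>\<^bsub>C\<^esub> f, inr\<^bsub>C\<^esub> (Cod C f) (Cod C g) \<cdot>\<^bsub>C\<^esub> g\<rbrace>\<^bsub>C\<^esub>"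

text \<open>
  Ternary coproducts \<open>A + X + Y\<close> are bracketed to the left. For \<open>g: A \<rightarrow> B\<close> the following is the map
  \<open>g + [id, id]: (A + X) + X \<rightarrow> B + X\<close>.
\<close>

definition plus_codiag :: "('o, 'a) cat \<Rightarrow> 'a \<Rightarrow> 'o \<Rightarrow> 'a" where
  "plus_codiag C g X = \<lbrace>g \<boxplus>\<^bsub>C\<^esub> idn\<^bsub>C\<^esub> X, inr\<^bsub>C\<^esub> (Cod C g) X\<rbrace>\<^bsub>C\<^esub>"


section \<open>Smallness, colimits, locally finitely presentable categories\<close>

text \<open>
  The type \<open>'u\<close> plays the role of a Grothendieck universe: a set (over any type) is small if its
  cardinality is strictly below that of \<open>'u\<close>, which is required to be closed under the usual
  operations, i.e. to be of strongly inaccessible cardinality. Up to isomorphism, every small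
  category has its objects and arrows in \<open>'u\<close>.
\<close>

definition small :: "'u itself \<Rightarrow> 'x set \<Rightarrow> bool" where
  "small (_ :: 'u itself) A \<longleftrightarrow> A \<prec> (UNIV :: 'u set)"

definition universe :: "'u itself \<Rightarrow> bool" where
  "universe (U :: 'u itself) \<longleftrightarrow>
     (\<exists>A :: 'u set. infinite A \<and> small U A) \<and>
     (\<forall>A :: 'u set. small U A \<longrightarrow> small U (Pow A)) \<and>
     (\<forall>(A :: 'u set) (B :: 'u \<Rightarrow> 'u set).
        small U A \<and> (\<forall>x \<in> A. small U (B x)) \<longrightarrow> small U (\<Union>x \<in> A. B x))"

definition small_cat :: "('u, 'u) cat \<Rightarrow> bool" where
  "small_cat J \<longleftrightarrow> category J \<and> small TYPE('u) (Ob J) \<and> small TYPE('u) (Arr J)"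

definition filtered :: "('o, 'a) cat \<Rightarrow> bool" where
  "filtered J \<longleftrightarrow> Ob J \<noteq> {} \<and>
     (\<forall>i \<in> Ob J. \<forall>j \<in> Ob J. \<exists>k. hom J i k \<noteq> {} \<and> hom J j k \<noteq> {}) \<and>
     (\<forall>i j. \<forall>f \<in> hom J i j. \<forall>g \<in> hom J i j. \<exists>k. \<exists>h \<in> hom J j k. h \<cdot>\<^bsub>J\<^esub> f = h \<cdot>\<^bsub>J\<^esub> g)"

definition cocone ::
  "('o, 'a) cat \<Rightarrow> ('i, 'j) cat \<Rightarrow> ('i, 'j, 'o, 'a) ftor \<Rightarrow> 'o \<Rightarrow> ('i \<Rightarrow> 'a) \<Rightarrow> bool" where
  "cocone C J D A c \<longleftrightarrow> A \<in> Ob C \<and>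
     (\<forall>i \<in> Ob J. c i \<in> hom C (D \<diamondop> i) A) \<and>
     (\<forall>i j. \<forall>f \<in> hom J i j. c j \<cdot>\<^bsub>C\<^esub> D \<star> f = c i)"

definition colimit ::
  "('o, 'a) cat \<Rightarrow> ('i, 'j) cat \<Rightarrow> ('i, 'j, 'o, 'a) ftor \<Rightarrow> 'o \<Rightarrow> ('i \<Rightarrow> 'a) \<Rightarrow> bool" where
  "colimit C J D A c \<longleftrightarrow> cocone C J D A c \<and>
     (\<forall>B b. cocone C J D B b \<longrightarrow>
        (\<exists>!h. h \<in> hom C A B \<and> (\<forall>i \<in> Ob J. h \<cdot>\<^bsub>C\<^esub> c i = b i)))"

definition preserves_colimits ::
  "('o, 'a) cat \<Rightarrow> ('p, 'b) cat \<Rightarrow> ('o, 'a, 'p, 'b) ftor \<Rightarrow> ('i, 'j) cat \<Rightarrow> bool" where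
  "preserves_colimits C D F J \<longleftrightarrow>
     (\<forall>G A c. is_functor J C G \<and> colimit C J G A c \<longrightarrow>
        colimit D J (ftor_comp F G) (F \<diamondop> A) (\<lambda>i. F \<star> c i))"

definition cocontinuous ::
  "'u itself \<Rightarrow> ('o, 'a) cat \<Rightarrow> ('p, 'b) cat \<Rightarrow> ('o, 'a, 'p, 'b) ftor \<Rightarrow> bool" where
  "cocontinuous (_ :: 'u itself) C D F \<longleftrightarrow>
     is_functor C D F \<and> (\<forall>J :: ('u, 'u) cat. small_cat J \<longrightarrow> preserves_colimits C D F J)"

definition finitary ::
  "'u itself \<Rightarrow> ('o, 'a) cat \<Rightarrow> ('p, 'b) cat \<Rightarrow> ('o, 'a, 'p, 'b) ftor \<Rightarrow> bool" where
  "finitary (_ :: 'u itself) C D F \<longleftrightarrow>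
     is_functor C D F \<and>
     (\<forall>J :: ('u, 'u) cat. small_cat J \<and> filtered J \<longrightarrow> preserves_colimits C D F J)"

text \<open>
  The category of all subsets of a type and all functions between them. It serves as the codomain of
  the functors \<open>Hom(X, -)\<close> when the type is that of the arrows of \<open>C\<close>. Whether a cocone over sets
  is colimiting can be tested on sets with two elements, so for a colimit it is immaterial that not
  all sets embed into the given type.
\<close>

definition sets_cat :: "('x set, 'x set \<times> ('x \<Rightarrow> 'x) \<times> 'x set) cat" where
  "sets_cat = \<lparr>
     Ob = UNIV,
     Arr = {(A, f, B). f \<in> A \<rightarrow>\<^sub>E B},
     Dom = (\<lambda>(A, f, B). A),
     Cod = (\<lambda>(A, f, B). B),
     Idn = (\<lambda>A. (A, \<lambda>x \<in> A. x, A)),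
     Cmp = (\<lambda>(B, g, D) (A, f, B'). (A, compose A g f, D)) \<rparr>"

definition hom_ftor ::
  "('o, 'a) cat \<Rightarrow> 'o \<Rightarrow> ('o, 'a, 'a set, 'a set \<times> ('a \<Rightarrow> 'a) \<times> 'a set) ftor" where
  "hom_ftor C X = \<lparr>
     fob = (\<lambda>Y. hom C X Y),
     far = (\<lambda>f. (hom C X (Dom C f), \<lambda>u \<in> hom C X (Dom C f). f \<cdot>\<^bsub>C\<^esub> u, hom C X (Cod C f))) \<rparr>"

definition finitely_presentable :: "'u itself \<Rightarrow> ('o, 'a) cat \<Rightarrow> 'o \<Rightarrow> bool" where
  "finitely_presentable U C X \<longleftrightarrow> X \<in> Ob C \<and> finitary U C sets_cat (hom_ftor C X)"

definition cocomplete :: "'u itself \<Rightarrow> ('o, 'a) cat \<Rightarrow> bool" where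
  "cocomplete (_ :: 'u itself) C \<longleftrightarrow>
     (\<forall>(J :: ('u, 'u) cat) G. small_cat J \<and> is_functor J C G \<longrightarrow> (\<exists>A c. colimit C J G A c))"

definition locally_finitely_presentable :: "'u itself \<Rightarrow> ('o, 'a) cat \<Rightarrow> bool" where
  "locally_finitely_presentable (U :: 'u itself) C \<longleftrightarrow>
     category C \<and> (\<forall>X \<in> Ob C. \<forall>Y \<in> Ob C. small U (hom C X Y)) \<and>
     cocomplete U C \<and>
     (\<exists>\<G>. small U \<G> \<and> (\<forall>G \<in> \<G>. finitely_presentable U C G) \<and>
        (\<forall>X \<in> Ob C. \<exists>(J :: ('u, 'u) cat) D c.
           small_cat J \<and> filtered J \<and> is_functor J C D \<and>
           (\<forall>i \<in> Ob J. D \<diamondop> i \<in> \<G>) \<and> colimit C J D X c))"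


section \<open>Monads and their algebras\<close>

record ('o, 'a) mnd = "('o, 'a, 'o, 'a) ftor" +
  munit :: "'o \<Rightarrow> 'a"
  mmult :: "'o \<Rightarrow> 'a"

definition is_monad :: "('o, 'a) cat \<Rightarrow> ('o, 'a) mnd \<Rightarrow> bool" where
  "is_monad C M \<longleftrightarrow>
     is_functor C C M \<and>
     nat_trans C C id_ftor M (munit M) \<and>
     nat_trans C C (ftor_comp M M) M (mmult M) \<and>
     (\<forall>X \<in> Ob C. mmult M X \<cdot>\<^bsub>C\<^esub> munit M (M \<diamondop> X) = idn\<^bsub>C\<^esub> (M \<diamondop> X)) \<and>
     (\<forall>X \<in> Ob C. mmult M X \<cdot>\<^bsub>C\<^esub> M \<star> munit M X = idn\<^bsub>C\<^esub> (M \<diamondop> X)) \<and>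
     (\<forall>X \<in> Ob C. mmult M X \<cdot>\<^bsub>C\<^esub> mmult M (M \<diamondop> X) = mmult M X \<cdot>\<^bsub>C\<^esub> M \<star> mmult M X)"

definition monad_morphism ::
  "('o, 'a) cat \<Rightarrow> ('o, 'a) mnd \<Rightarrow> ('o, 'a) mnd \<Rightarrow> ('o \<Rightarrow> 'a) \<Rightarrow> bool" where
  "monad_morphism C M N \<phi> \<longleftrightarrow>
     nat_trans C C M N \<phi> \<and>
     (\<forall>X \<in> Ob C. \<phi> X \<cdot>\<^bsub>C\<^esub> munit M X = munit N X) \<and>
     (\<forall>X \<in> Ob C. \<phi> X \<cdot>\<^bsub>C\<^esub> mmult M X = mmult N X \<cdot>\<^bsub>C\<^esub> N \<star> \<phi> X \<cdot>\<^bsub>C\<^esub> \<phi> (M \<diamondop> X))"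

definition free_monad ::
  "('o, 'a) cat \<Rightarrow> ('o, 'a) endo \<Rightarrow> ('o, 'a) mnd \<Rightarrow> ('o \<Rightarrow> 'a) \<Rightarrow> bool" where
  "free_monad C F M e \<longleftrightarrow>
     is_monad C M \<and> nat_trans C C F M e \<and>
     (\<forall>N \<alpha>. is_monad C N \<and> nat_trans C C F N \<alpha> \<longrightarrow>
        (\<exists>\<phi>. monad_morphism C M N \<phi> \<and> (\<forall>X \<in> Ob C. \<phi> X \<cdot>\<^bsub>C\<^esub> e X = \<alpha> X) \<and>
           (\<forall>\<psi>. monad_morphism C M N \<psi> \<and> (\<forall>X \<in> Ob C. \<psi> X \<cdot>\<^bsub>C\<^esub> e X = \<alpha> X) \<longrightarrow>
              (\<forall>X \<in> Ob C. \<psi> X = \<phi> X))))"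

definition monad_coproduct ::
  "('o, 'a) cat \<Rightarrow> ('o, 'a) mnd \<Rightarrow> ('o, 'a) mnd \<Rightarrow>
   ('o, 'a) mnd \<Rightarrow> ('o \<Rightarrow> 'a) \<Rightarrow> ('o \<Rightarrow> 'a) \<Rightarrow> bool" where
  "monad_coproduct C M M' Q in1 in2 \<longleftrightarrow>
     is_monad C M \<and> is_monad C M' \<and> is_monad C Q \<and>
     monad_morphism C M Q in1 \<and> monad_morphism C M' Q in2 \<and>
     (\<forall>N \<alpha> \<beta>. is_monad C N \<and> monad_morphism C M N \<alpha> \<and> monad_morphism C M' N \<beta> \<longrightarrow>
        (\<exists>\<phi>. monad_morphism C Q N \<phi> \<and>
           (\<forall>X \<in> Ob C. \<phi> X \<cdot>\<^bsub>C\<^esub> in1 X = \<alpha> X \<and> \<phi> X \<cdot>\<^bsub>C\<^esub> in2 X = \<beta> X) \<and>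
           (\<forall>\<psi>. monad_morphism C Q N \<psi> \<and>
              (\<forall>X \<in> Ob C. \<psi> X \<cdot>\<^bsub>C\<^esub> in1 X = \<alpha> X \<and> \<psi> X \<cdot>\<^bsub>C\<^esub> in2 X = \<beta> X) \<longrightarrow>
              (\<forall>X \<in> Ob C. \<psi> X = \<phi> X))))"

definition distributive_law ::
  "('o, 'a) cat \<Rightarrow> ('o, 'a) mnd \<Rightarrow> ('o, 'a) mnd \<Rightarrow> ('o \<Rightarrow> 'a) \<Rightarrow> bool" where
  "distributive_law C S T \<delta> \<longleftrightarrow>
     is_monad C S \<and> is_monad C T \<and>
     nat_trans C C (ftor_comp T S) (ftor_comp S T) \<delta> \<and>
     (\<forall>X \<in> Ob C. \<delta> X \<cdot>\<^bsub>C\<^esub> T \<star> munit S X = munit S (T \<diamondop> X)) \<and>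
     (\<forall>X \<in> Ob C. \<delta> X \<cdot>\<^bsub>C\<^esub> munit T (S \<diamondop> X) = S \<star> munit T X) \<and>
     (\<forall>X \<in> Ob C. \<delta> X \<cdot>\<^bsub>C\<^esub> T \<star> mmult S X
                  = mmult S (T \<diamondop> X) \<cdot>\<^bsub>C\<^esub> S \<star> \<delta> X \<cdot>\<^bsub>C\<^esub> \<delta> (S \<diamondop> X)) \<and>
     (\<forall>X \<in> Ob C. \<delta> X \<cdot>\<^bsub>C\<^esub> mmult T (S \<diamondop> X)
                  = S \<star> mmult T X \<cdot>\<^bsub>C\<^esub> \<delta> (T \<diamondop> X) \<cdot>\<^bsub>C\<^esub> T \<star> \<delta> X)"

definition composite_monad ::
  "('o, 'a) cat \<Rightarrow> ('o, 'a) mnd \<Rightarrow> ('o, 'a) mnd \<Rightarrow> ('o \<Rightarrow> 'a) \<Rightarrow> ('o, 'a) mnd" where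
  "composite_monad C S T \<delta> = \<lparr>
     fob = (\<lambda>X. S \<diamondop> T \<diamondop> X),
     far = (\<lambda>f. S \<star> T \<star> f),
     munit = (\<lambda>X. munit S (T \<diamondop> X) \<cdot>\<^bsub>C\<^esub> munit T X),
     mmult = (\<lambda>X. mmult S (T \<diamondop> X) \<cdot>\<^bsub>C\<^esub> S \<star> S \<star> mmult T X \<cdot>\<^bsub>C\<^esub> S \<star> \<delta> (T \<diamondop> X)) \<rparr>"

definition monad_algebra :: "('o, 'a) cat \<Rightarrow> ('o, 'a) mnd \<Rightarrow> 'o \<Rightarrow> 'a \<Rightarrow> bool" where
  "monad_algebra C M X x \<longleftrightarrow>
     X \<in> Ob C \<and> x \<in> hom C (M \<diamondop> X) X \<and>
     x \<cdot>\<^bsub>C\<^esub> munit M X = idn\<^bsub>C\<^esub> X \<and>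
     x \<cdot>\<^bsub>C\<^esub> mmult M X = x \<cdot>\<^bsub>C\<^esub> M \<star> x"

text \<open>
  Categories of structured objects: \<open>obs\<close> is the set of objects, \<open>u\<close> assigns the underlying object,
  \<open>hm x y f\<close> says that \<open>f\<close> is a homomorphism. Arrows carry their domain and codomain.
\<close>

definition structured_cat ::
  "('o, 'a) cat \<Rightarrow> 'x set \<Rightarrow> ('x \<Rightarrow> 'o) \<Rightarrow> ('x \<Rightarrow> 'x \<Rightarrow> 'a \<Rightarrow> bool) \<Rightarrow> ('x, 'x \<times> 'a \<times> 'x) cat" where
  "structured_cat C obs u hm = \<lparr>
     Ob = obs,
     Arr = {(x, f, y). x \<in> obs \<and> y \<in> obs \<and> f \<in> hom C (u x) (u y) \<and> hm x y f},
     Dom = (\<lambda>(x, f, y). x),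
     Cod = (\<lambda>(x, f, y). y),
     Idn = (\<lambda>x. (x, idn\<^bsub>C\<^esub> (u x), x)),
     Cmp = (\<lambda>(y, g, z) (x, f, y'). (x, g \<cdot>\<^bsub>C\<^esub> f, z)) \<rparr>"

definition forgetful :: "('o \<times> 's, ('o \<times> 's) \<times> 'a \<times> ('o \<times> 's), 'o, 'a) ftor" where
  "forgetful = \<lparr> fob = fst, far = (\<lambda>(x, f, y). f) \<rparr>"

definition Alg ::
  "('o, 'a) cat \<Rightarrow> ('o, 'a) mnd \<Rightarrow> ('o \<times> 'a, ('o \<times> 'a) \<times> 'a \<times> ('o \<times> 'a)) cat" where
  "Alg C M = structured_cat C {(X, x). monad_algebra C M X x} fst
     (\<lambda>(X, x) (Y, y) f. f \<cdot>\<^bsub>C\<^esub> x = y \<cdot>\<^bsub>C\<^esub> M \<star> f)"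

definition iso_of_cats ::
  "('o, 'a) cat \<Rightarrow> ('p, 'b) cat \<Rightarrow> ('o, 'a, 'p, 'b) ftor \<Rightarrow> bool" where
  "iso_of_cats A B F \<longleftrightarrow> is_functor A B F \<and>
     (\<exists>G :: ('p, 'b, 'o, 'a) ftor. is_functor B A G \<and>
        (\<forall>x \<in> Ob A. G \<diamondop> F \<diamondop> x = x) \<and> (\<forall>f \<in> Arr A. G \<star> F \<star> f = f) \<and>
        (\<forall>y \<in> Ob B. F \<diamondop> G \<diamondop> y = y) \<and> (\<forall>g \<in> Arr B. F \<star> G \<star> g = g))"

definition commutes_over ::
  "('o, 'a) cat \<Rightarrow> ('o, 'a, 'p, 'b) ftor \<Rightarrow> ('o, 'a, 'q, 'c) ftor \<Rightarrow> ('p, 'b, 'q, 'c) ftor \<Rightarrow> bool" where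
  "commutes_over A F U V \<longleftrightarrow>
     (\<forall>x \<in> Ob A. V \<diamondop> F \<diamondop> x = U \<diamondop> x) \<and> (\<forall>f \<in> Arr A. V \<star> F \<star> f = U \<star> f)"


section \<open>Incremental structural laws\<close>

text \<open>\<open>ins\<close> is the canonical transformation \<open>\<eta>\<^sub>\<Sigma>\<close> from \<open>Sig\<close> into its free monad \<open>S\<close>.\<close>

context
  fixes C :: "('o, 'a) cat" (structure)
    and Sig :: "('o, 'a) endo"
    and S :: "('o, 'a) mnd"
    and ins :: "'o \<Rightarrow> 'a"
    and T :: "('o, 'a) mnd"
    and \<delta> :: "'o \<Rightarrow> 'a"
    and \<Gamma> :: "('o \<times> 'o, 'a \<times> 'a, 'o, 'a) ftor"
    and d :: "'o \<times> 'o \<Rightarrow> 'a"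
begin

definition ST :: "('o, 'a) mnd" where
  "ST = composite_monad C S T \<delta>"

definition law_source :: "('o \<times> 'o, 'a \<times> 'a, 'o, 'a) ftor" where
  "law_source = \<lparr>
     fob = (\<lambda>(X, Y). \<Gamma> \<diamondop> (Sig \<diamondop> X, Y)),
     far = (\<lambda>(f, g). \<Gamma> \<star> (Sig \<star> f, g)) \<rparr>"

definition law_target :: "('o \<times> 'o, 'a \<times> 'a, 'o, 'a) ftor" where
  "law_target = \<lparr>
     fob = (\<lambda>(X, Y). ST \<diamondop> (\<Gamma> \<diamondop> (X, ST \<diamondop> Y) \<oplus> X \<oplus> Y)),
     far = (\<lambda>(f, g). ST \<star> (\<Gamma> \<star> (f, ST \<star> g) \<boxplus> f \<boxplus> g)) \<rparr>"

definition incremental_structural_law :: "'u itself \<Rightarrow> bool" where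
  "incremental_structural_law U \<longleftrightarrow>
     finitary U C C Sig \<and> free_monad C Sig S ins \<and>
     distributive_law C S T \<delta> \<and>
     (\<forall>I. initial_ob C I \<longrightarrow> iso_arr C (munit T I)) \<and>
     is_functor (prod_cat C C) C \<Gamma> \<and>
     (\<forall>Y \<in> Ob C. cocontinuous U C C
        \<lparr> fob = (\<lambda>X. \<Gamma> \<diamondop> (X, Y)), far = (\<lambda>f. \<Gamma> \<star> (f, idn Y)) \<rparr>) \<and>
     (\<forall>X \<in> Ob C. finitary U C C
        \<lparr> fob = (\<lambda>Y. \<Gamma> \<diamondop> (X, Y)), far = (\<lambda>g. \<Gamma> \<star> (idn X, g)) \<rparr>) \<and>
     nat_trans (prod_cat C C) C law_source law_target d"

subsection \<open>The category of algebras of a law\<close>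

definition law_algebra :: "'o \<Rightarrow> 'a \<Rightarrow> 'a \<Rightarrow> 'a \<Rightarrow> bool" where
  "law_algebra X a b c \<longleftrightarrow>
     monad_algebra C S X a \<and> monad_algebra C T X b \<and> c \<in> hom C (\<Gamma> \<diamondop> (X, X)) X \<and>
     b \<cdot> T \<star> a = a \<cdot> S \<star> b \<cdot> \<delta> X \<and>
     c \<cdot> \<Gamma> \<star> (a \<cdot> ins X, idn X)
       = a \<cdot> S \<star> b \<cdot> ST \<star> \<lbrace>c, idn X\<rbrace>
           \<cdot> ST \<star> plus_codiag C (\<Gamma> \<star> (idn X, a \<cdot> S \<star> b)) X \<cdot> d (X, X)"

definition law_Alg ::
  "('o \<times> 'a \<times> 'a \<times> 'a, ('o \<times> 'a \<times> 'a \<times> 'a) \<times> 'a \<times> ('o \<times> 'a \<times> 'a \<times> 'a)) cat" where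
  "law_Alg = structured_cat C {(X, a, b, c). law_algebra X a b c} fst
     (\<lambda>(X, a, b, c) (X', a', b', c') f.
        f \<cdot> a = a' \<cdot> S \<star> f \<and> f \<cdot> b = b' \<cdot> T \<star> f \<and> f \<cdot> c = c' \<cdot> \<Gamma> \<star> (f, f))"

subsection \<open>The induced distributive law\<close>

definition Gamma_S :: "('o, 'a) endo" where
  "Gamma_S = \<lparr> fob = (\<lambda>X. \<Gamma> \<diamondop> (X, S \<diamondop> X)), far = (\<lambda>f. \<Gamma> \<star> (f, S \<star> f)) \<rparr>"

text \<open>
  \<open>LL Y\<close>, \<open>KK Y\<close> are the functor \<open>L\<^sub>Y\<close> and the monad \<open>K\<^sub>Y\<close>; \<open>RKL Y\<close> is the monad
  \<open>R\<^sub>Y K\<^sub>Y L\<^sub>Y\<close> obtained from an arbitrarily chosen right adjoint \<open>R\<^sub>Y\<close> of \<open>L\<^sub>Y\<close>.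
\<close>

definition LL :: "'o \<Rightarrow> ('o, 'a) endo" where
  "LL Y = \<lparr>
     fob = (\<lambda>X. \<Gamma> \<diamondop> (X, ST \<diamondop> Y) \<oplus> X),
     far = (\<lambda>f. \<Gamma> \<star> (f, idn (ST \<diamondop> Y)) \<boxplus> f) \<rparr>"

definition KK :: "'o \<Rightarrow> ('o, 'a) mnd" where
  "KK Y = \<lparr>
     fob = (\<lambda>A. ST \<diamondop> (A \<oplus> Y)),
     far = (\<lambda>f. ST \<star> (f \<boxplus> idn Y)),
     munit = (\<lambda>A. munit ST (A \<oplus> Y) \<cdot> inl A Y),
     mmult = (\<lambda>A. mmult ST (A \<oplus> Y)
                    \<cdot> ST \<star> \<lbrace>idn (ST \<diamondop> (A \<oplus> Y)), munit ST (A \<oplus> Y) \<cdot> inr A Y\<rbrace>) \<rparr>"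

abbreviation R_adj :: "'o \<Rightarrow> ('o, 'a) adj" where
  "R_adj Y \<equiv> adjunction_of C (LL Y)"

definition RKL :: "'o \<Rightarrow> ('o, 'a) mnd" where
  "RKL Y = \<lparr>
     fob = (\<lambda>X. radj (R_adj Y) \<diamondop> KK Y \<diamondop> LL Y \<diamondop> X),
     far = (\<lambda>f. radj (R_adj Y) \<star> KK Y \<star> LL Y \<star> f),
     munit = (\<lambda>X. radj (R_adj Y) \<star> munit (KK Y) (LL Y \<diamondop> X) \<cdot> aunit (R_adj Y) X),
     mmult = (\<lambda>X. radj (R_adj Y) \<star> mmult (KK Y) (LL Y \<diamondop> X)
                    \<cdot> radj (R_adj Y) \<star> KK Y \<star> acounit (R_adj Y) (KK Y \<diamondop> LL Y \<diamondop> X)) \<rparr>"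

definition h_arr :: "'o \<Rightarrow> 'o \<Rightarrow> 'a" where
  "h_arr X Y =
     (let A = \<Gamma> \<diamondop> (X, ST \<diamondop> ST \<diamondop> Y) \<oplus> X;
          B = \<Gamma> \<diamondop> (X, ST \<diamondop> Y)
      in \<lbrace>ST \<star> (\<Gamma> \<star> (idn X, mmult ST Y) \<boxplus> idn X \<boxplus> idn Y)
            \<cdot> mmult ST (A \<oplus> Y)
            \<cdot> ST \<star> \<lbrace>munit ST (A \<oplus> Y) \<cdot> inl A Y, ST \<star> inr A Y\<rbrace>
            \<cdot> d (X, ST \<diamondop> Y),
          ST \<star> (inl (B \<oplus> X) Y \<cdot> inr B X) \<cdot> S \<star> munit T X \<cdot> ins X\<rbrace>)"

text \<open>
  The monad morphism \<open>S \<rightarrow> RKL Y\<close> extending the transpose of \<open>h_arr\<close>; it is only determined on \<open>Ob C\<close>.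
\<close>

definition h_ext :: "'o \<Rightarrow> 'o \<Rightarrow> 'a" where
  "h_ext Y = (SOME \<phi>. monad_morphism C S (RKL Y) \<phi> \<and>
     (\<forall>X \<in> Ob C. \<phi> X \<cdot> ins X = radj (R_adj Y) \<star> h_arr X Y \<cdot> aunit (R_adj Y) (Sig \<diamondop> X)))"

definition h_bar :: "'o \<Rightarrow> 'o \<Rightarrow> 'a" where
  "h_bar X Y = acounit (R_adj Y) (KK Y \<diamondop> LL Y \<diamondop> X) \<cdot> LL Y \<star> h_ext Y X"

definition d_hat :: "'o \<Rightarrow> 'o \<Rightarrow> 'a" where
  "d_hat X Y = h_bar X Y \<cdot> inl (\<Gamma> \<diamondop> (S \<diamondop> X, ST \<diamondop> Y)) (S \<diamondop> X)
     \<cdot> \<Gamma> \<star> (idn (S \<diamondop> X), S \<star> munit T Y)"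

text \<open>
  The two components of the structure on \<open>S \<diamondop> X\<close> lifted from \<open>b: TX \<rightarrow> X\<close>, \<open>c: \<Gamma>(X, SX) \<rightarrow> X\<close>.
\<close>

definition lift_T :: "'o \<Rightarrow> 'a \<Rightarrow> 'a" where
  "lift_T X b = S \<star> b \<cdot> \<delta> X"

definition lift_Gamma :: "'o \<Rightarrow> 'a \<Rightarrow> 'a \<Rightarrow> 'a" where
  "lift_Gamma X b c =
     S \<star> b \<cdot> ST \<star> \<lbrace>c, idn X\<rbrace> \<cdot> ST \<star> plus_codiag C (\<Gamma> \<star> (idn X, S \<star> b)) X
       \<cdot> d_hat X X \<cdot> \<Gamma> \<star> (idn (S \<diamondop> X), mmult S X)"

text \<open>
  \<open>P\<close> is the coproduct \<open>T \<oplus> T'\<close> with injections \<open>in1\<close>, \<open>in2\<close>, where \<open>T'\<close> is the free monad on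
  \<open>Gamma_S\<close> with canonical transformation \<open>e\<close>.
\<close>

context
  fixes P :: "('o, 'a) mnd"
    and in1 in2 e :: "'o \<Rightarrow> 'a"
begin

definition P_structure :: "'o \<Rightarrow> 'a \<Rightarrow> 'a \<Rightarrow> 'a" where
  "P_structure X b c =
     (THE p. monad_algebra C P X p \<and> p \<cdot> in1 X = b \<and> p \<cdot> in2 X \<cdot> e X = c)"

definition induced_law :: "'o \<Rightarrow> 'a" where
  "induced_law X =
     (let Q = P \<diamondop> X;
          b = mmult P X \<cdot> in1 Q;
          c = mmult P X \<cdot> in2 Q \<cdot> e Q
      in P_structure (S \<diamondop> Q) (lift_T Q b) (lift_Gamma Q b c) \<cdot> P \<star> S \<star> munit P X)"

definition can_S :: "'o \<Rightarrow> 'a" where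
  "can_S X = S \<star> munit P X"

definition can_T :: "'o \<Rightarrow> 'a" where
  "can_T X = munit S (P \<diamondop> X) \<cdot> in1 X"

definition can_Gamma :: "'o \<Rightarrow> 'a" where
  "can_Gamma X = munit S (P \<diamondop> X) \<cdot> in2 X \<cdot> e X \<cdot> \<Gamma> \<star> (idn X, munit S X)"

end

end

end

theory Submission
  imports Defs
begin

text \<open>
  In a locally finitely presentable category every presheaf of small sets that sends colimits to limits
  is representable. This provides the right adjoints of the functors \<open>L\<^sub>Y\<close>, and also the endomorphism
  monads of arrows. Monad morphisms into the latter are algebra structures that make the arrow a
  homomorphism, so the universal properties of \<open>S\<close>, \<open>T'\<close> and \<open>T \<oplus> T'\<close> among monads become statements
  about algebras: \<open>Sig\<close>-algebras are \<open>S\<close>-algebras, and a \<open>(T \<oplus> T')\<close>-algebra is a \<open>T\<close>-algebra with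
  a morphism \<open>\<Gamma>(X, SX) \<rightarrow> X\<close>.

  The monad morphism \<open>S \<rightarrow> R\<^sub>Y K\<^sub>Y L\<^sub>Y\<close> yields a recursion principle: for \<open>ST\<close>-algebras \<open>W\<close>, \<open>Z\<close> and a
  homomorphism \<open>W \<rightarrow> Z\<close>, a morphism \<open>k: \<Gamma>(SX, W) \<rightarrow> Z\<close> is determined by its restriction to \<open>\<Gamma>(X, W)\<close> and a
  recursion equation that involves \<open>d\<close>. For \<open>W = Z = SX\<close> over a \<open>(T \<oplus> T')\<close>-algebra \<open>X\<close> this equation is
  the condition (d2), so it makes \<open>SX\<close> the free \<open>(\<delta>, d)\<close>-algebra on \<open>X\<close>. The lifting of \<open>S\<close> and its unit
  and multiplication are instances of freeness, and for an \<open>S\<close>-algebra \<open>a\<close> on \<open>X\<close> freeness shows that \<open>a\<close> is a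
  homomorphism from the lifted algebra iff \<open>\<Gamma>(X, SX) \<rightarrow> X\<close> is \<open>c \<cdot> \<Gamma>(X, a)\<close> with \<open>c\<close> satisfying (d2).
\<close>


section \<open>Categories, monads and liftings\<close>

text \<open>\<open>free_monad\<close> and \<open>monad_coproduct\<close> are universal among monads
  and do not mention algebras, which is why endomorphism monads enter. Taking them for arrows rather
  than objects yields homomorphisms as well; an identity arrow gives back the case of a single
  object. The obstacle in the recursion is its parameter. The universal property of \<open>S\<close>
  yields solutions whose second argument is a free algebra \<open>STY\<close>, while (d2) has an
  arbitrary \<open>ST\<close>-algebra there. Uniqueness transfers, since a structure map
  \<open>STW \<rightarrow> W\<close> is split by the unit of \<open>ST\<close>. Existence is needed
  for \<open>SX\<close> as a quotient of \<open>STX\<close> along \<open>Sb\<close>; the section of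
  \<open>Sb\<close> at hand is not assumed to be a homomorphism of \<open>ST\<close>-algebras, so
  the descent of the solution has to be derived from uniqueness. Coproducts, right adjoints and the
  extension \<open>S \<rightarrow> RKL\<close> are arbitrary choices in the definitions, so
  everything about them is derived from their defining properties.\<close>

lemma in_hom: "f \<in> hom C X Y \<longleftrightarrow> f \<in> Arr C \<and> Dom C f = X \<and> Cod C f = Y"
  by (simp add: hom_def)

context category
begin

declare Dom_Ob [simp] Cod_Ob [simp]

lemma idn_arr [simp]:
  "X \<in> Ob C \<Longrightarrow> idn X \<in> Arr C" "X \<in> Ob C \<Longrightarrow> Dom C (idn X) = X" "X \<in> Ob C \<Longrightarrow> Cod C (idn X) = X"
  using Idn_hom by (auto simp: in_hom)

lemma Cmp_arr [simp]:
  assumes "f \<in> Arr C" "g \<in> Arr C" "Cod C f = Dom C g"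
  shows "g \<cdot> f \<in> Arr C" "Dom C (g \<cdot> f) = Dom C f" "Cod C (g \<cdot> f) = Cod C g"
  using Cmp_hom[of f "Dom C f" "Cod C f" g "Cod C g"] assms by (auto simp: in_hom)

lemma idn_Cmp [simp]:
  "f \<in> Arr C \<Longrightarrow> Cod C f = X \<Longrightarrow> idn X \<cdot> f = f"
  "f \<in> Arr C \<Longrightarrow> Dom C f = X \<Longrightarrow> f \<cdot> idn X = f"
  using Idn_left Idn_right by (auto simp: in_hom)

text \<open>As a simp rule it makes right-nested composites the normal form; its typing conditions
  are discharged from \<open>Arr\<close>, \<open>Dom\<close> and \<open>Cod\<close>.\<close>

lemma assoc [simp]:
  assumes "f \<in> Arr C" "g \<in> Arr C" "h \<in> Arr C" "Cod C f = Dom C g" "Cod C g = Dom C h"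
  shows "(h \<cdot> g) \<cdot> f = h \<cdot> (g \<cdot> f)"
  using Cmp_assoc[of f "Dom C f" "Cod C f" g "Cod C g" h "Cod C h"] assms by (auto simp: in_hom)

text \<open>In right-nested composites a rule for \<open>g \<cdot> f\<close> does not match once a
  further arrow is composed on the right. This produces the version of an equation with a tail
  \<open>k\<close>; the primed rules below are such versions.\<close>

lemma extend:
  assumes "g \<cdot> f = h" "f \<in> Arr C" "g \<in> Arr C" "Cod C f = Dom C g" "k \<in> Arr C" "Cod C k = Dom C f"
  shows "g \<cdot> (f \<cdot> k) = h \<cdot> k"
  using assms assoc[of k f g] by simp

end

lemma ftor_comp_simps [simp]:
  "ftor_comp G F \<diamondop> X = G \<diamondop> F \<diamondop> X" "ftor_comp G F \<star> f = G \<star> F \<star> f"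
  by (simp_all add: ftor_comp_def)

lemma id_ftor_simps [simp]: "id_ftor \<diamondop> X = X" "id_ftor \<star> f = f"
  by (simp_all add: id_ftor_def)

lemma functor_simps:
  assumes "is_functor C D F"
  shows "X \<in> Ob C \<Longrightarrow> F \<diamondop> X \<in> Ob D"
    and "X \<in> Ob C \<Longrightarrow> F \<star> idn\<^bsub>C\<^esub> X = idn\<^bsub>D\<^esub> (F \<diamondop> X)"
    and "f \<in> Arr C \<Longrightarrow> F \<star> f \<in> Arr D"
    and "f \<in> Arr C \<Longrightarrow> Dom D (F \<star> f) = F \<diamondop> Dom C f"
    and "f \<in> Arr C \<Longrightarrow> Cod D (F \<star> f) = F \<diamondop> Cod C f"
  using assms by (auto simp: is_functor_def in_hom)

lemma functor_Cmp:
  assumes "is_functor C D F" "f \<in> Arr C" "g \<in> Arr C" "Cod C f = Dom C g"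
  shows "F \<star> (g \<cdot>\<^bsub>C\<^esub> f) = F \<star> g \<cdot>\<^bsub>D\<^esub> F \<star> f"
  using assms by (simp add: is_functor_def hom_def)

lemma functorI:
  assumes "category C"
    and "\<And>X. X \<in> Ob C \<Longrightarrow> F \<diamondop> X \<in> Ob D"
    and "\<And>X. X \<in> Ob C \<Longrightarrow> F \<star> idn\<^bsub>C\<^esub> X = idn\<^bsub>D\<^esub> (F \<diamondop> X)"
    and "\<And>f. f \<in> Arr C \<Longrightarrow> F \<star> f \<in> Arr D \<and> Dom D (F \<star> f) = F \<diamondop> Dom C f \<and> Cod D (F \<star> f) = F \<diamondop> Cod C f"
    and "\<And>f g. f \<in> Arr C \<Longrightarrow> g \<in> Arr C \<Longrightarrow> Cod C f = Dom C g \<Longrightarrow>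
           F \<star> (g \<cdot>\<^bsub>C\<^esub> f) = F \<star> g \<cdot>\<^bsub>D\<^esub> F \<star> f"
  shows "is_functor C D F"
  using assms by (auto simp: is_functor_def hom_def)

lemma nat_trans_simps:
  assumes "nat_trans C D F G \<alpha>"
  shows "X \<in> Ob C \<Longrightarrow> \<alpha> X \<in> Arr D"
    and "X \<in> Ob C \<Longrightarrow> Dom D (\<alpha> X) = F \<diamondop> X"
    and "X \<in> Ob C \<Longrightarrow> Cod D (\<alpha> X) = G \<diamondop> X"
  using assms by (auto simp: nat_trans_def in_hom)

lemma nat_trans_nat:
  assumes "nat_trans C D F G \<alpha>" "f \<in> Arr C" "Cod C f = Y"
  shows "\<alpha> Y \<cdot>\<^bsub>D\<^esub> F \<star> f = G \<star> f \<cdot>\<^bsub>D\<^esub> \<alpha> (Dom C f)"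
  using assms by (auto simp: nat_trans_def hom_def)

lemma nat_transI:
  assumes "\<And>X. X \<in> Ob C \<Longrightarrow> \<alpha> X \<in> Arr D \<and> Dom D (\<alpha> X) = F \<diamondop> X \<and> Cod D (\<alpha> X) = G \<diamondop> X"
    and "\<And>f. f \<in> Arr C \<Longrightarrow> \<alpha> (Cod C f) \<cdot>\<^bsub>D\<^esub> F \<star> f = G \<star> f \<cdot>\<^bsub>D\<^esub> \<alpha> (Dom C f)"
  shows "nat_trans C D F G \<alpha>"
  using assms by (auto simp: nat_trans_def hom_def)

locale functor_on = category C for C :: "('o, 'a) cat" (structure) +
  fixes F :: "('o, 'a, 'o, 'a, 'z) ftor_scheme"
  assumes is_functor: "is_functor C C F"
begin

lemmas arr [simp] = functor_simps[OF is_functor]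
lemmas Cmp = functor_Cmp[OF is_functor]

lemma Cmp_rev:
  "f \<in> Arr C \<Longrightarrow> g \<in> Arr C \<Longrightarrow> Cod C f = Dom C g \<Longrightarrow> F \<star> g \<cdot> F \<star> f = F \<star> (g \<cdot> f)"
  by (simp add: Cmp)

lemmas Cmp_rev' = extend[OF Cmp_rev]

end

locale monad = functor_on C M for C :: "('o, 'a) cat" (structure) and M :: "('o, 'a) mnd" +
  assumes is_monad: "is_monad C M"
begin

lemma nat_unit: "nat_trans C C id_ftor M (munit M)"
  and nat_mult: "nat_trans C C (ftor_comp M M) M (mmult M)"
  using is_monad by (auto simp: is_monad_def)

lemma unit_arr [simp]:
  assumes "X \<in> Ob C"
  shows "munit M X \<in> Arr C" "Dom C (munit M X) = X" "Cod C (munit M X) = M \<diamondop> X"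
  using nat_trans_simps[OF nat_unit assms] by auto

lemma mult_arr [simp]:
  assumes "X \<in> Ob C"
  shows "mmult M X \<in> Arr C" "Dom C (mmult M X) = M \<diamondop> M \<diamondop> X" "Cod C (mmult M X) = M \<diamondop> X"
  using nat_trans_simps[OF nat_mult assms] by auto

lemma unit_nat: "f \<in> Arr C \<Longrightarrow> Cod C f = Y \<Longrightarrow> munit M Y \<cdot> f = M \<star> f \<cdot> munit M (Dom C f)"
  using nat_trans_nat[OF nat_unit] by simp

lemma mult_nat: "f \<in> Arr C \<Longrightarrow> Cod C f = Y \<Longrightarrow> mmult M Y \<cdot> M \<star> M \<star> f = M \<star> f \<cdot> mmult M (Dom C f)"
  using nat_trans_nat[OF nat_mult] by simp

lemma unit_left: "X \<in> Ob C \<Longrightarrow> mmult M X \<cdot> munit M (M \<diamondop> X) = idn (M \<diamondop> X)"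
  and unit_right: "X \<in> Ob C \<Longrightarrow> mmult M X \<cdot> M \<star> munit M X = idn (M \<diamondop> X)"
  and mult_assoc: "X \<in> Ob C \<Longrightarrow> mmult M X \<cdot> mmult M (M \<diamondop> X) = mmult M X \<cdot> M \<star> mmult M X"
  using is_monad by (auto simp: is_monad_def)

lemmas unit_nat' = extend[OF unit_nat]
lemmas mult_nat' = extend[OF mult_nat]
lemmas unit_left' = extend[OF unit_left]
lemmas unit_right' = extend[OF unit_right]
lemmas mult_assoc' = extend[OF mult_assoc]

lemma alg_arr:
  assumes "monad_algebra C M X x"
  shows "X \<in> Ob C" "x \<in> Arr C" "Dom C x = M \<diamondop> X" "Cod C x = X"
  using assms by (auto simp: monad_algebra_def in_hom)

lemma alg_unit: "monad_algebra C M X x \<Longrightarrow> x \<cdot> munit M X = idn X"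
  and alg_mult: "monad_algebra C M X x \<Longrightarrow> x \<cdot> mmult M X = x \<cdot> M \<star> x"
  by (auto simp: monad_algebra_def)

lemma algI:
  assumes "X \<in> Ob C" "x \<in> Arr C" "Dom C x = M \<diamondop> X" "Cod C x = X"
    "x \<cdot> munit M X = idn X" "x \<cdot> mmult M X = x \<cdot> M \<star> x"
  shows "monad_algebra C M X x"
  using assms by (auto simp: monad_algebra_def in_hom)

lemma free_alg: "X \<in> Ob C \<Longrightarrow> monad_algebra C M (M \<diamondop> X) (mmult M X)"
  by (rule algI) (auto simp: unit_left mult_assoc)

end

lemma monadI: "category C \<Longrightarrow> is_monad C M \<Longrightarrow> monad C M"
  by (simp add: monad_def monad_axioms_def functor_on_def functor_on_axioms_def is_monad_def)

lemma is_monadI: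
  fixes C (structure)
  assumes "category C" "is_functor C C M"
    and "nat_trans C C id_ftor M (munit M)" "nat_trans C C (ftor_comp M M) M (mmult M)"
    and "\<And>X. X \<in> Ob C \<Longrightarrow> mmult M X \<cdot> munit M (M \<diamondop> X) = idn (M \<diamondop> X)"
    and "\<And>X. X \<in> Ob C \<Longrightarrow> mmult M X \<cdot> M \<star> munit M X = idn (M \<diamondop> X)"
    and "\<And>X. X \<in> Ob C \<Longrightarrow> mmult M X \<cdot> mmult M (M \<diamondop> X) = mmult M X \<cdot> M \<star> mmult M X"
  shows "is_monad C M"
  using assms by (simp add: is_monad_def)

section \<open>Composite monads and the decomposition of their algebras\<close>

locale dist_law = S: monad C S + T: monad C T
  for C :: "('o, 'a) cat" (structure) and S T :: "('o, 'a) mnd" +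
  fixes \<delta> :: "'o \<Rightarrow> 'a"
  assumes dist: "distributive_law C S T \<delta>"
begin

lemma nat_\<delta>: "nat_trans C C (ftor_comp T S) (ftor_comp S T) \<delta>"
  using dist by (simp add: distributive_law_def)

lemma \<delta>_arr [simp]:
  assumes "X \<in> Ob C"
  shows "\<delta> X \<in> Arr C" "Dom C (\<delta> X) = T \<diamondop> S \<diamondop> X" "Cod C (\<delta> X) = S \<diamondop> T \<diamondop> X"
  using nat_trans_simps[OF nat_\<delta> assms] by auto

lemma \<delta>_nat: "f \<in> Arr C \<Longrightarrow> Cod C f = Y \<Longrightarrow> \<delta> Y \<cdot> T \<star> S \<star> f = S \<star> T \<star> f \<cdot> \<delta> (Dom C f)"
  using nat_trans_nat[OF nat_\<delta>] by simp

lemma \<delta>_unit_S: "X \<in> Ob C \<Longrightarrow> \<delta> X \<cdot> T \<star> munit S X = munit S (T \<diamondop> X)"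
  and \<delta>_unit_T: "X \<in> Ob C \<Longrightarrow> \<delta> X \<cdot> munit T (S \<diamondop> X) = S \<star> munit T X"
  using dist by (auto simp: distributive_law_def)

lemma \<delta>_mult_S:
  "X \<in> Ob C \<Longrightarrow> \<delta> X \<cdot> T \<star> mmult S X = mmult S (T \<diamondop> X) \<cdot> (S \<star> \<delta> X \<cdot> \<delta> (S \<diamondop> X))"
  using dist by (auto simp: distributive_law_def)

lemma \<delta>_mult_T:
  "X \<in> Ob C \<Longrightarrow> \<delta> X \<cdot> mmult T (S \<diamondop> X) = S \<star> mmult T X \<cdot> (\<delta> (T \<diamondop> X) \<cdot> T \<star> \<delta> X)"
  using dist by (auto simp: distributive_law_def)

lemmas \<delta>_nat' = S.extend[OF \<delta>_nat]

abbreviation "M \<equiv> composite_monad C S T \<delta>"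

lemma composite_simps:
  "M \<diamondop> X = S \<diamondop> T \<diamondop> X" "M \<star> f = S \<star> T \<star> f"
  "munit M X = munit S (T \<diamondop> X) \<cdot> munit T X"
  "X \<in> Ob C \<Longrightarrow> mmult M X = mmult S (T \<diamondop> X) \<cdot> (S \<star> S \<star> mmult T X \<cdot> S \<star> \<delta> (T \<diamondop> X))"
  by (simp_all add: composite_monad_def)

text \<open>An algebra of the composite monad in Beck's decomposed form; the equation is
  (d1).\<close>

definition compat_alg :: "'o \<Rightarrow> 'a \<Rightarrow> 'a \<Rightarrow> bool" where
  "compat_alg X a b \<longleftrightarrow> monad_algebra C S X a \<and> monad_algebra C T X b \<and> b \<cdot> T \<star> a = a \<cdot> (S \<star> b \<cdot> \<delta> X)"

text \<open>This is the lifting of \<open>S\<close> to \<open>T\<close>-algebras. The laws of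
  \<open>\<delta>\<close> for the unit and multiplication of \<open>T\<close> make the structure an
  algebra, the law for the multiplication of \<open>S\<close> makes \<open>mmult S X\<close> a
  homomorphism.\<close>

lemma lift_compat_alg:
  assumes b: "monad_algebra C T X b"
  shows "compat_alg (S \<diamondop> X) (mmult S X) (S \<star> b \<cdot> \<delta> X)"
proof -
  note [simp] = T.alg_arr[OF b]
  have "monad_algebra C T (S \<diamondop> X) (S \<star> b \<cdot> \<delta> X)"
  proof (rule T.algI)
    show "(S \<star> b \<cdot> \<delta> X) \<cdot> munit T (S \<diamondop> X) = idn (S \<diamondop> X)"
      using T.alg_unit[OF b] by (simp add: \<delta>_unit_T S.Cmp_rev)
    have "(S \<star> b \<cdot> \<delta> X) \<cdot> mmult T (S \<diamondop> X) = S \<star> (b \<cdot> mmult T X) \<cdot> (\<delta> (T \<diamondop> X) \<cdot> T \<star> \<delta> X)"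
      by (simp add: \<delta>_mult_T S.Cmp)
    also have "\<dots> = (S \<star> b \<cdot> \<delta> X) \<cdot> T \<star> (S \<star> b \<cdot> \<delta> X)"
      by (simp add: T.alg_mult[OF b] S.Cmp T.Cmp \<delta>_nat')
    finally show "(S \<star> b \<cdot> \<delta> X) \<cdot> mmult T (S \<diamondop> X) = (S \<star> b \<cdot> \<delta> X) \<cdot> T \<star> (S \<star> b \<cdot> \<delta> X)" .
  qed simp_all
  moreover have "(S \<star> b \<cdot> \<delta> X) \<cdot> T \<star> mmult S X = mmult S X \<cdot> (S \<star> (S \<star> b \<cdot> \<delta> X) \<cdot> \<delta> (S \<diamondop> X))"
    by (simp add: \<delta>_mult_S S.Cmp S.mult_nat')
  ultimately show ?thesis
    by (simp add: compat_alg_def S.free_alg)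
qed

lemma compat_algD:
  assumes "compat_alg X a b"
  shows "monad_algebra C S X a" "monad_algebra C T X b" "b \<cdot> T \<star> a = a \<cdot> (S \<star> b \<cdot> \<delta> X)"
    "X \<in> Ob C" "a \<in> Arr C" "Dom C a = S \<diamondop> X" "Cod C a = X" "b \<in> Arr C" "Dom C b = T \<diamondop> X" "Cod C b = X"
  using assms S.alg_arr T.alg_arr by (auto simp: compat_alg_def)

text \<open>(d1) read backwards trades \<open>a\<close> after
  \<open>S \<star> b \<cdot> \<delta> X\<close> for \<open>b \<cdot> T \<star> a\<close>; this turns
  the distributive law inside \<open>mmult M X\<close> into nested structure maps.\<close>

lemma compat_alg_composite:
  assumes ab: "compat_alg X a b"
  shows "monad_algebra C M X (a \<cdot> S \<star> b)"
proof -
  note [simp] = compat_algD(4-)[OF ab]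
  note a = compat_algD(1)[OF ab] and b = compat_algD(2)[OF ab]
  have "(a \<cdot> S \<star> b) \<cdot> munit M X = a \<cdot> (munit S X \<cdot> (b \<cdot> munit T X))"
    by (simp add: composite_simps S.unit_nat')
  then have unit: "(a \<cdot> S \<star> b) \<cdot> munit M X = idn X"
    by (simp add: S.alg_unit[OF a] T.alg_unit[OF b])
  have "(a \<cdot> S \<star> b) \<cdot> mmult M X = (a \<cdot> mmult S X) \<cdot> (S \<star> S \<star> (b \<cdot> mmult T X) \<cdot> S \<star> \<delta> (T \<diamondop> X))"
    by (simp add: composite_simps S.mult_nat' S.Cmp)
  also have "S \<star> S \<star> (b \<cdot> mmult T X) \<cdot> S \<star> \<delta> (T \<diamondop> X) = S \<star> S \<star> b \<cdot> S \<star> (\<delta> X \<cdot> T \<star> S \<star> b)"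
    by (simp add: T.alg_mult[OF b] S.Cmp \<delta>_nat)
  also have "(a \<cdot> mmult S X) \<cdot> \<dots> = a \<cdot> S \<star> (a \<cdot> (S \<star> b \<cdot> \<delta> X)) \<cdot> S \<star> T \<star> S \<star> b"
    by (simp add: S.alg_mult[OF a] S.Cmp)
  also have "\<dots> = (a \<cdot> S \<star> b) \<cdot> M \<star> (a \<cdot> S \<star> b)"
    by (simp add: compat_algD(3)[OF ab, symmetric] S.Cmp T.Cmp composite_simps)
  finally have "(a \<cdot> S \<star> b) \<cdot> mmult M X = (a \<cdot> S \<star> b) \<cdot> M \<star> (a \<cdot> S \<star> b)" .
  with unit show ?thesis
    by (simp add: monad_algebra_def in_hom composite_simps)
qed

lemma free_compat_alg: "X \<in> Ob C \<Longrightarrow> compat_alg (S \<diamondop> T \<diamondop> X) (mmult S (T \<diamondop> X)) (S \<star> mmult T X \<cdot> \<delta> (T \<diamondop> X))"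
  by (intro lift_compat_alg T.free_alg)

lemma mult_ST: "X \<in> Ob C \<Longrightarrow> mmult M X = mmult S (T \<diamondop> X) \<cdot> S \<star> (S \<star> mmult T X \<cdot> \<delta> (T \<diamondop> X))"
  by (simp add: composite_simps S.Cmp)

text \<open>By \<open>mult_ST\<close> the multiplication is the composite structure of the
  compatible algebra \<open>free_compat_alg\<close>, so associativity and one unit law are instances
  of \<open>compat_alg_composite\<close>. Functoriality, naturality and the other unit law are
  computed.\<close>

lemma is_monad_composite: "is_monad C M"
proof (rule is_monadI)
  show "category C" by (rule S.category_axioms)
  show "is_functor C C M"
    by (rule functorI[OF S.category_axioms]) (auto simp: composite_simps S.Cmp T.Cmp)
  show "nat_trans C C id_ftor M (munit M)"
    by (rule nat_transI) (auto simp: composite_simps S.unit_nat S.unit_nat' S.Cmp_rev S.Cmp_rev' T.unit_nat)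
  show "nat_trans C C (ftor_comp M M) M (mmult M)"
  proof (rule nat_transI)
    fix f assume [simp]: "f \<in> Arr C"
    let ?X = "Dom C f" and ?Y = "Cod C f"
    have "mmult M ?Y \<cdot> M \<star> M \<star> f = mmult S (T \<diamondop> ?Y) \<cdot> S \<star> (S \<star> mmult T ?Y \<cdot> (\<delta> (T \<diamondop> ?Y) \<cdot> T \<star> S \<star> T \<star> f))"
      by (simp add: composite_simps S.Cmp)
    also have "\<dots> = mmult S (T \<diamondop> ?Y) \<cdot> S \<star> (S \<star> (mmult T ?Y \<cdot> T \<star> T \<star> f) \<cdot> \<delta> (T \<diamondop> ?X))"
      by (simp add: \<delta>_nat S.Cmp)
    also have "\<dots> = M \<star> f \<cdot> mmult M ?X"
      by (simp add: T.mult_nat S.Cmp S.mult_nat' composite_simps)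
    finally show "mmult M ?Y \<cdot> ftor_comp M M \<star> f = M \<star> f \<cdot> mmult M ?X" by simp
  qed (simp_all add: composite_simps)
  fix X assume X [simp]: "X \<in> Ob C"
  have alg: "monad_algebra C M (M \<diamondop> X) (mmult M X)"
    using compat_alg_composite[OF free_compat_alg[OF X]] by (simp add: mult_ST) (simp add: composite_simps)
  then show "mmult M X \<cdot> munit M (M \<diamondop> X) = idn (M \<diamondop> X)"
    "mmult M X \<cdot> mmult M (M \<diamondop> X) = mmult M X \<cdot> M \<star> mmult M X"
    by (auto simp: monad_algebra_def)
  have "mmult M X \<cdot> M \<star> munit M X
      = mmult S (T \<diamondop> X) \<cdot> S \<star> (S \<star> mmult T X \<cdot> ((\<delta> (T \<diamondop> X) \<cdot> T \<star> munit S (T \<diamondop> X)) \<cdot> T \<star> munit T X))"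
    by (simp add: composite_simps S.Cmp T.Cmp)
  also have "\<dots> = mmult S (T \<diamondop> X) \<cdot> S \<star> (munit S (T \<diamondop> X) \<cdot> (mmult T X \<cdot> T \<star> munit T X))"
    by (simp add: \<delta>_unit_S S.unit_nat')
  also have "\<dots> = idn (M \<diamondop> X)"
    by (simp add: T.unit_right S.unit_right composite_simps)
  finally show "mmult M X \<cdot> M \<star> munit M X = idn (M \<diamondop> X)" .
qed

text \<open>The converse decomposition restricts \<open>x\<close> along the inclusions of
  \<open>S\<close> and \<open>T\<close>. Most of the claims insert units into the associativity law
  of \<open>x\<close> and cancel them with the axioms of \<open>\<delta>\<close>.\<close>

lemma composite_alg_compat:
  assumes x: "monad_algebra C M X x"
  defines "a \<equiv> x \<cdot> S \<star> munit T X" and "b \<equiv> x \<cdot> munit S (T \<diamondop> X)"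
  shows "compat_alg X a b" "x = a \<cdot> S \<star> b"
proof -
  interpret M: monad C M by (intro monadI S.category_axioms is_monad_composite)
  note x_arr [simp] = M.alg_arr[OF x, unfolded composite_simps]
  have unit: "x \<cdot> (munit S (T \<diamondop> X) \<cdot> munit T X) = idn X"
    using M.alg_unit[OF x] by (simp add: composite_simps)
  \<comment> \<open>Associativity of \<open>x\<close> with an open tail; the choices of
    \<open>f\<close> below put units into the two copies of \<open>ST\<close>.\<close>
  have mult: "x \<cdot> (S \<star> T \<star> x \<cdot> f) = x \<cdot> (mmult S (T \<diamondop> X) \<cdot> (S \<star> S \<star> mmult T X \<cdot> (S \<star> \<delta> (T \<diamondop> X) \<cdot> f)))"
    if "f \<in> Arr C" "Cod C f = S \<diamondop> T \<diamondop> S \<diamondop> T \<diamondop> X" for f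
    using S.extend[OF M.alg_mult[OF x, unfolded composite_simps(2) composite_simps(4)[OF x_arr(1)]], of f] that by simp
  have [simp]: "a \<in> Arr C" "Dom C a = S \<diamondop> X" "Cod C a = X" "b \<in> Arr C" "Dom C b = T \<diamondop> X" "Cod C b = X"
    by (simp_all add: a_def b_def)
  have "monad_algebra C S X a"
  proof (rule S.algI)
    show "a \<cdot> munit S X = idn X"
      using unit by (simp add: a_def S.unit_nat)
    have "a \<cdot> S \<star> a = x \<cdot> (S \<star> T \<star> x \<cdot> (S \<star> munit T (S \<diamondop> T \<diamondop> X) \<cdot> S \<star> S \<star> munit T X))"
      by (simp add: a_def T.Cmp S.Cmp_rev S.Cmp_rev' T.unit_nat T.unit_nat')
    also have "\<dots> = x \<cdot> (mmult S (T \<diamondop> X) \<cdot> (S \<star> S \<star> mmult T X \<cdot> (S \<star> (\<delta> (T \<diamondop> X) \<cdot> munit T (S \<diamondop> T \<diamondop> X)) \<cdot> S \<star> S \<star> munit T X)))"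
      by (simp add: mult S.Cmp)
    also have "\<dots> = x \<cdot> (mmult S (T \<diamondop> X) \<cdot> (S \<star> S \<star> (mmult T X \<cdot> munit T (T \<diamondop> X)) \<cdot> S \<star> S \<star> munit T X))"
      by (simp add: \<delta>_unit_T S.Cmp)
    also have "\<dots> = a \<cdot> mmult S X"
      by (simp add: a_def T.unit_left S.mult_nat)
    finally show "a \<cdot> mmult S X = a \<cdot> S \<star> a" by simp
  qed simp_all
  moreover have "monad_algebra C T X b"
  proof (rule T.algI)
    show "b \<cdot> munit T X = idn X"
      using unit by (simp add: b_def)
    have "b \<cdot> T \<star> b = x \<cdot> (S \<star> T \<star> x \<cdot> (S \<star> T \<star> munit S (T \<diamondop> X) \<cdot> munit S (T \<diamondop> T \<diamondop> X)))"
      by (simp add: b_def S.Cmp T.Cmp S.unit_nat S.unit_nat')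
    also have "\<dots> = x \<cdot> (mmult S (T \<diamondop> X) \<cdot> (S \<star> S \<star> mmult T X \<cdot> (S \<star> (\<delta> (T \<diamondop> X) \<cdot> T \<star> munit S (T \<diamondop> X)) \<cdot> munit S (T \<diamondop> T \<diamondop> X))))"
      by (simp add: mult S.Cmp)
    also have "\<dots> = x \<cdot> ((mmult S (T \<diamondop> X) \<cdot> S \<star> munit S (T \<diamondop> X)) \<cdot> (S \<star> mmult T X \<cdot> munit S (T \<diamondop> T \<diamondop> X)))"
      by (simp add: \<delta>_unit_S S.Cmp_rev S.Cmp_rev' S.unit_nat S.unit_nat')
    also have "\<dots> = b \<cdot> mmult T X"
      by (simp add: b_def S.unit_right S.unit_nat)
    finally show "b \<cdot> mmult T X = b \<cdot> T \<star> b" by simp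
  qed simp_all
  moreover have x_ab: "x = a \<cdot> S \<star> b"
  proof -
    have "a \<cdot> S \<star> b = x \<cdot> (S \<star> T \<star> x \<cdot> (S \<star> munit T (S \<diamondop> T \<diamondop> X) \<cdot> S \<star> munit S (T \<diamondop> X)))"
      by (simp add: a_def b_def T.Cmp S.Cmp_rev S.Cmp_rev' T.unit_nat T.unit_nat')
    also have "\<dots> = x \<cdot> (mmult S (T \<diamondop> X) \<cdot> (S \<star> S \<star> mmult T X \<cdot> (S \<star> (\<delta> (T \<diamondop> X) \<cdot> munit T (S \<diamondop> T \<diamondop> X)) \<cdot> S \<star> munit S (T \<diamondop> X))))"
      by (simp add: mult S.Cmp)
    also have "\<dots> = x \<cdot> (mmult S (T \<diamondop> X) \<cdot> (S \<star> S \<star> (mmult T X \<cdot> munit T (T \<diamondop> X)) \<cdot> S \<star> munit S (T \<diamondop> X)))"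
      by (simp add: \<delta>_unit_T S.Cmp)
    also have "\<dots> = x"
      by (simp add: T.unit_left S.unit_right)
    finally show ?thesis by simp
  qed
  moreover have "b \<cdot> T \<star> a = a \<cdot> (S \<star> b \<cdot> \<delta> X)"
  proof -
    have "b \<cdot> T \<star> a = x \<cdot> (S \<star> T \<star> x \<cdot> (S \<star> T \<star> S \<star> munit T X \<cdot> munit S (T \<diamondop> S \<diamondop> X)))"
      by (simp add: a_def b_def S.Cmp T.Cmp S.unit_nat S.unit_nat')
    also have "\<dots> = x \<cdot> (mmult S (T \<diamondop> X) \<cdot> (S \<star> S \<star> mmult T X \<cdot> (S \<star> (\<delta> (T \<diamondop> X) \<cdot> T \<star> S \<star> munit T X) \<cdot> munit S (T \<diamondop> S \<diamondop> X))))"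
      by (simp add: mult S.Cmp)
    also have "\<dots> = x \<cdot> (mmult S (T \<diamondop> X) \<cdot> (S \<star> S \<star> (mmult T X \<cdot> T \<star> munit T X) \<cdot> (S \<star> \<delta> X \<cdot> munit S (T \<diamondop> S \<diamondop> X))))"
      by (simp add: \<delta>_nat S.Cmp)
    also have "\<dots> = x \<cdot> (mmult S (T \<diamondop> X) \<cdot> (munit S (S \<diamondop> T \<diamondop> X) \<cdot> \<delta> X))"
      by (simp add: T.unit_right S.unit_nat)
    also have "\<dots> = x \<cdot> \<delta> X"
      by (simp add: S.unit_left')
    also have "\<dots> = a \<cdot> (S \<star> b \<cdot> \<delta> X)"
      by (subst x_ab) simp
    finally show ?thesis .
  qed
  ultimately show "compat_alg X a b" "x = a \<cdot> S \<star> b"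
    by (simp_all add: compat_alg_def)
qed

end

section \<open>From liftings to distributive laws (Beck)\<close>

locale lifting = S: monad C S + P: monad C P
  for C :: "('o, 'a) cat" (structure) and S P :: "('o, 'a) mnd" +
  fixes lift :: "'o \<Rightarrow> 'a \<Rightarrow> 'a"
  assumes lift_alg: "monad_algebra C P X p \<Longrightarrow> monad_algebra C P (S \<diamondop> X) (lift X p)"
    and lift_hom: "\<lbrakk>monad_algebra C P X p; monad_algebra C P Y q; f \<in> hom C X Y; f \<cdot> p = q \<cdot> P \<star> f\<rbrakk> \<Longrightarrow>
                     S \<star> f \<cdot> lift X p = lift Y q \<cdot> P \<star> S \<star> f"
    and lift_unit: "monad_algebra C P X p \<Longrightarrow> munit S X \<cdot> p = lift X p \<cdot> P \<star> munit S X"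
    and lift_mult: "monad_algebra C P X p \<Longrightarrow>
                      mmult S X \<cdot> lift (S \<diamondop> X) (lift X p) = lift X p \<cdot> P \<star> mmult S X"
begin

text \<open>Beck's formula for the law of a lifting. \<open>induced_law\<close> has the same shape,
  with the concrete lifted structure in place of \<open>lift\<close>.\<close>

definition law :: "'o \<Rightarrow> 'a" where
  "law X = lift (P \<diamondop> X) (mmult P X) \<cdot> P \<star> S \<star> munit P X"

lemma lift_arr [simp]:
  assumes "monad_algebra C P X p"
  shows "lift X p \<in> Arr C" "Dom C (lift X p) = P \<diamondop> S \<diamondop> X" "Cod C (lift X p) = S \<diamondop> X"
  using P.alg_arr[OF lift_alg[OF assms]] by auto

lemma law_arr [simp]:
  assumes "X \<in> Ob C"
  shows "law X \<in> Arr C" "Dom C (law X) = P \<diamondop> S \<diamondop> X" "Cod C (law X) = S \<diamondop> P \<diamondop> X"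
  using assms P.free_alg[OF assms] by (auto simp: law_def)

text \<open>\<open>p\<close> is a homomorphism from the free algebra
  \<open>P \<diamondop> X\<close>, so \<open>lift_hom\<close> applies to it; it is split by the
  unit, which removes the free algebra again.\<close>

lemma lift_eq_law:
  assumes p: "monad_algebra C P X p"
  shows "lift X p = S \<star> p \<cdot> law X"
proof -
  note [simp] = P.alg_arr[OF p] lift_arr[OF p] P.free_alg lift_arr[OF P.free_alg]
  have "S \<star> p \<cdot> law X = (lift X p \<cdot> P \<star> S \<star> p) \<cdot> P \<star> S \<star> munit P X"
    using lift_hom[OF P.free_alg p, where f = p] P.alg_mult[OF p]
    by (simp add: in_hom law_def flip: S.assoc)
  also have "\<dots> = lift X p"
    by (simp add: P.Cmp_rev S.Cmp_rev P.alg_unit[OF p])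
  finally show ?thesis by simp
qed

text \<open>Each axiom is a closure property of the lifting at a free algebra, restricted along
  \<open>P \<star> S \<star> munit P X\<close>: naturality comes from \<open>lift_hom\<close>, the
  laws for \<open>S\<close> from \<open>lift_unit\<close> and \<open>lift_mult\<close>, those for
  \<open>P\<close> from the lifted map being an algebra.\<close>

lemma distributive_law: "distributive_law C S P law"
proof -
  note [simp] = P.free_alg lift_arr[OF P.free_alg]
  have "nat_trans C C (ftor_comp P S) (ftor_comp S P) law"
  proof (rule nat_transI)
    fix f assume [simp]: "f \<in> Arr C"
    have "S \<star> P \<star> f \<cdot> law (Dom C f) =
        (S \<star> P \<star> f \<cdot> lift (P \<diamondop> Dom C f) (mmult P (Dom C f))) \<cdot> P \<star> S \<star> munit P (Dom C f)"
      by (simp add: law_def)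
    also have "\<dots> = (lift (P \<diamondop> Cod C f) (mmult P (Cod C f)) \<cdot> P \<star> S \<star> P \<star> f) \<cdot> P \<star> S \<star> munit P (Dom C f)"
      by (subst lift_hom[where q = "mmult P (Cod C f)" and Y = "P \<diamondop> Cod C f"]) (auto simp: in_hom P.mult_nat)
    also have "\<dots> = law (Cod C f) \<cdot> P \<star> S \<star> f"
      by (simp add: law_def S.Cmp_rev P.Cmp_rev P.unit_nat)
    finally show "law (Cod C f) \<cdot> ftor_comp P S \<star> f = ftor_comp S P \<star> f \<cdot> law (Dom C f)"
      by simp
  qed auto
  moreover have "law X \<cdot> P \<star> munit S X = munit S (P \<diamondop> X)" if [simp]: "X \<in> Ob C" for X
  proof -
    have "law X \<cdot> P \<star> munit S X = (lift (P \<diamondop> X) (mmult P X) \<cdot> P \<star> munit S (P \<diamondop> X)) \<cdot> P \<star> munit P X"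
      by (simp add: law_def P.Cmp_rev S.unit_nat)
    also have "\<dots> = munit S (P \<diamondop> X)"
      by (subst lift_unit[symmetric]) (simp_all add: P.unit_right)
    finally show ?thesis .
  qed
  moreover have "law X \<cdot> munit P (S \<diamondop> X) = S \<star> munit P X" if [simp]: "X \<in> Ob C" for X
    using S.extend[OF P.alg_unit[OF lift_alg[OF P.free_alg[of X]]], of "S \<star> munit P X"]
    by (simp add: law_def P.unit_nat)
  moreover have "law X \<cdot> P \<star> mmult S X = mmult S (P \<diamondop> X) \<cdot> S \<star> law X \<cdot> law (S \<diamondop> X)"
    if [simp]: "X \<in> Ob C" for X
  proof -
    let ?l = "lift (P \<diamondop> X) (mmult P X)"
    note l = lift_alg[OF P.free_alg[OF that]] and [simp] = lift_arr[OF lift_alg[OF P.free_alg]]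
    have nat: "law (S \<diamondop> P \<diamondop> X) \<cdot> P \<star> S \<star> S \<star> munit P X = S \<star> P \<star> S \<star> munit P X \<cdot> law (S \<diamondop> X)"
      using nat_trans_nat[OF \<open>nat_trans C C (ftor_comp P S) (ftor_comp S P) law\<close>, of "S \<star> munit P X"] by simp
    have "law X \<cdot> P \<star> mmult S X = (?l \<cdot> P \<star> mmult S (P \<diamondop> X)) \<cdot> P \<star> S \<star> S \<star> munit P X"
      by (simp add: law_def P.Cmp_rev S.mult_nat)
    also have "\<dots> = mmult S (P \<diamondop> X) \<cdot> (S \<star> ?l \<cdot> (law (S \<diamondop> P \<diamondop> X) \<cdot> P \<star> S \<star> S \<star> munit P X))"
      by (subst lift_mult[symmetric]) (simp_all add: lift_eq_law[OF l])
    also have "\<dots> = mmult S (P \<diamondop> X) \<cdot> S \<star> law X \<cdot> law (S \<diamondop> X)"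
      by (simp add: nat) (simp add: law_def S.Cmp)
    finally show ?thesis .
  qed
  moreover have "law X \<cdot> mmult P (S \<diamondop> X) = S \<star> mmult P X \<cdot> law (P \<diamondop> X) \<cdot> P \<star> law X"
    if [simp]: "X \<in> Ob C" for X
  proof -
    let ?l = "lift (P \<diamondop> X) (mmult P X)"
    note l = lift_alg[OF P.free_alg[OF that]]
    have "law X \<cdot> mmult P (S \<diamondop> X) = (?l \<cdot> mmult P (S \<diamondop> P \<diamondop> X)) \<cdot> P \<star> P \<star> S \<star> munit P X"
      by (simp add: law_def P.mult_nat)
    also have "\<dots> = ?l \<cdot> P \<star> law X"
      by (subst P.alg_mult[OF l]) (simp add: law_def P.Cmp)
    also have "\<dots> = S \<star> mmult P X \<cdot> law (P \<diamondop> X) \<cdot> P \<star> law X"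
      by (simp add: lift_eq_law[OF P.free_alg])
    finally show ?thesis .
  qed
  ultimately show ?thesis
    unfolding distributive_law_def using S.is_monad P.is_monad by blast
qed

end

section \<open>Representability in locally finitely presentable categories\<close>

lemma small_lepoll: "A \<lesssim> B \<Longrightarrow> small U B \<Longrightarrow> small U A"
  unfolding small_def by (rule lesspoll_trans1)

lemma small_subset: "small U B \<Longrightarrow> A \<subseteq> B \<Longrightarrow> small U A"
  using small_lepoll subset_imp_lepoll by blast

lemma small_image: "small U A \<Longrightarrow> small U (f ` A)"
  using small_lepoll image_lepoll by blast

lemma small_inj_on:
  fixes U :: "'u itself"
  assumes "small U A"
  obtains f :: "'x \<Rightarrow> 'u" where "inj_on f A"
  using assms unfolding small_def by (meson lepoll_def lesspoll_imp_lepoll)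

locale univ =
  fixes U :: "'u itself"
  assumes univ: "universe U"
begin

lemma infinite_UNIV: "infinite (UNIV :: 'u set)"
proof -
  obtain A :: "'u set" where "infinite A" using univ unfolding universe_def by (elim conjE exE) (rule that)
  then show ?thesis using infinite_super[of A UNIV] by simp
qed

lemma small_finite: "finite A \<Longrightarrow> small U A"
  unfolding small_def by (simp add: finite_lesspoll_infinite infinite_UNIV)

text \<open>\<open>universe\<close> quantifies over sets of elements of \<open>'u\<close> only, so
  closure for sets over other types is obtained by moving along an injection into
  \<open>'u\<close>.\<close>

lemma small_Pow:
  assumes "small U A"
  shows "small U (Pow A)"
proof -
  obtain f :: "_ \<Rightarrow> 'u" where f: "inj_on f A" using small_inj_on[OF assms] by blast
  have "small U (Pow (f ` A))"
    using univ small_image[OF assms, of f] by (auto simp: universe_def)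
  moreover have "Pow A \<lesssim> Pow (f ` A)"
    unfolding lepoll_def using f by (intro exI[of _ "image f"]) (auto simp: inj_on_image_Pow)
  ultimately show ?thesis using small_lepoll by blast
qed

text \<open>Elements of the sum are coded in \<open>'u\<close> by a pairing function, which exists
  because \<open>'u\<close> is infinite; closure of the universe under unions then bounds the set of
  codes.\<close>

lemma small_Sigma:
  assumes A: "small U A" and B: "\<And>x. x \<in> A \<Longrightarrow> small U (B x)"
  shows "small U (Sigma A B)"
proof -
  obtain f :: "_ \<Rightarrow> 'u" where f: "inj_on f A" using small_inj_on[OF A] by blast
  have "\<exists>g :: _ \<Rightarrow> 'u. inj_on g (B x)" if "x \<in> A" for x
    using small_inj_on[OF B[OF that]] by blast
  then obtain g :: "_ \<Rightarrow> _ \<Rightarrow> 'u" where g: "\<And>x. x \<in> A \<Longrightarrow> inj_on (g x) (B x)" by metis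
  have "(UNIV :: 'u set) \<times> (UNIV :: 'u set) \<approx> (UNIV :: 'u set)"
    using card_of_Times_same_infinite[OF infinite_UNIV] by (simp only: eqpoll_iff_card_of_ordIso)
  then obtain p :: "'u \<times> 'u \<Rightarrow> 'u" where p: "inj p"
    unfolding eqpoll_def by (metis UNIV_Times_UNIV bij_betw_imp_inj_on)
  let ?h = "\<lambda>(x, y). p (f x, g x y)"
  \<comment> \<open>\<open>?B u\<close> collects the codes over the point coded by \<open>u\<close>,
    so that the union is indexed by elements of \<open>'u\<close>.\<close>
  let ?B = "\<lambda>u. (\<lambda>y. ?h (inv_into A f u, y)) ` B (inv_into A f u)"
  have "small U (\<Union>u\<in>f ` A. ?B u)"
  proof -
    have "\<forall>u\<in>f ` A. small U (?B u)"
      using B by (auto intro!: small_image simp: f inv_into_f_f)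
    then show ?thesis
      using univ small_image[OF A, of f] unfolding universe_def by meson
  qed
  moreover have "?h ` Sigma A B \<subseteq> (\<Union>u\<in>f ` A. ?B u)"
    using f by (force simp: inv_into_f_f)
  ultimately have "small U (?h ` Sigma A B)" by (rule small_subset)
  moreover have "inj_on ?h (Sigma A B)"
  proof (rule inj_onI, clarify)
    fix x y x' y' assume *: "x \<in> A" "y \<in> B x" "x' \<in> A" "y' \<in> B x'" "p (f x, g x y) = p (f x', g x' y')"
    then have "f x = f x'" "g x y = g x' y'" using injD[OF p] by blast+
    then show "x = x' \<and> y = y'" using inj_onD[OF f] inj_onD[OF g] * by blast
  qed
  then have "Sigma A B \<lesssim> ?h ` Sigma A B"
    unfolding lepoll_def by (intro exI[of _ ?h] conjI) auto
  ultimately show ?thesis by (rule small_lepoll[rotated])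
qed

lemma small_Times: "small U A \<Longrightarrow> small U B \<Longrightarrow> small U (A \<times> B)"
  by (rule small_Sigma)

lemma small_UNION:
  assumes "small U A" "\<And>x. x \<in> A \<Longrightarrow> small U (B x)"
  shows "small U (\<Union>x\<in>A. B x)"
proof -
  have "(\<Union>x\<in>A. B x) = snd ` Sigma A B" by force
  then show ?thesis by (simp add: small_image[OF small_Sigma[OF assms]])
qed

end

section \<open>Structured objects as index categories\<close>

lemma hom_structured_cat:
  "hom (structured_cat C obs u hm) x y =
     {(x, f, y) | f. x \<in> obs \<and> y \<in> obs \<and> f \<in> hom C (u x) (u y) \<and> hm x y f}"
  by (auto simp: structured_cat_def hom_def)

lemma category_structured_cat:
  assumes "category C"
    and obs: "\<And>x. x \<in> obs \<Longrightarrow> u x \<in> Ob C"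
    and idn: "\<And>x. x \<in> obs \<Longrightarrow> hm x x (idn\<^bsub>C\<^esub> (u x))"
    and cmp: "\<And>x y z f g. \<lbrakk>x \<in> obs; y \<in> obs; z \<in> obs; f \<in> hom C (u x) (u y); g \<in> hom C (u y) (u z);
                hm x y f; hm y z g\<rbrakk> \<Longrightarrow> hm x z (g \<cdot>\<^bsub>C\<^esub> f)"
  shows "category (structured_cat C obs u hm)"
proof -
  interpret category C by fact
  have "g \<cdot>\<^bsub>structured_cat C obs u hm\<^esub> f \<in> hom (structured_cat C obs u hm) X Z"
    if "f \<in> hom (structured_cat C obs u hm) X Y" "g \<in> hom (structured_cat C obs u hm) Y Z" for f g X Y Z
    using that cmp[of X Y Z] Cmp_hom by (auto simp: hom_structured_cat) (auto simp: structured_cat_def)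
  then show ?thesis
    by unfold_locales (auto simp: structured_cat_def in_hom obs idn)
qed

lemma forgetful_simps [simp]:
  "forgetful \<diamondop> x = fst x" "forgetful \<star> (x, f, y) = f"
  by (simp_all add: forgetful_def)

lemma is_functor_forgetful:
  assumes "\<And>x. x \<in> obs \<Longrightarrow> fst x \<in> Ob C"
  shows "is_functor (structured_cat C obs fst hm) C forgetful"
  using assms by (auto simp: is_functor_def hom_structured_cat) (auto simp: structured_cat_def)

section \<open>Colimits over shapes that live in other types\<close>

locale lfp = category C + univ U for C :: "('o, 'a) cat" (structure) and U :: "'u itself" +
  assumes lfp: "locally_finitely_presentable U C"
begin

lemma small_hom: "small U (hom C X Y)"
proof (cases "hom C X Y = {}")
  case False
  then have "X \<in> Ob C" "Y \<in> Ob C" by (auto simp: in_hom)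
  then show ?thesis using lfp by (auto simp: locally_finitely_presentable_def)
qed (simp add: small_finite)

text \<open>
  Cocompleteness only speaks of shapes with objects and arrows in \<open>'u\<close>, hence the need to transport
  diagrams whose shape lives in another type.
\<close>

lemma transport_diagram:
  assumes J: "category J" and "small U (Ob J)" "small U (Arr J)" and G: "is_functor J C G"
  obtains J' :: "('u, 'u) cat" and G' :: "('u, 'u, 'o, 'a) ftor" and \<phi> where "small_cat J'" "is_functor J' C G'" "bij_betw \<phi> (Ob J) (Ob J')"
    "\<And>i. i \<in> Ob J \<Longrightarrow> G' \<diamondop> \<phi> i = G \<diamondop> i"
    "\<And>i j. i \<in> Ob J \<Longrightarrow> j \<in> Ob J \<Longrightarrow> far G' ` hom J' (\<phi> i) (\<phi> j) = far G ` hom J i j"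
proof -
  interpret J: category J by fact
  obtain \<phi> :: "_ \<Rightarrow> 'u" where \<phi>: "inj_on \<phi> (Ob J)" using small_inj_on assms(2) by blast
  obtain \<psi> :: "_ \<Rightarrow> 'u" where \<psi>: "inj_on \<psi> (Arr J)" using small_inj_on assms(3) by blast
  let ?p = "inv_into (Ob J) \<phi>" and ?q = "inv_into (Arr J) \<psi>"
  have [simp]: "i \<in> Ob J \<Longrightarrow> ?p (\<phi> i) = i" "f \<in> Arr J \<Longrightarrow> ?q (\<psi> f) = f" for i f
    using \<phi> \<psi> by simp_all
  have inj [simp]: "\<phi> i = \<phi> j \<longleftrightarrow> i = j" if "i \<in> Ob J" "j \<in> Ob J" for i j
    using \<phi> that by (auto simp: inj_on_def)
  define J' where "J' = \<lparr>Ob = \<phi> ` Ob J, Arr = \<psi> ` Arr J, Dom = (\<lambda>f. \<phi> (Dom J (?q f))),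
    Cod = (\<lambda>f. \<phi> (Cod J (?q f))), Idn = (\<lambda>i. \<psi> (idn\<^bsub>J\<^esub> (?p i))), Cmp = (\<lambda>g f. \<psi> (?q g \<cdot>\<^bsub>J\<^esub> ?q f))\<rparr>"
  define G' where "G' = \<lparr>fob = (\<lambda>i. G \<diamondop> ?p i), far = (\<lambda>f. G \<star> ?q f)\<rparr>"
  have hom_J': "hom J' i' j' = {\<psi> f | f. f \<in> Arr J \<and> i' = \<phi> (Dom J f) \<and> j' = \<phi> (Cod J f)}" for i' j'
    by (auto simp: hom_def J'_def)
  have cat: "category J'"
  proof
    show "h \<cdot>\<^bsub>J'\<^esub> (g \<cdot>\<^bsub>J'\<^esub> f) = h \<cdot>\<^bsub>J'\<^esub> g \<cdot>\<^bsub>J'\<^esub> f"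
      if "f \<in> hom J' W X" "g \<in> hom J' X Y" "h \<in> hom J' Y Z" for f g h W X Y Z
      using that by (auto simp: hom_J') (simp add: J'_def)
    show "g \<cdot>\<^bsub>J'\<^esub> f \<in> hom J' X Z" if "f \<in> hom J' X Y" "g \<in> hom J' Y Z" for f g X Y Z
      using that by (auto simp: hom_J') (simp add: J'_def, metis J.Cmp_arr)
    show "idn\<^bsub>J'\<^esub> X \<in> hom J' X X" if "X \<in> Ob J'" for X
      using that by (auto simp: hom_J') (auto simp: J'_def)
    show "idn\<^bsub>J'\<^esub> Y \<cdot>\<^bsub>J'\<^esub> f = f" "f \<cdot>\<^bsub>J'\<^esub> idn\<^bsub>J'\<^esub> X = f" if "f \<in> hom J' X Y" for f X Y
      using that by (auto simp: hom_J') (auto simp: J'_def)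
  qed (auto simp: J'_def)
  moreover have "small TYPE('u) (Ob J')" "small TYPE('u) (Arr J')"
    using assms(2,3) by (auto simp: J'_def small_def intro: lesspoll_trans1[OF image_lepoll])
  ultimately have "small_cat J'" by (simp add: small_cat_def)
  moreover have "is_functor J' C G'"
  proof (rule functorI[OF cat])
    fix f g assume "f \<in> Arr J'" "g \<in> Arr J'" "Cod J' f = Dom J' g"
    then show "G' \<star> (g \<cdot>\<^bsub>J'\<^esub> f) = G' \<star> g \<cdot> G' \<star> f"
      by (auto simp: J'_def G'_def functor_Cmp[OF G])
  qed (auto simp: J'_def G'_def functor_simps[OF G])
  moreover have "bij_betw \<phi> (Ob J) (Ob J')"
    using \<phi> by (simp add: bij_betw_def J'_def)
  moreover have "far G' ` hom J' (\<phi> i) (\<phi> j) = far G ` hom J i j" if "i \<in> Ob J" "j \<in> Ob J" for i j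
  proof -
    have "hom J' (\<phi> i) (\<phi> j) = \<psi> ` hom J i j"
      using that by (auto simp: hom_J' in_hom)
    moreover have "(\<lambda>f. G' \<star> \<psi> f) ` hom J i j = far G ` hom J i j"
      by (rule image_cong) (auto simp: G'_def in_hom)
    ultimately show ?thesis by (simp add: image_image)
  qed
  ultimately show thesis
    using that[of J' G' \<phi>] by (simp add: G'_def)
qed

text \<open>A cocone condition sees the arrows of the shape only through their images under the
  diagram, so equality of the sets of images is enough and no bijection between arrows is
  needed.\<close>

lemma transport_cocone:
  assumes \<phi>: "bij_betw \<phi> (Ob J) (Ob J')" "\<And>i. i \<in> Ob J \<Longrightarrow> G' \<diamondop> \<phi> i = G \<diamondop> i"
    "\<And>i j. i \<in> Ob J \<Longrightarrow> j \<in> Ob J \<Longrightarrow> far G' ` hom J' (\<phi> i) (\<phi> j) = far G ` hom J i j"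
    and J: "category J" "category J'"
  shows "cocone C J' G' A c \<longleftrightarrow> cocone C J G A (\<lambda>i. c (\<phi> i))"
proof -
  interpret J: category J by fact
  interpret J': category J' by fact
  have Ob: "Ob J' = \<phi> ` Ob J" using \<phi> by (simp add: bij_betw_def)
  have "(\<forall>i j. \<forall>f \<in> hom J i j. c (\<phi> j) \<cdot> G \<star> f = c (\<phi> i)) \<longleftrightarrow>
        (\<forall>i\<in>Ob J. \<forall>j\<in>Ob J. \<forall>k \<in> far G ` hom J i j. c (\<phi> j) \<cdot> k = c (\<phi> i))"
    by (auto simp: in_hom) 
  also have "\<dots> \<longleftrightarrow> (\<forall>i\<in>Ob J'. \<forall>j\<in>Ob J'. \<forall>k \<in> far G' ` hom J' i j. c j \<cdot> k = c i)"
    by (simp add: Ob flip: \<phi>(3))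
  also have "\<dots> \<longleftrightarrow> (\<forall>i j. \<forall>f \<in> hom J' i j. c j \<cdot> G' \<star> f = c i)"
    by (auto simp: in_hom)
  finally show ?thesis
    unfolding cocone_def by (auto simp: Ob \<phi>(2))
qed

lemma transport_colimit:
  assumes \<phi>: "bij_betw \<phi> (Ob J) (Ob J')" "\<And>i. i \<in> Ob J \<Longrightarrow> G' \<diamondop> \<phi> i = G \<diamondop> i"
    "\<And>i j. i \<in> Ob J \<Longrightarrow> j \<in> Ob J \<Longrightarrow> far G' ` hom J' (\<phi> i) (\<phi> j) = far G ` hom J i j"
    and J: "category J" "category J'"
    and A: "colimit C J' G' A c"
  shows "colimit C J G A (\<lambda>i. c (\<phi> i))"
proof -
  have Ob: "Ob J' = \<phi> ` Ob J" "inj_on \<phi> (Ob J)" using \<phi> by (simp_all add: bij_betw_def)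
  note tr = transport_cocone[OF \<phi> J]
  have "\<exists>!h. h \<in> hom C A B \<and> (\<forall>i\<in>Ob J. h \<cdot> c (\<phi> i) = b i)" if b: "cocone C J G B b" for B b
  proof -
    define b' where "b' = (\<lambda>i. b (inv_into (Ob J) \<phi> i))"
    have "cocone C J G B (\<lambda>i. b' (\<phi> i))"
      using b Ob(2) category.Dom_Ob[OF J(1)] category.Cod_Ob[OF J(1)]
      by (auto simp: cocone_def b'_def in_hom[of _ J])
    then have "\<exists>!h. h \<in> hom C A B \<and> (\<forall>i\<in>Ob J'. h \<cdot> c i = b' i)"
      using A tr unfolding colimit_def by blast
    then show ?thesis by (simp add: Ob b'_def)
  qed
  then show ?thesis using A tr unfolding colimit_def by blast
qed

end

text \<open>
  The assumption \<open>glue\<close> says that the presheaf \<open>\<Phi>\<close> with action \<open>act\<close> sends small colimits to limits.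
\<close>

locale continuous_presheaf = lfp C U for C :: "('o, 'a) cat" (structure) and U :: "'u itself" +
  fixes \<Phi> :: "'o \<Rightarrow> 'x set" and act :: "'x \<Rightarrow> 'a \<Rightarrow> 'x"
  assumes act_in: "f \<in> hom C A B \<Longrightarrow> x \<in> \<Phi> B \<Longrightarrow> act x f \<in> \<Phi> A"
    and act_idn: "A \<in> Ob C \<Longrightarrow> x \<in> \<Phi> A \<Longrightarrow> act x (idn A) = x"
    and act_Cmp: "f \<in> hom C A B \<Longrightarrow> g \<in> hom C B D \<Longrightarrow> x \<in> \<Phi> D \<Longrightarrow> act x (g \<cdot> f) = act (act x g) f"
    and small_values: "A \<in> Ob C \<Longrightarrow> small U (\<Phi> A)"
    and glue: "\<lbrakk>small_cat J; is_functor J C G; colimit C J G A c; \<And>i. i \<in> Ob J \<Longrightarrow> s i \<in> \<Phi> (G \<diamondop> i);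
       \<And>i j f. f \<in> hom J i j \<Longrightarrow> act (s j) (G \<star> f) = s i\<rbrakk> \<Longrightarrow>
       \<exists>!y. y \<in> \<Phi> A \<and> (\<forall>i\<in>Ob (J :: ('u, 'u) cat). act y (c i) = s i)"
begin

text \<open>\<open>glue\<close> and cocompleteness concern shapes over \<open>'u\<close>. The
  colimit and the gluing property are transported together because both must refer to the same
  cocone.\<close>

lemma colimit_glue:
  assumes "category J" "small U (Ob J)" "small U (Arr J)" "is_functor J C G"
  obtains A c where "colimit C J G A c"
    "\<And>x. \<lbrakk>\<And>i. i \<in> Ob J \<Longrightarrow> x i \<in> \<Phi> (G \<diamondop> i); \<And>i j f. f \<in> hom J i j \<Longrightarrow> act (x j) (G \<star> f) = x i\<rbrakk> \<Longrightarrow>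
       \<exists>!y. y \<in> \<Phi> A \<and> (\<forall>i\<in>Ob J. act y (c i) = x i)"
proof -
  interpret J: category J by fact
  show thesis
  proof (rule transport_diagram[OF assms])
    fix J' :: "('u, 'u) cat" and G' :: "('u, 'u, 'o, 'a) ftor" and \<phi>
    assume J': "small_cat J'" "is_functor J' C G'"
      and \<phi>: "bij_betw \<phi> (Ob J) (Ob J')"
      "\<And>i. i \<in> Ob J \<Longrightarrow> G' \<diamondop> \<phi> i = G \<diamondop> i"
      "\<And>i j. i \<in> Ob J \<Longrightarrow> j \<in> Ob J \<Longrightarrow> far G' ` hom J' (\<phi> i) (\<phi> j) = far G ` hom J i j"
    have cat': "category J'" using J' by (simp add: small_cat_def)
    obtain A c where A: "colimit C J' G' A c"
      using lfp J' unfolding locally_finitely_presentable_def cocomplete_def by blast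
    show thesis
    proof (rule that[OF transport_colimit[OF \<phi> assms(1) cat' A]])
      fix x assume x: "\<And>i. i \<in> Ob J \<Longrightarrow> x i \<in> \<Phi> (G \<diamondop> i)" "\<And>i j f. f \<in> hom J i j \<Longrightarrow> act (x j) (G \<star> f) = x i"
      have Ob: "Ob J' = \<phi> ` Ob J" "inj_on \<phi> (Ob J)" using \<phi> by (simp_all add: bij_betw_def)
      let ?p = "inv_into (Ob J) \<phi>"
      have "\<exists>!y. y \<in> \<Phi> A \<and> (\<forall>i\<in>Ob J'. act y (c i) = x (?p i))"
      proof (rule glue[OF J' A])
        show "x (?p i) \<in> \<Phi> (G' \<diamondop> i)" if "i \<in> Ob J'" for i
          using that by (auto simp: Ob \<phi>(2) x(1))
        fix i j f assume f: "f \<in> hom J' i j"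
        then obtain i' j' where ij: "i' \<in> Ob J" "j' \<in> Ob J" "i = \<phi> i'" "j = \<phi> j'"
          using category.Dom_Ob[OF cat'] category.Cod_Ob[OF cat'] Ob by (force simp: in_hom)
        then obtain f' where "f' \<in> hom J i' j'" "G' \<star> f = G \<star> f'"
          using \<phi>(3)[of i' j'] f by blast
        then show "act (x (?p j)) (G' \<star> f) = x (?p i)"
          using x(2) ij Ob(2) by simp
      qed
      then show "\<exists>!y. y \<in> \<Phi> A \<and> (\<forall>i\<in>Ob J. act y (c (\<phi> i)) = x i)"
        by (simp add: Ob)
    qed
  qed
qed

text \<open>A colimit of the forgetful functor from a category of structured objects, with the
  universal property and the gluing condition written out over \<open>obs\<close> and
  \<open>hm\<close>, so that uses need not unfold an index category.\<close>

definition glued_colimit ::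
  "('o \<times> 's) set \<Rightarrow> ('o \<times> 's \<Rightarrow> 'o \<times> 's \<Rightarrow> 'a \<Rightarrow> bool) \<Rightarrow> 'o \<Rightarrow> ('o \<times> 's \<Rightarrow> 'a) \<Rightarrow> bool" where
  "glued_colimit obs hm A c \<longleftrightarrow> A \<in> Ob C \<and> (\<forall>x\<in>obs. c x \<in> hom C (fst x) A) \<and>
     (\<forall>x\<in>obs. \<forall>y\<in>obs. \<forall>f\<in>hom C (fst x) (fst y). hm x y f \<longrightarrow> c y \<cdot> f = c x) \<and>
     (\<forall>B b. B \<in> Ob C \<and> (\<forall>x\<in>obs. b x \<in> hom C (fst x) B) \<and>
        (\<forall>x\<in>obs. \<forall>y\<in>obs. \<forall>f\<in>hom C (fst x) (fst y). hm x y f \<longrightarrow> b y \<cdot> f = b x) \<longrightarrow>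
        (\<exists>!h. h \<in> hom C A B \<and> (\<forall>x\<in>obs. h \<cdot> c x = b x))) \<and>
     (\<forall>s. (\<forall>x\<in>obs. s x \<in> \<Phi> (fst x)) \<and>
        (\<forall>x\<in>obs. \<forall>y\<in>obs. \<forall>f\<in>hom C (fst x) (fst y). hm x y f \<longrightarrow> act (s y) f = s x) \<longrightarrow>
        (\<exists>!y. y \<in> \<Phi> A \<and> (\<forall>x\<in>obs. act y (c x) = s x)))"

lemma glued_colimitD:
  assumes "glued_colimit obs hm A c"
  shows "A \<in> Ob C" "\<And>x. x \<in> obs \<Longrightarrow> c x \<in> hom C (fst x) A"
    "\<And>x y f. \<lbrakk>x \<in> obs; y \<in> obs; f \<in> hom C (fst x) (fst y); hm x y f\<rbrakk> \<Longrightarrow> c y \<cdot> f = c x"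
    "\<And>B b. \<lbrakk>B \<in> Ob C; \<And>x. x \<in> obs \<Longrightarrow> b x \<in> hom C (fst x) B;
        \<And>x y f. \<lbrakk>x \<in> obs; y \<in> obs; f \<in> hom C (fst x) (fst y); hm x y f\<rbrakk> \<Longrightarrow> b y \<cdot> f = b x\<rbrakk> \<Longrightarrow>
       \<exists>!h. h \<in> hom C A B \<and> (\<forall>x\<in>obs. h \<cdot> c x = b x)"
    "\<And>s. \<lbrakk>\<And>x. x \<in> obs \<Longrightarrow> s x \<in> \<Phi> (fst x);
        \<And>x y f. \<lbrakk>x \<in> obs; y \<in> obs; f \<in> hom C (fst x) (fst y); hm x y f\<rbrakk> \<Longrightarrow> act (s y) f = s x\<rbrakk> \<Longrightarrow>
       \<exists>!y. y \<in> \<Phi> A \<and> (\<forall>x\<in>obs. act y (c x) = s x)"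
  using assms unfolding glued_colimit_def by simp_all

lemma glued_colimit_exists:
  fixes obs :: "('o \<times> 's) set"
  assumes cat: "category (structured_cat C obs fst hm)" and small: "small U obs"
    and obs: "\<And>x. x \<in> obs \<Longrightarrow> fst x \<in> Ob C"
  shows "\<exists>A c. glued_colimit obs hm A c"
proof -
  let ?J = "structured_cat C obs fst hm"
  have Ob_J [simp]: "Ob ?J = obs" by (simp add: structured_cat_def)
  have sA: "small U (Arr ?J)"
  proof (rule small_subset)
    show "small U (\<Union>x\<in>obs. \<Union>y\<in>obs. {x} \<times> hom C (fst x) (fst y) \<times> {y})"
      by (intro small_UNION small small_Times small_hom small_finite) auto
    show "Arr ?J \<subseteq> \<dots>" by (auto simp: structured_cat_def)
  qed
  have sO: "small U (Ob ?J)" using small by simp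
  have "is_functor ?J C forgetful" using is_functor_forgetful obs by blast
  then show ?thesis
  proof (rule colimit_glue[OF cat sO sA])
    fix A c assume A: "colimit C ?J forgetful A c"
      and g: "\<And>x. \<lbrakk>\<And>i. i \<in> Ob ?J \<Longrightarrow> x i \<in> \<Phi> (forgetful \<diamondop> i);
        \<And>i j f. f \<in> hom ?J i j \<Longrightarrow> act (x j) (forgetful \<star> f) = x i\<rbrakk> \<Longrightarrow>
       \<exists>!y. y \<in> \<Phi> A \<and> (\<forall>i\<in>Ob ?J. act y (c i) = x i)"
    have co: "cocone C ?J forgetful B b \<longleftrightarrow> B \<in> Ob C \<and> (\<forall>x\<in>obs. b x \<in> hom C (fst x) B) \<and>
      (\<forall>x\<in>obs. \<forall>y\<in>obs. \<forall>f\<in>hom C (fst x) (fst y). hm x y f \<longrightarrow> b y \<cdot> f = b x)" for B b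
      by (auto simp: cocone_def hom_structured_cat)
    have "\<exists>!y. y \<in> \<Phi> A \<and> (\<forall>x\<in>obs. act y (c x) = s x)"
      if "\<forall>x\<in>obs. s x \<in> \<Phi> (fst x)"
        "\<forall>x\<in>obs. \<forall>y\<in>obs. \<forall>f\<in>hom C (fst x) (fst y). hm x y f \<longrightarrow> act (s y) f = s x" for s
    proof (rule g[unfolded Ob_J])
      show "s x \<in> \<Phi> (forgetful \<diamondop> x)" if "x \<in> obs" for x using that \<open>\<forall>x\<in>obs. s x \<in> \<Phi> (fst x)\<close> by simp
      show "act (s y) (forgetful \<star> f) = s x" if "f \<in> hom ?J x y" for x y f
        using that \<open>\<forall>x\<in>obs. \<forall>y\<in>obs. \<forall>f\<in>_. _\<close> by (auto simp: hom_structured_cat)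
    qed
    then have "glued_colimit obs hm A c"
      using A unfolding glued_colimit_def colimit_def co Ob_J by simp
    then show ?thesis by blast
  qed
qed

text \<open>The candidate is the colimit of all elements of \<open>\<Phi>\<close> over the small set
  of generators. An element over an arbitrary \<open>A\<close> restricts to elements over the
  generators of which \<open>A\<close> is a colimit; the corresponding coprojections form a cocone,
  and its mediating arrow has the required property because gluing over \<open>A\<close> is
  unique.\<close>

lemma weakly_terminal_element:
  obtains W w where "W \<in> Ob C" "w \<in> \<Phi> W" "\<And>A x. A \<in> Ob C \<Longrightarrow> x \<in> \<Phi> A \<Longrightarrow> \<exists>f\<in>hom C A W. act w f = x"
proof -
  obtain \<G> where \<G>: "small U \<G>" "\<And>G. G \<in> \<G> \<Longrightarrow> G \<in> Ob C"
    and gen: "\<And>X. X \<in> Ob C \<Longrightarrow> \<exists>(J :: ('u, 'u) cat) D c.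
           small_cat J \<and> filtered J \<and> is_functor J C D \<and>
           (\<forall>i \<in> Ob J. D \<diamondop> i \<in> \<G>) \<and> colimit C J D X c"
    using lfp unfolding locally_finitely_presentable_def finitely_presentable_def by auto
  let ?obs = "Sigma \<G> \<Phi>" and ?hm = "\<lambda>x y f. act (snd y) f = snd x"
  have cat: "category (structured_cat C ?obs fst ?hm)"
    by (rule category_structured_cat[OF category_axioms]) (auto simp: \<G> act_idn act_Cmp)
  have small: "small U ?obs"
    by (intro small_Sigma \<G> small_values)
  have obs: "\<And>x. x \<in> ?obs \<Longrightarrow> fst x \<in> Ob C" using \<G> by auto
  obtain W c where "glued_colimit ?obs ?hm W c" using glued_colimit_exists[OF cat small obs] by blast
  note W = glued_colimitD(1-3)[OF this] and gW = glued_colimitD(5)[OF this]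
  \<comment> \<open>The tautological family, which assigns to each index its own element, glues to
    one element over the colimit.\<close>
  obtain w where w: "w \<in> \<Phi> W" "\<And>x. x \<in> ?obs \<Longrightarrow> act w (c x) = snd x"
    using gW[of snd] by auto
  show thesis
  proof (rule that[OF W(1) w(1)])
    fix A x assume A: "A \<in> Ob C" and x: "x \<in> \<Phi> A"
    obtain J :: "('u, 'u) cat" and D a where J: "small_cat J" "is_functor J C D" "\<forall>i \<in> Ob J. D \<diamondop> i \<in> \<G>"
      "colimit C J D A a" using gen[OF A] by blast
    interpret J: category J using J by (simp add: small_cat_def)
    have a: "\<And>i. i \<in> Ob J \<Longrightarrow> a i \<in> hom C (D \<diamondop> i) A" "\<And>i j f. f \<in> hom J i j \<Longrightarrow> a j \<cdot> D \<star> f = a i"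
      using J by (auto simp: colimit_def cocone_def)
    let ?o = "\<lambda>i. (D \<diamondop> i, act x (a i))"
    have o: "?o i \<in> ?obs" if "i \<in> Ob J" for i
      using that J act_in[OF a(1) x] by auto
    have D: "D \<star> f \<in> hom C (D \<diamondop> i) (D \<diamondop> j)" if "f \<in> hom J i j" for f i j
      using that functor_simps[OF J(2)] by (auto simp: in_hom)
    have ij: "i \<in> Ob J" "j \<in> Ob J" if "f \<in> hom J i j" for f i j
      using that by (auto simp: in_hom)
    have comp: "act (act x (a j)) (D \<star> f) = act x (a i)" if "f \<in> hom J i j" for f i j
      using act_Cmp[OF D[OF that] a(1) x] a(2)[OF that] ij[OF that] by simp
    have "cocone C J D W (\<lambda>i. c (?o i))"
      unfolding cocone_def
    proof (intro conjI ballI allI)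
      show "c (?o i) \<in> hom C (D \<diamondop> i) W" if "i \<in> Ob J" for i using W(2)[OF o[OF that]] by simp
      show "c (?o j) \<cdot> D \<star> f = c (?o i)" if "f \<in> hom J i j" for i j f
        using W(3)[OF o o, of i j "D \<star> f"] ij[OF that] D[OF that] comp[OF that] by simp
    qed fact
    then obtain h where h: "h \<in> hom C A W" "\<And>i. i \<in> Ob J \<Longrightarrow> h \<cdot> a i = c (?o i)"
      using J(4) unfolding colimit_def by blast
    \<comment> \<open>\<open>x\<close> and \<open>act w h\<close> restrict to the same family along
      the cocone \<open>a\<close>, so the uniqueness part of \<open>glue\<close> identifies
      them.\<close>
    have "\<exists>!y. y \<in> \<Phi> A \<and> (\<forall>i\<in>Ob J. act y (a i) = act x (a i))"
      by (rule glue[OF J(1,2,4)]) (use act_in[OF a(1) x] comp in auto)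
    moreover have "act (act w h) (a i) = act x (a i)" if "i \<in> Ob J" for i
      using act_Cmp[OF a(1)[OF that] h(1) w(1)] h(2)[OF that] w(2)[OF o[OF that]] by simp
    ultimately have "act w h = x" using act_in[OF h(1) w(1)] x by blast
    with h(1) show "\<exists>f\<in>hom C A W. act w f = x" by blast
  qed
qed

text \<open>
  Freyd's argument: the joint coequalizer of all endomorphisms of a weakly terminal element is terminal.
\<close>

theorem representable:
  obtains R r where "R \<in> Ob C" "r \<in> \<Phi> R"
    "\<And>A x. A \<in> Ob C \<Longrightarrow> x \<in> \<Phi> A \<Longrightarrow> \<exists>!f. f \<in> hom C A R \<and> act r f = x"
proof -
  obtain W w where W: "W \<in> Ob C" "w \<in> \<Phi> W"
    and wt: "\<And>A x. A \<in> Ob C \<Longrightarrow> x \<in> \<Phi> A \<Longrightarrow> \<exists>f\<in>hom C A W. act w f = x"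
    using weakly_terminal_element by metis
  \<comment> \<open>One object and, as arrows, all endomorphisms of \<open>W\<close> that fix
    \<open>w\<close>: the colimit of this shape is the joint coequalizer.\<close>
  let ?obs = "{(W, w)}" and ?hm = "\<lambda>x y f. act w f = w"
  have cat: "category (structured_cat C ?obs fst ?hm)"
    by (rule category_structured_cat[OF category_axioms])
      (use W act_idn act_Cmp[OF _ _ W(2)] in auto)
  obtain V c where "glued_colimit ?obs ?hm V c"
    using glued_colimit_exists[OF cat small_finite] W(1) by auto
  note V = glued_colimitD(1-3)[OF this] and colim = glued_colimitD(4)[OF this] and gV = glued_colimitD(5)[OF this]
  define q where "q = c (W, w)"
  have q: "q \<in> hom C W V" using V(2) by (simp add: q_def)
  have q_endo: "q \<cdot> f = q" if "f \<in> hom C W W" "act w f = w" for f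
    using V(3)[of "(W, w)" "(W, w)" f] that by (simp add: q_def)
  have q_epi: "f = g" if f: "f \<in> hom C V B" and g: "g \<in> hom C V B" and eq: "f \<cdot> q = g \<cdot> q" for f g B
  proof -
    have "\<exists>!h. h \<in> hom C V B \<and> (\<forall>x\<in>?obs. h \<cdot> c x = f \<cdot> q)"
    proof (rule colim)
      show "B \<in> Ob C" using f by (auto simp: in_hom)
      show "\<And>x. x \<in> ?obs \<Longrightarrow> f \<cdot> q \<in> hom C (fst x) B" using f q by (auto simp: in_hom)
      show "(f \<cdot> q) \<cdot> k = f \<cdot> q" if "x \<in> ?obs" "y \<in> ?obs" "k \<in> hom C (fst x) (fst y)" "act w k = w" for x y k
        using f q q_endo[of k] that by (auto simp: in_hom)
    qed
    then show ?thesis using f g eq by (auto simp: q_def)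
  qed
  \<comment> \<open>\<open>w\<close> is invariant under these endomorphisms and therefore descends
    to an element over \<open>V\<close>.\<close>
  have "\<exists>!y. y \<in> \<Phi> V \<and> (\<forall>x\<in>?obs. act y (c x) = w)"
    by (rule gV) (use W in auto)
  then obtain v where v: "v \<in> \<Phi> V" "act v q = w"
    by (auto simp: q_def)
  show thesis
  proof (rule that[OF V(1) v(1)])
    fix A x assume A: "A \<in> Ob C" and x: "x \<in> \<Phi> A"
    obtain h where h: "h \<in> hom C A W" "act w h = x" using wt[OF A x] by blast
    have ex: "q \<cdot> h \<in> hom C A V \<and> act v (q \<cdot> h) = x"
      using h q v act_Cmp[OF h(1) q v(1)] by (simp add: in_hom)
    moreover have "f = g" if f: "f \<in> hom C A V" "act v f = x" and g: "g \<in> hom C A V" "act v g = x" for f g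
    proof -
      \<comment> \<open>The parallel pair \<open>f\<close>, \<open>g\<close> as an index category,
        whose colimit coequalizes them. The Boolean tags keep the two objects apart even when
        \<open>A = V\<close>.\<close>
      let ?obs = "{(A, False), (V, True)}"
        and ?hm = "\<lambda>x y k. (snd x = snd y \<and> k = idn (fst x)) \<or> (\<not> snd x \<and> snd y \<and> k \<in> {f, g})"
      have cat: "category (structured_cat C ?obs fst ?hm)"
        by (rule category_structured_cat[OF category_axioms]) (use A V f g in \<open>auto simp: in_hom\<close>)
      have obs: "fst x \<in> Ob C" if "x \<in> ?obs" for x using that A V by auto
      obtain Z c where "glued_colimit ?obs ?hm Z c" using glued_colimit_exists[OF cat small_finite obs] by blast
      note Z = glued_colimitD(1-3)[OF this] and gZ = glued_colimitD(5)[OF this]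
      define z where "z = c (V, True)"
      have z: "z \<in> hom C V Z" using Z(2)[of "(V, True)"] by (simp add: z_def)
      have zf: "z \<cdot> f = z \<cdot> g"
        using Z(3)[of "(A, False)" "(V, True)" f] Z(3)[of "(A, False)" "(V, True)" g] f g by (simp add: z_def)
      have "\<exists>!y. y \<in> \<Phi> Z \<and> (\<forall>o'\<in>?obs. act y (c o') = (if snd o' then v else x))"
      proof (rule gZ)
        show "(if snd o' then v else x) \<in> \<Phi> (fst o')" if "o' \<in> ?obs" for o'
          using that v(1) x by fastforce
        fix o' o'' k assume o': "o'' \<in> ?obs" "o' \<in> ?obs" "?hm o'' o' k"
        have "(o'' = (A, False) \<and> o' = (A, False) \<and> k = idn A) \<or> (o'' = (V, True) \<and> o' = (V, True) \<and> k = idn V) \<or>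
          (o'' = (A, False) \<and> o' = (V, True) \<and> k \<in> {f, g})"
          using o' by auto
        moreover have "act v k = x" if "k \<in> {f, g}" using that f(2) g(2) by blast
        moreover have "act v (idn V) = v" "act x (idn A) = x" using act_idn A V(1) x v(1) by blast+
        ultimately show "act (if snd o' then v else x) k = (if snd o'' then v else x)"
          by (elim disjE conjE) (simp_all only: snd_conv if_True if_False)
      qed
      then obtain v' where v': "v' \<in> \<Phi> Z" "act v' z = v"
        by (auto simp: z_def)
      obtain r where r: "r \<in> hom C Z W" "act w r = v'" using wt[OF Z(1) v'(1)] by blast
      have zq: "z \<cdot> q \<in> hom C W Z" using z q by (auto simp: in_hom)
      \<comment> \<open>\<open>r \<cdot> (z \<cdot> q)\<close> is one of the endomorphisms absorbed
        by \<open>q\<close>. As \<open>q\<close> is epi, \<open>q \<cdot> r\<close> is a left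
        inverse of \<open>z\<close>, and \<open>z\<close> identifies \<open>f\<close> with
        \<open>g\<close>.\<close>
      have "act w (r \<cdot> (z \<cdot> q)) = w"
        using act_Cmp[OF zq r(1) W(2)] act_Cmp[OF q z v'(1)] r v' v by simp
      then have "q \<cdot> (r \<cdot> (z \<cdot> q)) = q"
        using q_endo[of "r \<cdot> (z \<cdot> q)"] r z q by (simp add: in_hom)
      have qrz: "q \<cdot> (r \<cdot> z) = idn V"
        by (rule q_epi) (use \<open>q \<cdot> (r \<cdot> (z \<cdot> q)) = q\<close> q r z V(1) in \<open>auto simp: in_hom\<close>)
      have "f = (q \<cdot> (r \<cdot> z)) \<cdot> f" unfolding qrz using f by (simp add: in_hom)
      also have "\<dots> = q \<cdot> (r \<cdot> (z \<cdot> f))" using q r z f by (simp add: in_hom)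
      also have "\<dots> = (q \<cdot> (r \<cdot> z)) \<cdot> g" unfolding zf using q r z g by (simp add: in_hom)
      also have "\<dots> = g" unfolding qrz using g by (simp add: in_hom)
      finally show ?thesis .
    qed
    ultimately show "\<exists>!f. f \<in> hom C A V \<and> act v f = x" by blast
  qed
qed

end

section \<open>Coproducts, right adjoints, and algebras of free monads\<close>

locale coprod_category = category C for C :: "('o, 'a) cat" (structure) +
  assumes coproducts: "X \<in> Ob C \<Longrightarrow> Y \<in> Ob C \<Longrightarrow> \<exists>Q i j. is_coproduct C X Y Q i j"
begin

lemma is_coproduct_of:
  assumes "X \<in> Ob C" "Y \<in> Ob C"
  shows "is_coproduct C X Y (X \<oplus> Y) (inl X Y) (inr X Y)"
proof -
  have "\<exists>t. case t of (Q, i, j) \<Rightarrow> is_coproduct C X Y Q i j"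
    using coproducts[OF assms] by auto
  from someI_ex[OF this] show ?thesis
    by (simp add: coprod_ob_def inl_def inr_def coproduct_of_def split: prod.splits)
qed

lemma inj_arr [simp]:
  assumes "X \<in> Ob C" "Y \<in> Ob C"
  shows "inl X Y \<in> Arr C" "Dom C (inl X Y) = X" "Cod C (inl X Y) = X \<oplus> Y"
    "inr X Y \<in> Arr C" "Dom C (inr X Y) = Y" "Cod C (inr X Y) = X \<oplus> Y" "X \<oplus> Y \<in> Ob C"
proof -
  show "inl X Y \<in> Arr C" "Dom C (inl X Y) = X" "Cod C (inl X Y) = X \<oplus> Y"
    "inr X Y \<in> Arr C" "Dom C (inr X Y) = Y" "Cod C (inr X Y) = X \<oplus> Y"
    using is_coproduct_of[OF assms] by (auto simp: is_coproduct_def in_hom)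
  then show "X \<oplus> Y \<in> Ob C" using Cod_Ob by metis
qed

lemma copair_props:
  assumes "f \<in> Arr C" "g \<in> Arr C" "Cod C f = Cod C g"
  shows "\<lbrace>f, g\<rbrace> \<in> hom C (Dom C f \<oplus> Dom C g) (Cod C f) \<and>
    \<lbrace>f, g\<rbrace> \<cdot> inl (Dom C f) (Dom C g) = f \<and> \<lbrace>f, g\<rbrace> \<cdot> inr (Dom C f) (Dom C g) = g"
  unfolding copair_def
  by (rule theI') (use is_coproduct_of[of "Dom C f" "Dom C g"] assms in \<open>auto simp: is_coproduct_def in_hom\<close>)

lemma copair_arr [simp]:
  assumes "f \<in> Arr C" "g \<in> Arr C" "Cod C f = Cod C g"
  shows "\<lbrace>f, g\<rbrace> \<in> Arr C" "Dom C \<lbrace>f, g\<rbrace> = Dom C f \<oplus> Dom C g" "Cod C \<lbrace>f, g\<rbrace> = Cod C f"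
  using copair_props[OF assms] by (auto simp: in_hom)

lemma copair_inj [simp]:
  assumes "f \<in> Arr C" "g \<in> Arr C" "Cod C f = Cod C g" "Dom C f = X" "Dom C g = Y"
  shows "\<lbrace>f, g\<rbrace> \<cdot> inl X Y = f" "\<lbrace>f, g\<rbrace> \<cdot> inr X Y = g"
  using copair_props[OF assms(1-3)] assms by auto

lemmas copair_inj' [simp] = extend[OF copair_inj(1)] extend[OF copair_inj(2)]

lemma coprod_eqI:
  assumes "X \<in> Ob C" "Y \<in> Ob C" "h \<in> Arr C" "k \<in> Arr C" "Dom C h = X \<oplus> Y" "Dom C k = X \<oplus> Y"
    "h \<cdot> inl X Y = k \<cdot> inl X Y" "h \<cdot> inr X Y = k \<cdot> inr X Y"
  shows "h = k"
proof -
  let ?Z = "Cod C h"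
  have "Cod C h = Cod C k"
    using assms Cmp_arr(3)[of "inl X Y" h] Cmp_arr(3)[of "inl X Y" k] by simp
  moreover have "\<exists>!l. l \<in> hom C (X \<oplus> Y) ?Z \<and> l \<cdot> inl X Y = h \<cdot> inl X Y \<and> l \<cdot> inr X Y = h \<cdot> inr X Y"
  proof -
    have "h \<cdot> inl X Y \<in> hom C X ?Z" "h \<cdot> inr X Y \<in> hom C Y ?Z"
      using assms(1-6) by (simp_all add: in_hom)
    then show ?thesis using is_coproduct_of[OF assms(1,2)] unfolding is_coproduct_def by blast
  qed
  ultimately show ?thesis using assms by (auto simp: in_hom)
qed

lemma Cmp_copair [simp]:
  assumes "f \<in> Arr C" "g \<in> Arr C" "Cod C f = Cod C g" "h \<in> Arr C" "Dom C h = Cod C f"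
  shows "h \<cdot> \<lbrace>f, g\<rbrace> = \<lbrace>h \<cdot> f, h \<cdot> g\<rbrace>"
  by (rule coprod_eqI[of "Dom C f" "Dom C g"]) (use assms in auto)

lemmas Cmp_copair' [simp] = extend[OF Cmp_copair]

lemma copair_inl_inr [simp]: "X \<in> Ob C \<Longrightarrow> Y \<in> Ob C \<Longrightarrow> \<lbrace>inl X Y, inr X Y\<rbrace> = idn (X \<oplus> Y)"
  by (rule coprod_eqI[of X Y]) auto

lemma coprod_arr_arr [simp]:
  assumes "f \<in> Arr C" "g \<in> Arr C"
  shows "f \<boxplus> g \<in> Arr C" "Dom C (f \<boxplus> g) = Dom C f \<oplus> Dom C g" "Cod C (f \<boxplus> g) = Cod C f \<oplus> Cod C g"
  using assms by (auto simp: coprod_arr_def)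

lemma coprod_arr_inj [simp]:
  assumes "f \<in> Arr C" "g \<in> Arr C" "Dom C f = X" "Dom C g = Y"
  shows "(f \<boxplus> g) \<cdot> inl X Y = inl (Cod C f) (Cod C g) \<cdot> f" "(f \<boxplus> g) \<cdot> inr X Y = inr (Cod C f) (Cod C g) \<cdot> g"
  using assms by (auto simp: coprod_arr_def)

lemmas coprod_arr_inj' [simp] = extend[OF coprod_arr_inj(1)] extend[OF coprod_arr_inj(2)]

lemma copair_coprod_arr [simp]:
  assumes "f \<in> Arr C" "g \<in> Arr C" "h \<in> Arr C" "k \<in> Arr C" "Cod C h = Cod C k" "Cod C f = Dom C h" "Cod C g = Dom C k"
  shows "\<lbrace>h, k\<rbrace> \<cdot> (f \<boxplus> g) = \<lbrace>h \<cdot> f, k \<cdot> g\<rbrace>"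
  using assms by (simp add: coprod_arr_def)

lemmas copair_coprod_arr' [simp] = extend[OF copair_coprod_arr]

lemma coprod_arr_copair [simp]:
  assumes "f \<in> Arr C" "g \<in> Arr C" "h \<in> Arr C" "k \<in> Arr C" "Cod C f = Cod C g" "Cod C f = Dom C h \<oplus> Dom C k"
  shows "(h \<boxplus> k) \<cdot> \<lbrace>f, g\<rbrace> = \<lbrace>(h \<boxplus> k) \<cdot> f, (h \<boxplus> k) \<cdot> g\<rbrace>"
  using assms by simp

lemma coprod_arr_Cmp:
  assumes "f \<in> Arr C" "g \<in> Arr C" "h \<in> Arr C" "k \<in> Arr C" "Cod C f = Dom C h" "Cod C g = Dom C k"
  shows "(h \<boxplus> k) \<cdot> (f \<boxplus> g) = (h \<cdot> f) \<boxplus> (k \<cdot> g)"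
  using assms by (simp add: coprod_arr_def)

lemma coprod_arr_idn: "X \<in> Ob C \<Longrightarrow> Y \<in> Ob C \<Longrightarrow> idn X \<boxplus> idn Y = idn (X \<oplus> Y)"
  by (simp add: coprod_arr_def)

end

section \<open>Coproducts and right adjoints from representability\<close>

context lfp
begin

text \<open>For the one-point presheaf the gluing condition is trivial, so glued colimits are plain
  colimits; the shape is discrete with two objects.\<close>

lemma coprod_category: "coprod_category C"
proof
  fix X Y assume X: "X \<in> Ob C" and Y: "Y \<in> Ob C"
  interpret pt: continuous_presheaf C U "\<lambda>_. {()}" "\<lambda>x _. x"
    by unfold_locales (auto simp: small_finite)
  let ?obs = "{(X, False), (Y, True)}" and ?hm = "\<lambda>x y k. snd x = snd y \<and> k = idn (fst x)"
  have cat: "category (structured_cat C ?obs fst ?hm)"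
    by (rule category_structured_cat[OF category_axioms]) (use X Y in \<open>auto simp: in_hom\<close>)
  have obs: "fst x \<in> Ob C" if "x \<in> ?obs" for x using that X Y by auto
  obtain Q c where "pt.glued_colimit ?obs ?hm Q c" using pt.glued_colimit_exists[OF cat small_finite obs] by blast
  note Q = pt.glued_colimitD(1-3)[OF this] and colim = pt.glued_colimitD(4)[OF this]
  have "is_coproduct C X Y Q (c (X, False)) (c (Y, True))"
    unfolding is_coproduct_def
  proof (intro conjI allI ballI)
    show "c (X, False) \<in> hom C X Q" "c (Y, True) \<in> hom C Y Q" using Q(2)[of "(X, False)"] Q(2)[of "(Y, True)"] by auto
    fix Z f g assume f: "f \<in> hom C X Z" and g: "g \<in> hom C Y Z"
    have "\<exists>!h. h \<in> hom C Q Z \<and> (\<forall>x\<in>?obs. h \<cdot> c x = (if snd x then g else f))"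
      by (rule colim) (use f g X Y in \<open>auto simp: in_hom\<close>)
    then show "\<exists>!h. h \<in> hom C Q Z \<and> h \<cdot> c (X, False) = f \<and> h \<cdot> c (Y, True) = g"
      by simp
  qed
  then show "\<exists>Q i j. is_coproduct C X Y Q i j" by blast
qed

text \<open>The value of the right adjoint at \<open>Z\<close> represents the presheaf of arrows
  from \<open>L \<diamondop> W\<close> to \<open>Z\<close>. Preservation of colimits by
  \<open>L\<close> is its gluing condition: compatible families are cocones under the image of the
  diagram.\<close>

lemma right_adjoint_exists:
  fixes L :: "('o, 'a) endo"
  assumes L: "is_functor C C L" and pres: "\<And>J :: ('u, 'u) cat. small_cat J \<Longrightarrow> preserves_colimits C C L J"
  shows "\<exists>A. is_adjunction C L A"
proof -
  interpret L: functor_on C L by unfold_locales fact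
  have "\<exists>R r. R \<in> Ob C \<and> r \<in> hom C (L \<diamondop> R) Z \<and>
      (\<forall>W x. W \<in> Ob C \<longrightarrow> x \<in> hom C (L \<diamondop> W) Z \<longrightarrow> (\<exists>!f. f \<in> hom C W R \<and> r \<cdot> L \<star> f = x))" if "Z \<in> Ob C" for Z
  proof -
    interpret continuous_presheaf C U "\<lambda>W. hom C (L \<diamondop> W) Z" "\<lambda>x f. x \<cdot> L \<star> f"
    proof
      fix J :: "('u, 'u) cat" and G A c s
      assume *: "small_cat J" "is_functor J C G" "colimit C J G A c" "\<And>i. i \<in> Ob J \<Longrightarrow> s i \<in> hom C (L \<diamondop> G \<diamondop> i) Z"
        "\<And>i j f. f \<in> hom J i j \<Longrightarrow> s j \<cdot> L \<star> G \<star> f = s i"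
      then have "colimit C J (ftor_comp L G) (L \<diamondop> A) (\<lambda>i. L \<star> c i)"
        using pres[OF *(1)] unfolding preserves_colimits_def by blast
      moreover have "cocone C J (ftor_comp L G) Z s"
        using * that by (simp add: cocone_def)
      ultimately show "\<exists>!y. y \<in> hom C (L \<diamondop> A) Z \<and> (\<forall>i\<in>Ob J. y \<cdot> L \<star> c i = s i)"
        unfolding colimit_def by blast
    qed (auto simp: in_hom L.Cmp small_hom)
    show ?thesis by (rule representable) blast
  qed
  then obtain R \<epsilon> where R: "\<And>Z. Z \<in> Ob C \<Longrightarrow> R Z \<in> Ob C" "\<And>Z. Z \<in> Ob C \<Longrightarrow> \<epsilon> Z \<in> hom C (L \<diamondop> R Z) Z"
    and univ: "\<And>Z W x. Z \<in> Ob C \<Longrightarrow> W \<in> Ob C \<Longrightarrow> x \<in> hom C (L \<diamondop> W) Z \<Longrightarrow> \<exists>!f. f \<in> hom C W (R Z) \<and> \<epsilon> Z \<cdot> L \<star> f = x"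
    by metis
  have \<epsilon> [simp]: "\<epsilon> Z \<in> Arr C" "Dom C (\<epsilon> Z) = L \<diamondop> R Z" "Cod C (\<epsilon> Z) = Z" if "Z \<in> Ob C" for Z
    using R(2)[OF that] by (auto simp: in_hom)
  define tr where "tr Z x W = (THE f. f \<in> hom C W (R Z) \<and> \<epsilon> Z \<cdot> L \<star> f = x)" for Z x W
  have tr: "tr Z x W \<in> Arr C" "Dom C (tr Z x W) = W" "Cod C (tr Z x W) = R Z" "\<epsilon> Z \<cdot> L \<star> tr Z x W = x"
    if "W \<in> Ob C" "x \<in> Arr C" "Dom C x = L \<diamondop> W" "Cod C x = Z" for Z x W
  proof -
    have "Z \<in> Ob C" "x \<in> hom C (L \<diamondop> W) Z" using that by (auto simp: in_hom)
    then have "\<exists>!f. f \<in> hom C W (R Z) \<and> \<epsilon> Z \<cdot> L \<star> f = x"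
      using that univ by blast
    from theI'[OF this]
    show "tr Z x W \<in> Arr C" "Dom C (tr Z x W) = W" "Cod C (tr Z x W) = R Z" "\<epsilon> Z \<cdot> L \<star> tr Z x W = x"
      by (auto simp: tr_def in_hom)
  qed
  have eq: "f = g" if "Z \<in> Ob C" "f \<in> Arr C" "g \<in> Arr C" "Dom C f = Dom C g" "Cod C f = R Z" "Cod C g = R Z"
    "\<epsilon> Z \<cdot> L \<star> f = \<epsilon> Z \<cdot> L \<star> g" for f g Z
  proof -
    have "\<exists>!h. h \<in> hom C (Dom C f) (R Z) \<and> \<epsilon> Z \<cdot> L \<star> h = \<epsilon> Z \<cdot> L \<star> f"
      by (rule univ) (use that in \<open>auto simp: in_hom\<close>)
    then show ?thesis using that by (auto simp: in_hom)
  qed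
  \<comment> \<open>The arrow part and the unit are transposes under the universal arrows
    \<open>\<epsilon>\<close>; the adjunction laws then follow by cancelling
    \<open>\<epsilon>\<close> with \<open>eq\<close>.\<close>
  define RR where "RR = \<lparr>fob = R, far = (\<lambda>f. tr (Cod C f) (f \<cdot> \<epsilon> (Dom C f)) (R (Dom C f)))\<rparr>"
  define A where "A = \<lparr>radj = RR, aunit = (\<lambda>W. tr (L \<diamondop> W) (idn (L \<diamondop> W)) W), acounit = \<epsilon>\<rparr>"
  have RR [simp]: "RR \<diamondop> Z = R Z" for Z by (simp add: RR_def)
  have RR_arr [simp]: "RR \<star> f \<in> Arr C" "Dom C (RR \<star> f) = R (Dom C f)" "Cod C (RR \<star> f) = R (Cod C f)"
    and RR_eps: "\<epsilon> (Cod C f) \<cdot> L \<star> RR \<star> f = f \<cdot> \<epsilon> (Dom C f)"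
    if "f \<in> Arr C" for f
    using that R(1) tr[of "R (Dom C f)" "f \<cdot> \<epsilon> (Dom C f)"] by (auto simp: RR_def)
  have u [simp]: "aunit A W \<in> Arr C" "Dom C (aunit A W) = W" "Cod C (aunit A W) = R (L \<diamondop> W)"
    and u_eps: "\<epsilon> (L \<diamondop> W) \<cdot> L \<star> aunit A W = idn (L \<diamondop> W)"
    if "W \<in> Ob C" for W
    using that tr[of W "idn (L \<diamondop> W)"] by (auto simp: A_def)
  have [simp]: "acounit A = \<epsilon>" "radj A = RR" by (simp_all add: A_def)
  note [simp] = R(1)
  have "is_functor C C RR"
  proof (rule functorI[OF category_axioms])
    show "RR \<star> idn X = idn (RR \<diamondop> X)" if "X \<in> Ob C" for X
      by (rule eq[of X]) (use that RR_eps[of "idn X"] in auto)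
    fix f g assume [simp]: "f \<in> Arr C" "g \<in> Arr C" "Cod C f = Dom C g"
    show "RR \<star> (g \<cdot> f) = RR \<star> g \<cdot> RR \<star> f"
      by (rule eq[of "Cod C g"])
        (use RR_eps[of "g \<cdot> f"] RR_eps[of f] RR_eps[of g] extend[OF RR_eps[of g], of "L \<star> RR \<star> f"] in \<open>auto simp: L.Cmp\<close>)
  qed auto
  moreover have "nat_trans C C id_ftor (ftor_comp RR L) (aunit A)"
  proof (rule nat_transI)
    fix f assume [simp]: "f \<in> Arr C"
    have "aunit A (Cod C f) \<cdot> f = RR \<star> L \<star> f \<cdot> aunit A (Dom C f)"
      by (rule eq[of "L \<diamondop> Cod C f"])
        (use extend[OF RR_eps[of "L \<star> f"], of "L \<star> aunit A (Dom C f)"] extend[OF u_eps[of "Cod C f"], of "L \<star> f"]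
          u_eps[of "Dom C f"] in \<open>auto simp: L.Cmp\<close>)
    then show "aunit A (Cod C f) \<cdot> id_ftor \<star> f = ftor_comp RR L \<star> f \<cdot> aunit A (Dom C f)" by simp
  qed auto
  moreover have "nat_trans C C (ftor_comp L RR) id_ftor \<epsilon>"
    by (rule nat_transI) (auto simp: RR_eps)
  moreover have "RR \<star> \<epsilon> Z \<cdot> aunit A (R Z) = idn (R Z)" if [simp]: "Z \<in> Ob C" for Z
    by (rule eq[of Z])
      (use extend[OF RR_eps[of "\<epsilon> Z"], of "L \<star> aunit A (R Z)"] u_eps[of "R Z"] in \<open>auto simp: L.Cmp\<close>)
  ultimately have "is_adjunction C L A"
    using L u_eps by (simp add: is_adjunction_def)
  then show ?thesis by blast
qed

end

lemma (in category) restrict_alg: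
  assumes N: "is_monad C N" and M: "is_monad C M" and \<phi>: "monad_morphism C M N \<phi>" and n: "monad_algebra C N X n"
  shows "monad_algebra C M X (n \<cdot> \<phi> X)"
proof -
  interpret N: monad C N by (intro monadI category_axioms N)
  interpret M: monad C M by (intro monadI category_axioms M)
  note [simp] = N.alg_arr[OF n]
  have nat: "nat_trans C C M N \<phi>" using \<phi> by (simp add: monad_morphism_def)
  note [simp] = nat_trans_simps[OF nat]
  show ?thesis
  proof (rule M.algI)
    show "(n \<cdot> \<phi> X) \<cdot> munit M X = idn X"
      using \<phi> N.alg_unit[OF n] by (simp add: monad_morphism_def)
    have "(n \<cdot> \<phi> X) \<cdot> mmult M X = (n \<cdot> mmult N X) \<cdot> (N \<star> \<phi> X \<cdot> \<phi> (M \<diamondop> X))"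
      using \<phi> by (simp add: monad_morphism_def)
    also have "\<dots> = n \<cdot> (N \<star> (n \<cdot> \<phi> X) \<cdot> \<phi> (M \<diamondop> X))"
      by (simp add: N.alg_mult[OF n] N.Cmp)
    also have "\<dots> = (n \<cdot> \<phi> X) \<cdot> M \<star> (n \<cdot> \<phi> X)"
      using nat_trans_nat[OF nat, of "n \<cdot> \<phi> X" X] by simp
    finally show "(n \<cdot> \<phi> X) \<cdot> mmult M X = (n \<cdot> \<phi> X) \<cdot> M \<star> (n \<cdot> \<phi> X)" .
  qed simp_all
qed

text \<open>
  The endomorphism monad of an arrow \<open>f: A \<rightarrow> B\<close>: monad morphisms into it are pairs of algebra
  structures on \<open>A\<close> and \<open>B\<close> which make \<open>f\<close> a homomorphism. It represents, at \<open>Y\<close>, the presheaf of pairs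
  of functions \<open>hom(Y, A) \<rightarrow> hom(W, A)\<close>, \<open>hom(Y, B) \<rightarrow> hom(W, B)\<close> compatible with \<open>f\<close>.
\<close>

locale arrow_endo = lfp C U for C :: "('o, 'a) cat" (structure) and U :: "'u itself" +
  fixes A B :: 'o and f :: 'a
  assumes f_hom: "f \<in> hom C A B"
begin

text \<open>Indexing the endpoints of \<open>f\<close> by Booleans lets one argument serve both
  algebra structures.\<close>

definition D :: "bool \<Rightarrow> 'o" where "D i = (if i then B else A)"

lemma D_simps [simp]: "D False = A" "D True = B"
  by (simp_all add: D_def)

lemma f_arr [simp]: "f \<in> Arr C" "Dom C f = A" "Cod C f = B" "A \<in> Ob C" "B \<in> Ob C"
  using f_hom by (auto simp: in_hom)

lemma D_Ob [simp]: "D i \<in> Ob C"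
  by (cases i) simp_all

definition compat :: "'o \<Rightarrow> 'o \<Rightarrow> (bool \<Rightarrow> 'a \<Rightarrow> 'a) \<Rightarrow> bool" where
  "compat Y W \<theta> \<longleftrightarrow> (\<forall>i. \<forall>y \<in> hom C Y (D i). \<theta> i y \<in> hom C W (D i)) \<and>
     (\<forall>y \<in> hom C Y A. f \<cdot> \<theta> False y = \<theta> True (f \<cdot> y))"

text \<open>Normalisation outside the hom sets makes equality in \<open>\<Phi>\<close> mean
  agreement on the meaningful arguments, as unique gluing and the smallness proof require.\<close>

definition ext :: "'o \<Rightarrow> (bool \<Rightarrow> 'a \<Rightarrow> 'a) \<Rightarrow> bool \<Rightarrow> 'a \<Rightarrow> 'a" where
  "ext Y \<theta> = (\<lambda>i y. if y \<in> hom C Y (D i) then \<theta> i y else undefined)"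

definition \<Phi> :: "'o \<Rightarrow> 'o \<Rightarrow> (bool \<Rightarrow> 'a \<Rightarrow> 'a) set" where
  "\<Phi> Y W = {\<theta>. compat Y W \<theta> \<and> ext Y \<theta> = \<theta>}"

lemma f_Cmp [simp]: "y \<in> hom C Y A \<Longrightarrow> f \<cdot> y \<in> hom C Y B"
  using f_hom Cmp_hom by blast

lemma compat_ext [simp]: "compat Y W (ext Y \<theta>) \<longleftrightarrow> compat Y W \<theta>"
proof -
  have "ext Y \<theta> True (f \<cdot> y) = \<theta> True (f \<cdot> y)" "ext Y \<theta> False y = \<theta> False y" if "y \<in> hom C Y A" for y
    using that by (auto simp: ext_def)
  then show ?thesis by (simp add: compat_def) (simp add: ext_def)
qed

lemma ext_ext [simp]: "ext Y (ext Y \<theta>) = ext Y \<theta>"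
  by (simp add: ext_def fun_eq_iff)

lemma ext_eq: "ext Y \<theta> = ext Y \<theta>' \<longleftrightarrow> (\<forall>i. \<forall>y\<in>hom C Y (D i). \<theta> i y = \<theta>' i y)"
  by (auto simp: ext_def fun_eq_iff) 

text \<open>A normalised pair is determined by its graph, a subset of a small set.\<close>

lemma small_\<Phi>: "small U (\<Phi> Y W)"
proof -
  let ?X = "\<Union>i\<in>(UNIV :: bool set). {i} \<times> hom C Y (D i) \<times> hom C W (D i)"
  let ?g = "\<lambda>\<theta>. {(i, y, \<theta> i y) | i y. y \<in> hom C Y (D i)}"
  have "small U (Pow ?X)"
    by (intro small_Pow small_UNION small_Times small_hom small_finite) auto
  moreover have "?g ` \<Phi> Y W \<subseteq> Pow ?X"
    by (auto simp: \<Phi>_def compat_def)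
  ultimately have sm: "small U (?g ` \<Phi> Y W)" by (rule small_subset)
  have "inj_on ?g (\<Phi> Y W)"
  proof (rule inj_onI)
    fix \<theta> \<theta>' assume \<theta>: "\<theta> \<in> \<Phi> Y W" "\<theta>' \<in> \<Phi> Y W" and eq: "?g \<theta> = ?g \<theta>'"
    have "\<theta> i y = \<theta>' i y" if "y \<in> hom C Y (D i)" for i y
    proof -
      have "(i, y, \<theta> i y) \<in> ?g \<theta>'" unfolding eq[symmetric] using that by blast
      then show ?thesis by blast
    qed
    then have "ext Y \<theta> = ext Y \<theta>'" by (simp add: ext_eq)
    then show "\<theta> = \<theta>'" using \<theta> by (simp add: \<Phi>_def)
  qed
  then have "\<Phi> Y W \<lesssim> ?g ` \<Phi> Y W"
    unfolding lepoll_def by (intro exI[of _ ?g] conjI) auto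
  then show ?thesis using sm by (rule small_lepoll)
qed

text \<open>Gluing is done separately for each argument \<open>y\<close>: the values at
  \<open>y\<close> form a cocone with vertex \<open>D i\<close>. Compatibility with \<open>f\<close>
  and uniqueness are inherited from the uniqueness of mediating arrows.\<close>

lemma presheaf:
  assumes Y: "Y \<in> Ob C"
  shows "continuous_presheaf C U (\<Phi> Y) (\<lambda>\<theta> k. ext Y (\<lambda>i y. \<theta> i y \<cdot> k))"
proof
  fix k W W' \<theta> assume k: "k \<in> hom C W W'" and \<theta>: "\<theta> \<in> \<Phi> Y W'"
  then have "compat Y W (\<lambda>i y. \<theta> i y \<cdot> k)"
    by (auto simp: \<Phi>_def compat_def in_hom simp del: assoc simp flip: assoc)
  then show "ext Y (\<lambda>i y. \<theta> i y \<cdot> k) \<in> \<Phi> Y W" by (simp add: \<Phi>_def)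
next
  fix W \<theta> assume "W \<in> Ob C" and \<theta>: "\<theta> \<in> \<Phi> Y W"
  then have "ext Y (\<lambda>i y. \<theta> i y \<cdot> idn W) = ext Y \<theta>"
    unfolding ext_eq by (auto simp: \<Phi>_def compat_def in_hom)
  then show "ext Y (\<lambda>i y. \<theta> i y \<cdot> idn W) = \<theta>" using \<theta> by (simp add: \<Phi>_def)
next
  fix k W W' l W'' \<theta> assume "k \<in> hom C W W'" "l \<in> hom C W' W''" "\<theta> \<in> \<Phi> Y W''"
  then show "ext Y (\<lambda>i y. \<theta> i y \<cdot> (l \<cdot> k)) = ext Y (\<lambda>i y. ext Y (\<lambda>i y. \<theta> i y \<cdot> l) i y \<cdot> k)"
    unfolding ext_eq by (auto simp: \<Phi>_def compat_def in_hom ext_def)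
next
  fix J :: "('u, 'u) cat" and G V c s
  assume J: "small_cat J" "is_functor J C G" and V: "colimit C J G V c"
    and s: "\<And>i. i \<in> Ob J \<Longrightarrow> s i \<in> \<Phi> Y (G \<diamondop> i)"
    and comp: "\<And>i j k. k \<in> hom J i j \<Longrightarrow> ext Y (\<lambda>i y. s j i y \<cdot> G \<star> k) = s i"
  interpret J: category J using J by (simp add: small_cat_def)
  have c: "c i \<in> hom C (G \<diamondop> i) V" if "i \<in> Ob J" for i
    using V that by (auto simp: colimit_def cocone_def)
  have s_hom: "s j i y \<in> hom C (G \<diamondop> j) (D i)" if "j \<in> Ob J" "y \<in> hom C Y (D i)" for i j y
    using s[OF that(1)] that(2) by (auto simp: \<Phi>_def compat_def)
  have ex1: "\<exists>!h. h \<in> hom C V (D i) \<and> (\<forall>j\<in>Ob J. h \<cdot> c j = s j i y)" if y: "y \<in> hom C Y (D i)" for i y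
  proof -
    have "cocone C J G (D i) (\<lambda>j. s j i y)"
      unfolding cocone_def
    proof (intro conjI ballI allI)
      fix j j' k assume k: "k \<in> hom J j j'"
      show "s j' i y \<cdot> G \<star> k = s j i y"
        unfolding comp[OF k, symmetric] using y by (simp add: ext_def)
    qed (use y s_hom in auto)
    then show ?thesis using V unfolding colimit_def by blast
  qed
  define \<theta> where "\<theta> i y = (THE h. h \<in> hom C V (D i) \<and> (\<forall>j\<in>Ob J. h \<cdot> c j = s j i y))" for i y
  have \<theta>: "\<theta> i y \<in> hom C V (D i)" "\<And>j. j \<in> Ob J \<Longrightarrow> \<theta> i y \<cdot> c j = s j i y" if "y \<in> hom C Y (D i)" for i y
    using theI'[OF ex1[OF that]] unfolding \<theta>_def by blast+
  have uniq: "h = \<theta> i y" if "y \<in> hom C Y (D i)" "h \<in> hom C V (D i)" "\<And>j. j \<in> Ob J \<Longrightarrow> h \<cdot> c j = s j i y" for h i y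
    using ex1[OF that(1)] \<theta>[OF that(1)] that by blast
  have "compat Y V \<theta>"
    unfolding compat_def
  proof (intro conjI allI ballI)
    fix y assume y: "y \<in> hom C Y A"
    have s_comp: "f \<cdot> s j False y = s j True (f \<cdot> y)" if "j \<in> Ob J" for j
      using s[OF that] y by (auto simp: \<Phi>_def compat_def)
    show "f \<cdot> \<theta> False y = \<theta> True (f \<cdot> y)"
    proof (rule uniq)
      show "f \<cdot> \<theta> False y \<in> hom C V (D True)" using \<theta>(1)[of y False] y by simp
      show "(f \<cdot> \<theta> False y) \<cdot> c j = s j True (f \<cdot> y)" if "j \<in> Ob J" for j
        using \<theta>[of y False] y c[OF that] s_comp[OF that] that by (simp add: in_hom)
    qed (use y in simp)
  qed (rule \<theta>)
  then have "ext Y \<theta> \<in> \<Phi> Y V" by (simp add: \<Phi>_def)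
  moreover have restr: "ext Y (\<lambda>i y. \<theta>' i y \<cdot> c j) = s j \<longleftrightarrow> (\<forall>i. \<forall>y\<in>hom C Y (D i). \<theta>' i y \<cdot> c j = s j i y)"
    if "j \<in> Ob J" for \<theta>' j
  proof -
    have "ext Y (s j) = s j" using s[OF that] by (simp add: \<Phi>_def)
    then show ?thesis using ext_eq[of Y "\<lambda>i y. \<theta>' i y \<cdot> c j" "s j"] by simp
  qed
  moreover have "\<theta>' = ext Y \<theta>" if "\<theta>' \<in> \<Phi> Y V" "\<And>j. j \<in> Ob J \<Longrightarrow> ext Y (\<lambda>i y. \<theta>' i y \<cdot> c j) = s j" for \<theta>'
  proof -
    have "\<theta>' i y = \<theta> i y" if y: "y \<in> hom C Y (D i)" for i y
    proof (rule uniq[OF y])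
      show "\<theta>' i y \<in> hom C V (D i)" using \<open>\<theta>' \<in> \<Phi> Y V\<close> y by (simp add: \<Phi>_def compat_def)
      show "\<theta>' i y \<cdot> c j = s j i y" if j: "j \<in> Ob J" for j
        using \<open>\<And>j. j \<in> Ob J \<Longrightarrow> ext Y (\<lambda>i y. \<theta>' i y \<cdot> c j) = s j\<close>[OF j] y unfolding restr[OF j] by blast
    qed
    then have "ext Y \<theta>' = ext Y \<theta>" unfolding ext_eq by blast
    then show ?thesis using that by (simp add: \<Phi>_def)
  qed
  moreover have "ext Y (\<lambda>i y. ext Y \<theta> i y \<cdot> c j) = s j" if "j \<in> Ob J" for j
    unfolding restr[OF that] using \<theta>(2) that by (simp add: ext_def)
  ultimately show "\<exists>!\<theta>'. \<theta>' \<in> \<Phi> Y V \<and> (\<forall>j\<in>Ob J. ext Y (\<lambda>i y. \<theta>' i y \<cdot> c j) = s j)" by blast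
qed (rule small_\<Phi>)

definition universal :: "'o \<Rightarrow> 'o \<Rightarrow> (bool \<Rightarrow> 'a \<Rightarrow> 'a) \<Rightarrow> bool" where
  "universal Y V \<pi> \<longleftrightarrow> V \<in> Ob C \<and> compat Y V \<pi> \<and>
     (\<forall>W \<theta>. W \<in> Ob C \<longrightarrow> compat Y W \<theta> \<longrightarrow>
        (\<exists>!w. w \<in> hom C W V \<and> (\<forall>i. \<forall>y\<in>hom C Y (D i). \<pi> i y \<cdot> w = \<theta> i y)))"

lemma universal_exists:
  assumes "Y \<in> Ob C"
  shows "\<exists>V \<pi>. universal Y V \<pi>"
proof -
  interpret continuous_presheaf C U "\<Phi> Y" "\<lambda>\<theta> k. ext Y (\<lambda>i y. \<theta> i y \<cdot> k)"
    using presheaf[OF assms] .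
  show ?thesis
  proof (rule representable)
    fix V \<pi> assume V: "V \<in> Ob C" "\<pi> \<in> \<Phi> Y V"
      and u: "\<And>W \<theta>. W \<in> Ob C \<Longrightarrow> \<theta> \<in> \<Phi> Y W \<Longrightarrow> \<exists>!w. w \<in> hom C W V \<and> ext Y (\<lambda>i y. \<pi> i y \<cdot> w) = \<theta>"
    have "universal Y V \<pi>"
      unfolding universal_def
    proof (intro conjI allI impI)
      show "compat Y V \<pi>" using V by (simp add: \<Phi>_def)
      fix W \<theta> assume W: "W \<in> Ob C" and "compat Y W \<theta>"
      then have "ext Y \<theta> \<in> \<Phi> Y W" by (simp add: \<Phi>_def)
      from u[OF W this] show "\<exists>!w. w \<in> hom C W V \<and> (\<forall>i. \<forall>y\<in>hom C Y (D i). \<pi> i y \<cdot> w = \<theta> i y)"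
        by (simp only: ext_eq)
    qed fact
    then show ?thesis by blast
  qed
qed

text \<open>In terms of limits this is the pullback of the powers of \<open>A\<close> by
  \<open>hom(Y, A)\<close> and of \<open>B\<close> by \<open>hom(Y, B)\<close> over the power of
  \<open>B\<close> by \<open>hom(Y, A)\<close>; \<open>\<pi> Y i y\<close> is the projection at
  \<open>y\<close>.\<close>

definition N0 :: "'o \<Rightarrow> 'o" where "N0 Y = fst (SOME t. universal Y (fst t) (snd t))"
definition \<pi> :: "'o \<Rightarrow> bool \<Rightarrow> 'a \<Rightarrow> 'a" where "\<pi> Y = snd (SOME t. universal Y (fst t) (snd t))"

lemma universal_N0: "Y \<in> Ob C \<Longrightarrow> universal Y (N0 Y) (\<pi> Y)"
  unfolding N0_def \<pi>_def by (rule someI_ex) (use universal_exists in auto)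

lemma N0_Ob [simp]: "Y \<in> Ob C \<Longrightarrow> N0 Y \<in> Ob C"
  using universal_N0 by (simp add: universal_def)

lemma \<pi>_arr [simp]:
  assumes "y \<in> Arr C" "Cod C y = D i" "Dom C y = Y"
  shows "\<pi> Y i y \<in> Arr C" "Dom C (\<pi> Y i y) = N0 Y" "Cod C (\<pi> Y i y) = D i"
  using universal_N0[of Y] assms by (auto simp: universal_def compat_def in_hom)

lemma \<pi>_f: "y \<in> Arr C \<Longrightarrow> Cod C y = A \<Longrightarrow> Dom C y = Y \<Longrightarrow> f \<cdot> \<pi> Y False y = \<pi> Y True (f \<cdot> y)"
  using universal_N0[of Y] by (auto simp: universal_def compat_def in_hom)

definition lft :: "'o \<Rightarrow> 'o \<Rightarrow> (bool \<Rightarrow> 'a \<Rightarrow> 'a) \<Rightarrow> 'a" where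
  "lft Y W \<theta> = (THE w. w \<in> hom C W (N0 Y) \<and> (\<forall>i. \<forall>y\<in>hom C Y (D i). \<pi> Y i y \<cdot> w = \<theta> i y))"

lemma lft:
  assumes "Y \<in> Ob C" "W \<in> Ob C" and "compat Y W \<theta>"
  shows "lft Y W \<theta> \<in> Arr C" "Dom C (lft Y W \<theta>) = W" "Cod C (lft Y W \<theta>) = N0 Y"
    "\<And>i y. y \<in> Arr C \<Longrightarrow> Cod C y = D i \<Longrightarrow> Dom C y = Y \<Longrightarrow> \<pi> Y i y \<cdot> lft Y W \<theta> = \<theta> i y"
proof -
  have "\<exists>!w. w \<in> hom C W (N0 Y) \<and> (\<forall>i. \<forall>y\<in>hom C Y (D i). \<pi> Y i y \<cdot> w = \<theta> i y)"
    using universal_N0[OF assms(1)] assms(2,3) unfolding universal_def by blast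
  from theI'[OF this, folded lft_def]
  show "lft Y W \<theta> \<in> Arr C" "Dom C (lft Y W \<theta>) = W" "Cod C (lft Y W \<theta>) = N0 Y"
    "\<And>i y. y \<in> Arr C \<Longrightarrow> Cod C y = D i \<Longrightarrow> Dom C y = Y \<Longrightarrow> \<pi> Y i y \<cdot> lft Y W \<theta> = \<theta> i y"
    by (auto simp: in_hom)
qed

lemma \<pi>_joint_mono:
  assumes "Y \<in> Ob C" "v \<in> Arr C" "w \<in> Arr C" "Dom C v = Dom C w" "Cod C v = N0 Y" "Cod C w = N0 Y"
    and eq: "\<And>i y. y \<in> Arr C \<Longrightarrow> Cod C y = D i \<Longrightarrow> Dom C y = Y \<Longrightarrow> \<pi> Y i y \<cdot> v = \<pi> Y i y \<cdot> w"
  shows "v = w"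
proof -
  let ?\<theta> = "\<lambda>i y. \<pi> Y i y \<cdot> v"
  have "compat Y (Dom C v) ?\<theta>"
    using assms by (auto simp: compat_def in_hom \<pi>_f simp del: assoc simp flip: assoc)
  then have "\<exists>!w. w \<in> hom C (Dom C v) (N0 Y) \<and> (\<forall>i. \<forall>y\<in>hom C Y (D i). \<pi> Y i y \<cdot> w = ?\<theta> i y)"
    using universal_N0[OF assms(1)] assms(2) Dom_Ob unfolding universal_def by blast
  moreover have "v \<in> hom C (Dom C v) (N0 Y) \<and> (\<forall>i. \<forall>y\<in>hom C Y (D i). \<pi> Y i y \<cdot> v = ?\<theta> i y)"
    "w \<in> hom C (Dom C v) (N0 Y) \<and> (\<forall>i. \<forall>y\<in>hom C Y (D i). \<pi> Y i y \<cdot> w = ?\<theta> i y)"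
    using assms(2-6) eq by (auto simp: in_hom)
  ultimately show ?thesis by blast
qed

text \<open>The pattern is that of a continuation monad: an arrow acts by precomposition on the
  argument of \<open>\<pi>\<close>, the unit is evaluation, and the multiplication evaluates
  twice.\<close>

definition N :: "('o, 'a) mnd" where
  "N = \<lparr>fob = N0, far = (\<lambda>k. lft (Cod C k) (N0 (Dom C k)) (\<lambda>i y. \<pi> (Dom C k) i (y \<cdot> k))),
     munit = (\<lambda>Y. lft Y Y (\<lambda>i y. y)), mmult = (\<lambda>Y. lft Y (N0 (N0 Y)) (\<lambda>i y. \<pi> (N0 Y) i (\<pi> Y i y)))\<rparr>"

lemma N_fob [simp]: "N \<diamondop> Y = N0 Y" by (simp add: N_def)

lemma N_far:
  assumes "k \<in> Arr C"
  shows "N \<star> k \<in> Arr C" "Dom C (N \<star> k) = N0 (Dom C k)" "Cod C (N \<star> k) = N0 (Cod C k)"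
    "\<And>i y. y \<in> Arr C \<Longrightarrow> Cod C y = D i \<Longrightarrow> Dom C y = Cod C k \<Longrightarrow> \<pi> (Cod C k) i y \<cdot> N \<star> k = \<pi> (Dom C k) i (y \<cdot> k)"
proof -
  have "compat (Cod C k) (N0 (Dom C k)) (\<lambda>i y. \<pi> (Dom C k) i (y \<cdot> k))"
    using assms by (auto simp: compat_def in_hom \<pi>_f)
  from lft[OF _ _ this] assms
  show "N \<star> k \<in> Arr C" "Dom C (N \<star> k) = N0 (Dom C k)" "Cod C (N \<star> k) = N0 (Cod C k)"
    "\<And>i y. y \<in> Arr C \<Longrightarrow> Cod C y = D i \<Longrightarrow> Dom C y = Cod C k \<Longrightarrow> \<pi> (Cod C k) i y \<cdot> N \<star> k = \<pi> (Dom C k) i (y \<cdot> k)"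
    by (simp_all add: N_def)
qed

lemma N_unit:
  assumes "Y \<in> Ob C"
  shows "munit N Y \<in> Arr C" "Dom C (munit N Y) = Y" "Cod C (munit N Y) = N0 Y"
    "\<And>i y. y \<in> Arr C \<Longrightarrow> Cod C y = D i \<Longrightarrow> Dom C y = Y \<Longrightarrow> \<pi> Y i y \<cdot> munit N Y = y"
proof -
  have "compat Y Y (\<lambda>i y. y)" by (auto simp: compat_def)
  from lft[OF _ _ this] assms
  show "munit N Y \<in> Arr C" "Dom C (munit N Y) = Y" "Cod C (munit N Y) = N0 Y"
    "\<And>i y. y \<in> Arr C \<Longrightarrow> Cod C y = D i \<Longrightarrow> Dom C y = Y \<Longrightarrow> \<pi> Y i y \<cdot> munit N Y = y"
    by (simp_all add: N_def)
qed

lemma N_mult: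
  assumes "Y \<in> Ob C"
  shows "mmult N Y \<in> Arr C" "Dom C (mmult N Y) = N0 (N0 Y)" "Cod C (mmult N Y) = N0 Y"
    "\<And>i y. y \<in> Arr C \<Longrightarrow> Cod C y = D i \<Longrightarrow> Dom C y = Y \<Longrightarrow> \<pi> Y i y \<cdot> mmult N Y = \<pi> (N0 Y) i (\<pi> Y i y)"
proof -
  have "compat Y (N0 (N0 Y)) (\<lambda>i y. \<pi> (N0 Y) i (\<pi> Y i y))"
    by (auto simp: compat_def in_hom \<pi>_f)
  from lft[OF _ _ this] assms
  show "mmult N Y \<in> Arr C" "Dom C (mmult N Y) = N0 (N0 Y)" "Cod C (mmult N Y) = N0 Y"
    "\<And>i y. y \<in> Arr C \<Longrightarrow> Cod C y = D i \<Longrightarrow> Dom C y = Y \<Longrightarrow> \<pi> Y i y \<cdot> mmult N Y = \<pi> (N0 Y) i (\<pi> Y i y)"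
    by (simp_all add: N_def)
qed

lemmas N_arrs [simp] = N_far(1-3) N_unit(1-3) N_mult(1-3)
text \<open>With these evaluation rules and their versions with a tail, every monad law for
  \<open>N\<close> holds by simplification once it is tested on the projections.\<close>

lemma \<pi>_Cmp [simp]:
  assumes "y \<in> Arr C" "Cod C y = D i"
  shows "Dom C y = Y' \<Longrightarrow> k \<in> Arr C \<Longrightarrow> Cod C k = Y' \<Longrightarrow> \<pi> Y' i y \<cdot> N \<star> k = \<pi> (Dom C k) i (y \<cdot> k)"
    "Dom C y = Y' \<Longrightarrow> \<pi> Y' i y \<cdot> munit N Y' = y"
    "Dom C y = Y' \<Longrightarrow> \<pi> Y' i y \<cdot> mmult N Y' = \<pi> (N0 Y') i (\<pi> Y' i y)"
  using assms N_far(4)[of k y i] N_unit(4)[of Y' y i] N_mult(4)[of Y' y i] by auto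

lemmas \<pi>_Cmp' [simp] = extend[OF \<pi>_Cmp(1)] extend[OF \<pi>_Cmp(2)] extend[OF \<pi>_Cmp(3)]

lemma is_monad_N: "is_monad C N"
proof (rule is_monadI[OF category_axioms])
  show "is_functor C C N"
  proof (rule functorI[OF category_axioms])
    show "N \<star> idn X = idn (N \<diamondop> X)" if "X \<in> Ob C" for X
      by (rule \<pi>_joint_mono[of X]) (use that in auto)
    show "N \<star> (g \<cdot> f) = N \<star> g \<cdot> N \<star> f" if "f \<in> Arr C" "g \<in> Arr C" "Cod C f = Dom C g" for f g
      by (rule \<pi>_joint_mono[of "Cod C g"]) (use that in auto)
  qed auto
  show "nat_trans C C id_ftor N (munit N)"
  proof (rule nat_transI)
    fix k assume k: "k \<in> Arr C"
    show "munit N (Cod C k) \<cdot> id_ftor \<star> k = N \<star> k \<cdot> munit N (Dom C k)"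
      by (rule \<pi>_joint_mono[of "Cod C k"]) (use k in auto)
  qed auto
  show "nat_trans C C (ftor_comp N N) N (mmult N)"
  proof (rule nat_transI)
    fix k assume k: "k \<in> Arr C"
    show "mmult N (Cod C k) \<cdot> ftor_comp N N \<star> k = N \<star> k \<cdot> mmult N (Dom C k)"
      by (rule \<pi>_joint_mono[of "Cod C k"]) (use k in auto)
  qed auto
  fix X assume [simp]: "X \<in> Ob C"
  show "mmult N X \<cdot> munit N (N \<diamondop> X) = idn (N \<diamondop> X)"
    by (rule \<pi>_joint_mono[of X]) auto
  show "mmult N X \<cdot> N \<star> munit N X = idn (N \<diamondop> X)"
    by (rule \<pi>_joint_mono[of X]) auto
  show "mmult N X \<cdot> mmult N (N \<diamondop> X) = mmult N X \<cdot> N \<star> mmult N X"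
    by (rule \<pi>_joint_mono[of X]) auto
qed

text \<open>The components are found as in the Yoneda lemma: their projection at \<open>y\<close>
  has to be \<open>al i\<close> after \<open>F \<star> y\<close>. The square \<open>hom\<close>
  gives the compatibility with \<open>f\<close>.\<close>

lemma nat_trans_into_N:
  fixes al :: "bool \<Rightarrow> 'a"
  assumes F: "is_functor C C F" and al: "\<And>i. al i \<in> hom C (F \<diamondop> D i) (D i)" and hom: "f \<cdot> al False = al True \<cdot> F \<star> f"
  obtains \<psi> where "nat_trans C C F N \<psi>"
    "\<And>Y i y. y \<in> Arr C \<Longrightarrow> Cod C y = D i \<Longrightarrow> Dom C y = Y \<Longrightarrow> \<pi> Y i y \<cdot> \<psi> Y = al i \<cdot> F \<star> y"
proof -
  interpret F: functor_on C F by unfold_locales fact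
  have al_arr [simp]: "al i \<in> Arr C" "Dom C (al i) = F \<diamondop> D i" "Cod C (al i) = D i" for i
    using al[of i] by (simp_all add: in_hom del: if_split)
  define \<psi> where "\<psi> Y = lft Y (F \<diamondop> Y) (\<lambda>i y. al i \<cdot> F \<star> y)" for Y
  have "compat Y (F \<diamondop> Y) (\<lambda>i y. al i \<cdot> F \<star> y)" for Y
  proof -
    have "f \<cdot> (al False \<cdot> F \<star> y) = al True \<cdot> F \<star> (f \<cdot> y)" if "y \<in> hom C Y A" for y
      using extend[OF hom, of "F \<star> y"] that by (simp add: in_hom F.Cmp)
    then show ?thesis by (auto simp: compat_def in_hom)
  qed
  note \<psi> [simp] = lft[OF _ _ this, folded \<psi>_def, simplified F.arr]
  have "nat_trans C C F N \<psi>"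
  proof (rule nat_transI)
    fix k assume [simp]: "k \<in> Arr C"
    show "\<psi> (Cod C k) \<cdot> F \<star> k = N \<star> k \<cdot> \<psi> (Dom C k)"
    proof (rule \<pi>_joint_mono[of "Cod C k"])
      fix i y assume y [simp]: "y \<in> Arr C" "Cod C y = D i" "Dom C y = Cod C k"
      show "\<pi> (Cod C k) i y \<cdot> (\<psi> (Cod C k) \<cdot> F \<star> k) = \<pi> (Cod C k) i y \<cdot> (N \<star> k \<cdot> \<psi> (Dom C k))"
        using extend[OF \<psi>(4)[of "Cod C k" y i], of "F \<star> k"] by (simp add: F.Cmp)
    qed simp_all
  qed simp_all
  then show thesis
  proof (rule that)
    show "\<pi> Y i y \<cdot> \<psi> Y = al i \<cdot> F \<star> y" if "y \<in> Arr C" "Cod C y = D i" "Dom C y = Y" for Y i y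
      using \<psi>(4)[of Y y i] that Dom_Ob[OF that(1)] by simp
  qed
qed

text \<open>After projection, the unit and multiplication conditions for the transformation of
  \<open>nat_trans_into_N\<close> are the algebra laws of \<open>a\<close> and
  \<open>b\<close>.\<close>

lemma monad_morphism_into_N:
  assumes M: "is_monad C M" and a: "monad_algebra C M A a" and b: "monad_algebra C M B b" and hom: "f \<cdot> a = b \<cdot> M \<star> f"
  obtains \<phi> where "monad_morphism C M N \<phi>"
    "\<And>Y i y. y \<in> Arr C \<Longrightarrow> Cod C y = D i \<Longrightarrow> Dom C y = Y \<Longrightarrow> \<pi> Y i y \<cdot> \<phi> Y = (if i then b else a) \<cdot> M \<star> y"
proof -
  interpret M: monad C M by (intro monadI category_axioms M)
  note [simp] = M.alg_arr[OF a] M.alg_arr[OF b]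
  let ?al = "\<lambda>i. if i then b else a"
  have al: "monad_algebra C M (D i) (?al i)" for i using a b by simp
  note [simp] = M.alg_arr[OF al]
  obtain \<phi> where \<phi>: "nat_trans C C M N \<phi>"
    "\<And>Y i y. y \<in> Arr C \<Longrightarrow> Cod C y = D i \<Longrightarrow> Dom C y = Y \<Longrightarrow> \<pi> Y i y \<cdot> \<phi> Y = ?al i \<cdot> M \<star> y"
  proof (rule nat_trans_into_N[OF M.is_functor, of ?al])
    show "?al i \<in> hom C (M \<diamondop> D i) (D i)" for i by (simp add: in_hom)
    show "f \<cdot> ?al False = ?al True \<cdot> M \<star> f" using hom by simp
  qed (rule that)
  note [simp] = nat_trans_simps[OF \<phi>(1)]
  note \<phi>2 = \<phi>(2) extend[OF \<phi>(2)]
  have "monad_morphism C M N \<phi>"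
    unfolding monad_morphism_def
  proof (intro conjI ballI \<phi>(1))
    fix X assume [simp]: "X \<in> Ob C"
    show "\<phi> X \<cdot> munit M X = munit N X"
    proof (rule \<pi>_joint_mono[of X])
      fix i y assume y [simp]: "y \<in> Arr C" "Cod C y = D i" "Dom C y = X"
      have "\<pi> X i y \<cdot> (\<phi> X \<cdot> munit M X) = (?al i \<cdot> munit M (D i)) \<cdot> y"
        by (simp add: \<phi>2 M.unit_nat del: if_split)
      also have "\<dots> = \<pi> X i y \<cdot> munit N X"
        unfolding M.alg_unit[OF al] by (simp del: if_split)
      finally show "\<pi> X i y \<cdot> (\<phi> X \<cdot> munit M X) = \<pi> X i y \<cdot> munit N X" .
    qed simp_all
    show "\<phi> X \<cdot> mmult M X = mmult N X \<cdot> N \<star> \<phi> X \<cdot> \<phi> (M \<diamondop> X)"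
    proof (rule \<pi>_joint_mono[of X])
      fix i y assume y [simp]: "y \<in> Arr C" "Cod C y = D i" "Dom C y = X"
      have "\<pi> X i y \<cdot> (\<phi> X \<cdot> mmult M X) = (?al i \<cdot> mmult M (D i)) \<cdot> M \<star> M \<star> y"
        by (simp add: \<phi>2 M.mult_nat del: if_split)
      also have "\<dots> = ?al i \<cdot> M \<star> (?al i \<cdot> M \<star> y)"
        unfolding M.alg_mult[OF al] by (simp add: M.Cmp del: if_split)
      also have "\<dots> = \<pi> X i y \<cdot> (mmult N X \<cdot> N \<star> \<phi> X \<cdot> \<phi> (M \<diamondop> X))"
        by (simp add: \<phi>2 del: if_split)
      finally show "\<pi> X i y \<cdot> (\<phi> X \<cdot> mmult M X) = \<pi> X i y \<cdot> (mmult N X \<cdot> N \<star> \<phi> X \<cdot> \<phi> (M \<diamondop> X))" .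
    qed simp_all
  qed
  then show thesis using that \<phi>(2) by blast
qed

text \<open>Projection at the identity makes \<open>D i\<close> an algebra of \<open>N\<close>, and
  algebras restrict along \<open>\<phi>\<close>. The square follows from \<open>\<pi>_f\<close> and
  naturality of \<open>\<phi>\<close>.\<close>

lemma monad_morphism_from_N:
  assumes M: "is_monad C M" and \<phi>: "monad_morphism C M N \<phi>"
  defines "al \<equiv> \<lambda>i. \<pi> (D i) i (idn (D i)) \<cdot> \<phi> (D i)"
  shows "monad_algebra C M (D i) (al i)" "f \<cdot> al False = al True \<cdot> M \<star> f"
proof -
  interpret M: monad C M by (intro monadI category_axioms M)
  interpret N: monad C N by (intro monadI category_axioms is_monad_N)
  have D [simp]: "D i \<in> Ob C" for i by simp
  have "monad_algebra C N (D i) (\<pi> (D i) i (idn (D i)))"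
    by (rule N.algI) (simp_all del: if_split)
  then show "monad_algebra C M (D i) (al i)"
    unfolding al_def using restrict_alg[OF is_monad_N M \<phi>] by blast
  have nat: "nat_trans C C M N \<phi>" using \<phi> by (simp add: monad_morphism_def)
  note [simp] = nat_trans_simps[OF nat]
  have "f \<cdot> al False = (f \<cdot> \<pi> A False (idn A)) \<cdot> \<phi> A" by (simp add: al_def)
  also have "\<dots> = \<pi> B True (idn B) \<cdot> (N \<star> f \<cdot> \<phi> A)"
    by (simp add: \<pi>_f)
  also have "N \<star> f \<cdot> \<phi> A = \<phi> B \<cdot> M \<star> f"
    using nat_trans_nat[OF nat, of f B] by simp
  finally show "f \<cdot> al False = al True \<cdot> M \<star> f"
    by (simp add: al_def)
qed

end

section \<open>Algebras of free monads and of coproducts of monads\<close>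

context lfp
begin

lemma arrow_endo: "f \<in> hom C A B \<Longrightarrow> arrow_endo C U A B f"
  by unfold_locales

context
  fixes F :: "('o, 'a) endo" and M :: "('o, 'a) mnd" and e
  assumes F: "is_functor C C F" and free: "free_monad C F M e"
begin

lemma free_monad_is_monad: "is_monad C M"
  using free by (simp add: free_monad_def)

lemma free_monad_nat: "nat_trans C C F M e"
  using free by (simp add: free_monad_def)

text \<open>The given square of \<open>F\<close>-structures is a natural transformation from
  \<open>F\<close> to the endomorphism monad of \<open>f\<close>. Its extension to \<open>M\<close>
  yields both algebra structures and the new square at once.\<close>

lemma free_monad_hom_exists:
  assumes f: "f \<in> hom C A B" and al: "\<alpha> \<in> hom C (F \<diamondop> A) A" "\<beta> \<in> hom C (F \<diamondop> B) B" "f \<cdot> \<alpha> = \<beta> \<cdot> F \<star> f"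
  obtains a b where "monad_algebra C M A a" "monad_algebra C M B b" "a \<cdot> e A = \<alpha>" "b \<cdot> e B = \<beta>" "f \<cdot> a = b \<cdot> M \<star> f"
proof -
  interpret arrow_endo C U A B f using f by (rule arrow_endo)
  interpret M: monad C M by (intro monadI category_axioms free_monad_is_monad)
  interpret F: functor_on C F by unfold_locales (rule F)
  let ?al = "\<lambda>i. if i then \<beta> else \<alpha>"
  obtain \<psi> where \<psi>: "nat_trans C C F N \<psi>"
    "\<And>Y i y. y \<in> Arr C \<Longrightarrow> Cod C y = D i \<Longrightarrow> Dom C y = Y \<Longrightarrow> \<pi> Y i y \<cdot> \<psi> Y = ?al i \<cdot> F \<star> y"
  proof (rule nat_trans_into_N[OF F, of ?al])
    show "?al i \<in> hom C (F \<diamondop> D i) (D i)" for i using al by simp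
    show "f \<cdot> ?al False = ?al True \<cdot> F \<star> f" using al by simp
  qed (rule that)
  obtain \<phi> where \<phi>: "monad_morphism C M N \<phi>" "\<And>X. X \<in> Ob C \<Longrightarrow> \<phi> X \<cdot> e X = \<psi> X"
    using free \<psi>(1) is_monad_N unfolding free_monad_def by blast
  note m = monad_morphism_from_N[OF free_monad_is_monad \<phi>(1)]
  have nat: "nat_trans C C M N \<phi>" using \<phi> by (simp add: monad_morphism_def)
  note [simp] = nat_trans_simps[OF nat] nat_trans_simps[OF free_monad_nat]
  have "(\<pi> A False (idn A) \<cdot> \<phi> A) \<cdot> e A = \<alpha>" "(\<pi> B True (idn B) \<cdot> \<phi> B) \<cdot> e B = \<beta>"
    using \<psi>(2)[of "idn A" False A] \<psi>(2)[of "idn B" True B] al by (auto simp: \<phi>(2) in_hom)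
  then show thesis
    using that m(1)[of False] m(1)[of True] m(2) by simp
qed

text \<open>Both structures become monad morphisms into the endomorphism monad of the identity of
  \<open>A\<close>. They agree on \<open>e\<close>, hence everywhere by the uniqueness clause of
  \<open>free_monad\<close>, and the structures are recovered by projection at the identity.\<close>

lemma free_monad_alg_unique:
  assumes a: "monad_algebra C M A a" and a': "monad_algebra C M A a'" and eq: "a \<cdot> e A = a' \<cdot> e A"
  shows "a = a'"
proof -
  interpret M: monad C M by (intro monadI category_axioms free_monad_is_monad)
  interpret F: functor_on C F by unfold_locales (rule F)
  note [simp] = M.alg_arr[OF a] M.alg_arr[OF a'] nat_trans_simps[OF free_monad_nat]
  interpret arrow_endo C U A A "idn A" by (rule arrow_endo) (simp add: in_hom)
  have [simp]: "D i = A" for i by (cases i) simp_all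
  obtain \<phi> where \<phi>: "monad_morphism C M N \<phi>"
    "\<And>Y i y. y \<in> Arr C \<Longrightarrow> Cod C y = D i \<Longrightarrow> Dom C y = Y \<Longrightarrow> \<pi> Y i y \<cdot> \<phi> Y = (if i then a else a) \<cdot> M \<star> y"
    by (rule monad_morphism_into_N[OF free_monad_is_monad a a]) simp_all
  obtain \<phi>' where \<phi>': "monad_morphism C M N \<phi>'"
    "\<And>Y i y. y \<in> Arr C \<Longrightarrow> Cod C y = D i \<Longrightarrow> Dom C y = Y \<Longrightarrow> \<pi> Y i y \<cdot> \<phi>' Y = (if i then a' else a') \<cdot> M \<star> y"
    by (rule monad_morphism_into_N[OF free_monad_is_monad a' a']) simp_all
  have nat: "nat_trans C C M N \<phi>" "nat_trans C C M N \<phi>'" using \<phi> \<phi>' by (simp_all add: monad_morphism_def)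
  note [simp] = nat_trans_simps[OF nat(1)] nat_trans_simps[OF nat(2)]
  have e_nat: "M \<star> y \<cdot> e Y = e A \<cdot> F \<star> y" if "y \<in> Arr C" "Cod C y = A" "Dom C y = Y" for y Y
    using nat_trans_nat[OF free_monad_nat that(1,2)] that(3) by simp
  have eq_e: "\<phi> X \<cdot> e X = \<phi>' X \<cdot> e X" if [simp]: "X \<in> Ob C" for X
  proof (rule \<pi>_joint_mono[OF that])
    fix i y assume [simp]: "y \<in> Arr C" "Cod C y = D i" "Dom C y = X"
    have "\<pi> X i y \<cdot> (\<phi> X \<cdot> e X) = (a \<cdot> e A) \<cdot> F \<star> y"
      using extend[OF \<phi>(2)[of y i X], of "e X"] by (simp add: e_nat)
    also have "\<dots> = \<pi> X i y \<cdot> (\<phi>' X \<cdot> e X)"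
      unfolding eq using extend[OF \<phi>'(2)[of y i X], of "e X"] by (simp add: e_nat)
    finally show "\<pi> X i y \<cdot> (\<phi> X \<cdot> e X) = \<pi> X i y \<cdot> (\<phi>' X \<cdot> e X)" .
  qed simp_all
  have "nat_trans C C F N (\<lambda>X. \<phi>' X \<cdot> e X)"
  proof (rule nat_transI)
    fix k assume [simp]: "k \<in> Arr C"
    show "(\<phi>' (Cod C k) \<cdot> e (Cod C k)) \<cdot> F \<star> k = N \<star> k \<cdot> (\<phi>' (Dom C k) \<cdot> e (Dom C k))"
      using nat_trans_nat[OF free_monad_nat, of k] extend[OF nat_trans_nat[OF nat(2), of k], of _ "e (Dom C k)"]
      by simp
  qed simp_all
  then obtain \<phi>0 where u:
    "\<And>\<xi>. monad_morphism C M N \<xi> \<Longrightarrow> \<forall>X\<in>Ob C. \<xi> X \<cdot> e X = \<phi>' X \<cdot> e X \<Longrightarrow> \<forall>X\<in>Ob C. \<xi> X = \<phi>0 X"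
    using free is_monad_N unfolding free_monad_def by blast
  have "\<forall>X\<in>Ob C. \<phi> X = \<phi>0 X" by (rule u[OF \<phi>(1)]) (use eq_e in blast)
  moreover have "\<forall>X\<in>Ob C. \<phi>' X = \<phi>0 X" by (rule u[OF \<phi>'(1)]) blast
  ultimately have "\<phi> A = \<phi>' A" by simp
  then show ?thesis using \<phi>(2)[of "idn A" False A] \<phi>'(2)[of "idn A" False A] by simp
qed

lemma free_monad_alg_exists:
  assumes "\<alpha> \<in> hom C (F \<diamondop> A) A"
  obtains a where "monad_algebra C M A a" "a \<cdot> e A = \<alpha>"
proof -
  interpret F: functor_on C F by unfold_locales (rule F)
  have [simp]: "A \<in> Ob C" using assms by (auto simp: in_hom)
  show thesis
    by (rule free_monad_hom_exists[of "idn A" A A \<alpha> \<alpha>]) (use assms that in \<open>auto simp: in_hom\<close>)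
qed

text \<open>The square on generators extends to some pair of structures with a square on
  \<open>M\<close>; uniqueness identifies this pair with \<open>a\<close> and
  \<open>b\<close>.\<close>

lemma free_monad_hom:
  assumes f: "f \<in> hom C A B" and a: "monad_algebra C M A a" and b: "monad_algebra C M B b"
    and hom: "f \<cdot> (a \<cdot> e A) = (b \<cdot> e B) \<cdot> F \<star> f"
  shows "f \<cdot> a = b \<cdot> M \<star> f"
proof -
  interpret M: monad C M by (intro monadI category_axioms free_monad_is_monad)
  note [simp] = M.alg_arr[OF a] M.alg_arr[OF b] nat_trans_simps[OF free_monad_nat]
  show ?thesis
  proof (rule free_monad_hom_exists[OF f _ _ hom])
    show "a \<cdot> e A \<in> hom C (F \<diamondop> A) A" "b \<cdot> e B \<in> hom C (F \<diamondop> B) B" by (simp_all add: in_hom)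
    fix a' b' assume *: "monad_algebra C M A a'" "monad_algebra C M B b'" "a' \<cdot> e A = a \<cdot> e A" "b' \<cdot> e B = b \<cdot> e B"
      and "f \<cdot> a' = b' \<cdot> M \<star> f"
    moreover have "a' = a" "b' = b" using * a b free_monad_alg_unique by blast+
    ultimately show ?thesis by simp
  qed
qed

end

context
  fixes M M' Q :: "('o, 'a) mnd" and in1 in2
  assumes coprod: "monad_coproduct C M M' Q in1 in2"
begin

lemma monad_coproduct_monads: "is_monad C M" "is_monad C M'" "is_monad C Q"
  and monad_coproduct_morphisms: "monad_morphism C M Q in1" "monad_morphism C M' Q in2"
  using coprod by (simp_all add: monad_coproduct_def)

lemma monad_coproduct_nat: "nat_trans C C M Q in1" "nat_trans C C M' Q in2"
  using monad_coproduct_morphisms by (simp_all add: monad_morphism_def)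

text \<open>As for free monads, with the copairing of two monad morphisms into the endomorphism
  monad in place of the free extension.\<close>

lemma monad_coproduct_hom_exists:
  assumes f: "f \<in> hom C A B"
    and alg: "monad_algebra C M A a" "monad_algebra C M B b" "f \<cdot> a = b \<cdot> M \<star> f"
      "monad_algebra C M' A a'" "monad_algebra C M' B b'" "f \<cdot> a' = b' \<cdot> M' \<star> f"
  obtains p q where "monad_algebra C Q A p" "monad_algebra C Q B q" "p \<cdot> in1 A = a" "p \<cdot> in2 A = a'"
    "q \<cdot> in1 B = b" "q \<cdot> in2 B = b'" "f \<cdot> p = q \<cdot> Q \<star> f"
proof -
  interpret M: monad C M by (intro monadI category_axioms monad_coproduct_monads)
  interpret M': monad C M' by (intro monadI category_axioms monad_coproduct_monads)
  interpret Q: monad C Q by (intro monadI category_axioms monad_coproduct_monads)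
  interpret arrow_endo C U A B f using f by (rule arrow_endo)
  obtain \<phi> where \<phi>: "monad_morphism C M N \<phi>"
    "\<And>Y i y. y \<in> Arr C \<Longrightarrow> Cod C y = D i \<Longrightarrow> Dom C y = Y \<Longrightarrow> \<pi> Y i y \<cdot> \<phi> Y = (if i then b else a) \<cdot> M \<star> y"
    by (rule monad_morphism_into_N[OF monad_coproduct_monads(1) alg(1-3)]) (rule that)
  obtain \<phi>' where \<phi>': "monad_morphism C M' N \<phi>'"
    "\<And>Y i y. y \<in> Arr C \<Longrightarrow> Cod C y = D i \<Longrightarrow> Dom C y = Y \<Longrightarrow> \<pi> Y i y \<cdot> \<phi>' Y = (if i then b' else a') \<cdot> M' \<star> y"
    by (rule monad_morphism_into_N[OF monad_coproduct_monads(2) alg(4-6)]) (rule that)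
  obtain \<xi> where \<xi>: "monad_morphism C Q N \<xi>" "\<And>X. X \<in> Ob C \<Longrightarrow> \<xi> X \<cdot> in1 X = \<phi> X"
    "\<And>X. X \<in> Ob C \<Longrightarrow> \<xi> X \<cdot> in2 X = \<phi>' X"
    using coprod is_monad_N \<phi>(1) \<phi>'(1) unfolding monad_coproduct_def by blast
  note m = monad_morphism_from_N[OF monad_coproduct_monads(3) \<xi>(1)]
  have nat: "nat_trans C C Q N \<xi>" using \<xi> by (simp add: monad_morphism_def)
  note [simp] = nat_trans_simps[OF nat] nat_trans_simps[OF monad_coproduct_nat(1)] nat_trans_simps[OF monad_coproduct_nat(2)]
    M.alg_arr[OF alg(1)] M.alg_arr[OF alg(2)] M'.alg_arr[OF alg(4)] M'.alg_arr[OF alg(5)]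
  have "(\<pi> A False (idn A) \<cdot> \<xi> A) \<cdot> in1 A = a" "(\<pi> B True (idn B) \<cdot> \<xi> B) \<cdot> in1 B = b"
    "(\<pi> A False (idn A) \<cdot> \<xi> A) \<cdot> in2 A = a'" "(\<pi> B True (idn B) \<cdot> \<xi> B) \<cdot> in2 B = b'"
    using \<phi>(2)[of "idn A" False A] \<phi>(2)[of "idn B" True B] \<phi>'(2)[of "idn A" False A] \<phi>'(2)[of "idn B" True B]
    by (auto simp: \<xi>(2,3))
  then show thesis
    using that m(1)[of False] m(1)[of True] m(2) by simp
qed

lemma monad_coproduct_alg_unique:
  assumes p: "monad_algebra C Q A p" and q: "monad_algebra C Q A q"
    and eq: "p \<cdot> in1 A = q \<cdot> in1 A" "p \<cdot> in2 A = q \<cdot> in2 A"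
  shows "p = q"
proof -
  interpret M: monad C M by (intro monadI category_axioms monad_coproduct_monads)
  interpret M': monad C M' by (intro monadI category_axioms monad_coproduct_monads)
  interpret Q: monad C Q by (intro monadI category_axioms monad_coproduct_monads)
  note nats = monad_coproduct_nat
  note [simp] = Q.alg_arr[OF p] Q.alg_arr[OF q] nat_trans_simps[OF nats(1)] nat_trans_simps[OF nats(2)]
  interpret arrow_endo C U A A "idn A" by (rule arrow_endo) (simp add: in_hom)
  have [simp]: "D i = A" for i by (cases i) simp_all
  obtain \<phi> where \<phi>: "monad_morphism C Q N \<phi>"
    "\<And>Y i y. y \<in> Arr C \<Longrightarrow> Cod C y = D i \<Longrightarrow> Dom C y = Y \<Longrightarrow> \<pi> Y i y \<cdot> \<phi> Y = (if i then p else p) \<cdot> Q \<star> y"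
    by (rule monad_morphism_into_N[OF monad_coproduct_monads(3) p p]) simp_all
  obtain \<phi>' where \<phi>': "monad_morphism C Q N \<phi>'"
    "\<And>Y i y. y \<in> Arr C \<Longrightarrow> Cod C y = D i \<Longrightarrow> Dom C y = Y \<Longrightarrow> \<pi> Y i y \<cdot> \<phi>' Y = (if i then q else q) \<cdot> Q \<star> y"
    by (rule monad_morphism_into_N[OF monad_coproduct_monads(3) q q]) simp_all
  note m = restrict_alg[OF monad_coproduct_monads(3) monad_coproduct_monads(1) monad_coproduct_morphisms(1) q]
    restrict_alg[OF monad_coproduct_monads(3) monad_coproduct_monads(2) monad_coproduct_morphisms(2) q]
  obtain \<chi> where \<chi>: "monad_morphism C M N \<chi>"
    "\<And>Y i y. y \<in> Arr C \<Longrightarrow> Cod C y = D i \<Longrightarrow> Dom C y = Y \<Longrightarrow> \<pi> Y i y \<cdot> \<chi> Y = (if i then q \<cdot> in1 A else q \<cdot> in1 A) \<cdot> M \<star> y"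
    by (rule monad_morphism_into_N[OF monad_coproduct_monads(1) m(1) m(1)]) simp_all
  obtain \<chi>' where \<chi>': "monad_morphism C M' N \<chi>'"
    "\<And>Y i y. y \<in> Arr C \<Longrightarrow> Cod C y = D i \<Longrightarrow> Dom C y = Y \<Longrightarrow> \<pi> Y i y \<cdot> \<chi>' Y = (if i then q \<cdot> in2 A else q \<cdot> in2 A) \<cdot> M' \<star> y"
    by (rule monad_morphism_into_N[OF monad_coproduct_monads(2) m(2) m(2)]) simp_all
  have nat: "nat_trans C C Q N \<phi>" "nat_trans C C Q N \<phi>'" "nat_trans C C M N \<chi>" "nat_trans C C M' N \<chi>'"
    using \<phi> \<phi>' \<chi> \<chi>' by (simp_all add: monad_morphism_def)
  note [simp] = nat_trans_simps[OF nat(1)] nat_trans_simps[OF nat(2)] nat_trans_simps[OF nat(3)] nat_trans_simps[OF nat(4)]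
  \<comment> \<open>Stated for a general \<open>r\<close> because it serves both \<open>p\<close>
    and \<open>q\<close>: the two morphisms have the same restrictions \<open>\<chi>\<close> and
    \<open>\<chi>'\<close> and hence coincide.\<close>
  have restr: "\<xi> X \<cdot> in1 X = \<chi> X" "\<xi> X \<cdot> in2 X = \<chi>' X"
    if [simp]: "X \<in> Ob C" and \<xi>: "nat_trans C C Q N \<xi>"
      "\<And>i y. y \<in> Arr C \<Longrightarrow> Cod C y = D i \<Longrightarrow> Dom C y = X \<Longrightarrow> \<pi> X i y \<cdot> \<xi> X = r \<cdot> Q \<star> y"
      and r: "r \<cdot> in1 A = q \<cdot> in1 A" "r \<cdot> in2 A = q \<cdot> in2 A" "r \<in> Arr C" "Dom C r = Q \<diamondop> A" for X \<xi> r
  proof -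
    note [simp] = nat_trans_simps[OF \<xi>(1)] r(3,4)
    show "\<xi> X \<cdot> in1 X = \<chi> X"
    proof (rule \<pi>_joint_mono[of X])
      fix i y assume [simp]: "y \<in> Arr C" "Cod C y = D i" "Dom C y = X"
      have "\<pi> X i y \<cdot> (\<xi> X \<cdot> in1 X) = (r \<cdot> in1 A) \<cdot> M \<star> y"
        using extend[OF \<xi>(2)[of y i], of "in1 X"] nat_trans_nat[OF nats(1), of y A] by simp
      then show "\<pi> X i y \<cdot> (\<xi> X \<cdot> in1 X) = \<pi> X i y \<cdot> \<chi> X"
        unfolding r using \<chi>(2)[of y i X] by simp
    qed simp_all
    show "\<xi> X \<cdot> in2 X = \<chi>' X"
    proof (rule \<pi>_joint_mono[of X])
      fix i y assume [simp]: "y \<in> Arr C" "Cod C y = D i" "Dom C y = X"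
      have "\<pi> X i y \<cdot> (\<xi> X \<cdot> in2 X) = (r \<cdot> in2 A) \<cdot> M' \<star> y"
        using extend[OF \<xi>(2)[of y i], of "in2 X"] nat_trans_nat[OF nats(2), of y A] by simp
      then show "\<pi> X i y \<cdot> (\<xi> X \<cdot> in2 X) = \<pi> X i y \<cdot> \<chi>' X"
        unfolding r using \<chi>'(2)[of y i X] by simp
    qed simp_all
  qed
  have eq1: "\<phi> X \<cdot> in1 X = \<chi> X" "\<phi> X \<cdot> in2 X = \<chi>' X" if "X \<in> Ob C" for X
    using restr[OF that nat(1), of p] eq \<phi>(2) by auto
  have eq2: "\<phi>' X \<cdot> in1 X = \<chi> X" "\<phi>' X \<cdot> in2 X = \<chi>' X" if "X \<in> Ob C" for X
    using restr[OF that nat(2), of q] \<phi>'(2) by auto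
  obtain \<xi>0 where u:
    "\<And>\<xi>. monad_morphism C Q N \<xi> \<Longrightarrow> \<forall>X\<in>Ob C. \<xi> X \<cdot> in1 X = \<chi> X \<and> \<xi> X \<cdot> in2 X = \<chi>' X \<Longrightarrow>
       \<forall>X\<in>Ob C. \<xi> X = \<xi>0 X"
    using coprod is_monad_N \<chi>(1) \<chi>'(1) unfolding monad_coproduct_def by blast
  have "\<forall>X\<in>Ob C. \<phi> X = \<xi>0 X" by (rule u[OF \<phi>(1)]) (use eq1 in blast)
  moreover have "\<forall>X\<in>Ob C. \<phi>' X = \<xi>0 X" by (rule u[OF \<phi>'(1)]) (use eq2 in blast)
  ultimately have "\<phi> A = \<phi>' A" by simp
  then show ?thesis using \<phi>(2)[of "idn A" False A] \<phi>'(2)[of "idn A" False A] by simp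
qed

lemma monad_coproduct_alg_exists:
  assumes a: "monad_algebra C M A a" "monad_algebra C M' A a'"
  obtains p where "monad_algebra C Q A p" "p \<cdot> in1 A = a" "p \<cdot> in2 A = a'"
proof -
  interpret M: monad C M by (intro monadI category_axioms monad_coproduct_monads)
  interpret M': monad C M' by (intro monadI category_axioms monad_coproduct_monads)
  note [simp] = M.alg_arr[OF a(1)] M'.alg_arr[OF a(2)]
  show thesis
    by (rule monad_coproduct_hom_exists[of "idn A" A A a a a' a']) (use a that in \<open>auto simp: in_hom\<close>)
qed

lemma monad_coproduct_hom:
  assumes f: "f \<in> hom C A B" and p: "monad_algebra C Q A p" and q: "monad_algebra C Q B q"
    and hom: "f \<cdot> (p \<cdot> in1 A) = (q \<cdot> in1 B) \<cdot> M \<star> f" "f \<cdot> (p \<cdot> in2 A) = (q \<cdot> in2 B) \<cdot> M' \<star> f"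
  shows "f \<cdot> p = q \<cdot> Q \<star> f"
proof -
  note r1 = restrict_alg[OF monad_coproduct_monads(3) monad_coproduct_monads(1) monad_coproduct_morphisms(1)]
    and r2 = restrict_alg[OF monad_coproduct_monads(3) monad_coproduct_monads(2) monad_coproduct_morphisms(2)]
  show ?thesis
  proof (rule monad_coproduct_hom_exists[OF f r1[OF p] r1[OF q] hom(1) r2[OF p] r2[OF q] hom(2)])
    fix p' q' assume *: "monad_algebra C Q A p'" "monad_algebra C Q B q'" "p' \<cdot> in1 A = p \<cdot> in1 A" "p' \<cdot> in2 A = p \<cdot> in2 A"
      "q' \<cdot> in1 B = q \<cdot> in1 B" "q' \<cdot> in2 B = q \<cdot> in2 B" and "f \<cdot> p' = q' \<cdot> Q \<star> f"
    moreover have "p' = p" "q' = q" using * p q monad_coproduct_alg_unique by blast+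
    ultimately show ?thesis by simp
  qed
qed

end

end

section \<open>Recursion with parameters along an adjunction\<close>

locale adjoint_monad = category C + K: monad C K
  for C :: "('o, 'a) cat" (structure) and K :: "('o, 'a) mnd" +
  fixes L :: "('o, 'a) endo" and Ad :: "('o, 'a) adj"
  assumes adj: "is_adjunction C L Ad"
begin

abbreviation "R \<equiv> radj Ad"
abbreviation "\<eta> \<equiv> aunit Ad"
abbreviation "\<epsilon> \<equiv> acounit Ad"

sublocale L: functor_on C L by unfold_locales (use adj in \<open>simp add: is_adjunction_def\<close>)
sublocale R: functor_on C R by unfold_locales (use adj in \<open>simp add: is_adjunction_def\<close>)

lemma nat_\<eta>: "nat_trans C C id_ftor (ftor_comp R L) \<eta>"
  and nat_\<epsilon>: "nat_trans C C (ftor_comp L R) id_ftor \<epsilon>"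
  using adj by (auto simp: is_adjunction_def)

lemma \<eta>_arr [simp]:
  assumes "X \<in> Ob C"
  shows "\<eta> X \<in> Arr C" "Dom C (\<eta> X) = X" "Cod C (\<eta> X) = R \<diamondop> L \<diamondop> X"
  using nat_trans_simps[OF nat_\<eta> assms] by auto

lemma \<epsilon>_arr [simp]:
  assumes "X \<in> Ob C"
  shows "\<epsilon> X \<in> Arr C" "Dom C (\<epsilon> X) = L \<diamondop> R \<diamondop> X" "Cod C (\<epsilon> X) = X"
  using nat_trans_simps[OF nat_\<epsilon> assms] by auto

lemma \<eta>_nat: "f \<in> Arr C \<Longrightarrow> Cod C f = Y \<Longrightarrow> \<eta> Y \<cdot> f = R \<star> L \<star> f \<cdot> \<eta> (Dom C f)"
  using nat_trans_nat[OF nat_\<eta>] by simp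

lemma \<epsilon>_nat: "f \<in> Arr C \<Longrightarrow> Cod C f = Y \<Longrightarrow> \<epsilon> Y \<cdot> L \<star> R \<star> f = f \<cdot> \<epsilon> (Dom C f)"
  using nat_trans_nat[OF nat_\<epsilon>] by simp

lemma triangle_L: "X \<in> Ob C \<Longrightarrow> \<epsilon> (L \<diamondop> X) \<cdot> L \<star> \<eta> X = idn (L \<diamondop> X)"
  and triangle_R: "X \<in> Ob C \<Longrightarrow> R \<star> \<epsilon> X \<cdot> \<eta> (R \<diamondop> X) = idn (R \<diamondop> X)"
  using adj by (auto simp: is_adjunction_def)

lemmas \<epsilon>_nat' = extend[OF \<epsilon>_nat]

definition rkl :: "('o, 'a) mnd" where
  "rkl = \<lparr> fob = (\<lambda>X. R \<diamondop> K \<diamondop> L \<diamondop> X), far = (\<lambda>f. R \<star> K \<star> L \<star> f),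
     munit = (\<lambda>X. R \<star> munit K (L \<diamondop> X) \<cdot> \<eta> X),
     mmult = (\<lambda>X. R \<star> mmult K (L \<diamondop> X) \<cdot> R \<star> K \<star> \<epsilon> (K \<diamondop> L \<diamondop> X)) \<rparr>"

lemma rkl_simps:
  "rkl \<diamondop> X = R \<diamondop> K \<diamondop> L \<diamondop> X" "rkl \<star> f = R \<star> K \<star> L \<star> f"
  "munit rkl X = R \<star> munit K (L \<diamondop> X) \<cdot> \<eta> X"
  "X \<in> Ob C \<Longrightarrow> mmult rkl X = R \<star> (mmult K (L \<diamondop> X) \<cdot> K \<star> \<epsilon> (K \<diamondop> L \<diamondop> X))"
  by (simp_all add: rkl_def R.Cmp)

text \<open>The unit laws combine those of \<open>K\<close> with the triangle identities;
  associativity combines that of \<open>K\<close> with naturality of the counit.\<close>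

lemma is_monad_rkl: "is_monad C rkl"
proof (rule is_monadI[OF category_axioms])
  show "is_functor C C rkl"
    by (rule functorI[OF category_axioms]) (auto simp: rkl_simps R.Cmp K.Cmp L.Cmp)
  show "nat_trans C C id_ftor rkl (munit rkl)"
  proof (rule nat_transI)
    fix f assume [simp]: "f \<in> Arr C"
    show "munit rkl (Cod C f) \<cdot> id_ftor \<star> f = rkl \<star> f \<cdot> munit rkl (Dom C f)"
      by (simp add: rkl_simps \<eta>_nat R.Cmp_rev R.Cmp_rev' K.unit_nat)
  qed (simp_all add: rkl_simps)
  show "nat_trans C C (ftor_comp rkl rkl) rkl (mmult rkl)"
  proof (rule nat_transI)
    fix f assume [simp]: "f \<in> Arr C"
    have "mmult K (L \<diamondop> Cod C f) \<cdot> (K \<star> \<epsilon> (K \<diamondop> L \<diamondop> Cod C f) \<cdot> K \<star> L \<star> R \<star> K \<star> L \<star> f)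
        = K \<star> L \<star> f \<cdot> (mmult K (L \<diamondop> Dom C f) \<cdot> K \<star> \<epsilon> (K \<diamondop> L \<diamondop> Dom C f))"
      by (simp add: K.Cmp_rev \<epsilon>_nat) (simp add: K.Cmp K.mult_nat')
    then show "mmult rkl (Cod C f) \<cdot> ftor_comp rkl rkl \<star> f = rkl \<star> f \<cdot> mmult rkl (Dom C f)"
      by (simp add: rkl_simps R.Cmp_rev)
  qed (simp_all add: rkl_simps)
  fix X assume [simp]: "X \<in> Ob C"
  let ?A = "K \<diamondop> L \<diamondop> X"
  have "mmult K (L \<diamondop> X) \<cdot> (K \<star> \<epsilon> ?A \<cdot> munit K (L \<diamondop> R \<diamondop> ?A)) = mmult K (L \<diamondop> X) \<cdot> (munit K ?A \<cdot> \<epsilon> ?A)"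
    by (simp add: K.unit_nat)
  also have "\<dots> = \<epsilon> ?A"
    by (simp add: K.unit_left')
  finally have "mmult K (L \<diamondop> X) \<cdot> (K \<star> \<epsilon> ?A \<cdot> munit K (L \<diamondop> R \<diamondop> ?A)) = \<epsilon> ?A" .
  then show "mmult rkl X \<cdot> munit rkl (rkl \<diamondop> X) = idn (rkl \<diamondop> X)"
    by (simp add: rkl_simps R.Cmp_rev' triangle_R)
  have "mmult K (L \<diamondop> X) \<cdot> (K \<star> \<epsilon> (K \<diamondop> L \<diamondop> X) \<cdot> (K \<star> L \<star> R \<star> munit K (L \<diamondop> X) \<cdot> K \<star> L \<star> \<eta> X)) = idn (K \<diamondop> L \<diamondop> X)"
    by (simp add: K.Cmp_rev K.Cmp_rev' \<epsilon>_nat' triangle_L K.unit_right)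
  then show "mmult rkl X \<cdot> rkl \<star> munit rkl X = idn (rkl \<diamondop> X)"
    by (simp add: rkl_simps R.Cmp_rev K.Cmp L.Cmp)
  have "(mmult K (L \<diamondop> X) \<cdot> K \<star> \<epsilon> ?A) \<cdot> (mmult K (L \<diamondop> R \<diamondop> ?A) \<cdot> K \<star> \<epsilon> (K \<diamondop> L \<diamondop> R \<diamondop> ?A))
      = mmult K (L \<diamondop> X) \<cdot> (mmult K ?A \<cdot> (K \<star> K \<star> \<epsilon> ?A \<cdot> K \<star> \<epsilon> (K \<diamondop> L \<diamondop> R \<diamondop> ?A)))"
    by (simp add: K.mult_nat'[of "\<epsilon> ?A"])
  also have "\<dots> = mmult K (L \<diamondop> X) \<cdot> (K \<star> mmult K (L \<diamondop> X) \<cdot> K \<star> (K \<star> \<epsilon> ?A \<cdot> \<epsilon> (K \<diamondop> L \<diamondop> R \<diamondop> ?A)))"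
    by (simp add: K.mult_assoc' K.Cmp)
  also have "\<dots> = mmult K (L \<diamondop> X) \<cdot> (K \<star> \<epsilon> ?A \<cdot> K \<star> L \<star> R \<star> (mmult K (L \<diamondop> X) \<cdot> K \<star> \<epsilon> ?A))"
    using \<epsilon>_nat[of "mmult K (L \<diamondop> X) \<cdot> K \<star> \<epsilon> ?A"] by (simp add: K.Cmp_rev)
  finally show "mmult rkl X \<cdot> mmult rkl (rkl \<diamondop> X) = mmult rkl X \<cdot> rkl \<star> mmult rkl X"
    by (simp add: rkl_simps R.Cmp_rev)
qed

lemma transpose_eqI:
  assumes "u \<in> Arr C" "v \<in> Arr C" "Dom C u = L \<diamondop> X" "Dom C v = L \<diamondop> X" "Cod C u = Cod C v" "X \<in> Ob C"
    and eq: "R \<star> u \<cdot> \<eta> X = R \<star> v \<cdot> \<eta> X"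
  shows "u = v"
proof -
  have "u = \<epsilon> (Cod C u) \<cdot> L \<star> (R \<star> u \<cdot> \<eta> X)" if "u \<in> Arr C" "Dom C u = L \<diamondop> X" for u
    using that assms by (simp add: L.Cmp \<epsilon>_nat' triangle_L)
  from this[of u] this[of v] show ?thesis using assms by simp
qed

end

text \<open>
  A monad morphism \<open>\<phi>: S \<rightarrow> RKL\<close> out of the free monad \<open>S\<close> on \<open>Sig\<close> amounts to a definition by
  recursion with parameters: its transpose \<open>hbar: LS \<rightarrow> KL\<close> extends \<open>h: L Sig \<rightarrow> KL\<close>.
\<close>

locale param_recursion = adjoint_monad C K L Ad + S: monad C S + Sig: functor_on C Sig
  for C :: "('o, 'a) cat" (structure) and K L Ad S and Sig :: "('o, 'a) endo" +
  fixes ins h \<phi> :: "'o \<Rightarrow> 'a"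
  assumes nat_ins: "nat_trans C C Sig S ins"
    and S_alg_exists: "\<alpha> \<in> hom C (Sig \<diamondop> X) X \<Longrightarrow> \<exists>a. monad_algebra C S X a \<and> a \<cdot> ins X = \<alpha>"
    and S_hom: "\<lbrakk>f \<in> hom C X Y; monad_algebra C S X a; monad_algebra C S Y b;
                  f \<cdot> (a \<cdot> ins X) = (b \<cdot> ins Y) \<cdot> Sig \<star> f\<rbrakk> \<Longrightarrow> f \<cdot> a = b \<cdot> S \<star> f"
    and nat_h: "nat_trans C C (ftor_comp L Sig) (ftor_comp K L) h"
    and \<phi>: "monad_morphism C S rkl \<phi>"
    and \<phi>_ins: "X \<in> Ob C \<Longrightarrow> \<phi> X \<cdot> ins X = R \<star> h X \<cdot> \<eta> (Sig \<diamondop> X)"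
begin

lemma ins_arr [simp]:
  assumes "X \<in> Ob C"
  shows "ins X \<in> Arr C" "Dom C (ins X) = Sig \<diamondop> X" "Cod C (ins X) = S \<diamondop> X"
  using nat_trans_simps[OF nat_ins assms] by auto

lemma h_arr_simps [simp]:
  assumes "X \<in> Ob C"
  shows "h X \<in> Arr C" "Dom C (h X) = L \<diamondop> Sig \<diamondop> X" "Cod C (h X) = K \<diamondop> L \<diamondop> X"
  using nat_trans_simps[OF nat_h assms] by auto

lemma h_nat: "f \<in> Arr C \<Longrightarrow> Cod C f = Y \<Longrightarrow> h Y \<cdot> L \<star> Sig \<star> f = K \<star> L \<star> f \<cdot> h (Dom C f)"
  using nat_trans_nat[OF nat_h] by simp

lemma nat_\<phi>: "nat_trans C C S rkl \<phi>"
  using \<phi> by (simp add: monad_morphism_def)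

lemma \<phi>_arr [simp]:
  assumes "X \<in> Ob C"
  shows "\<phi> X \<in> Arr C" "Dom C (\<phi> X) = S \<diamondop> X" "Cod C (\<phi> X) = R \<diamondop> K \<diamondop> L \<diamondop> X"
  using nat_trans_simps[OF nat_\<phi> assms] by (auto simp: rkl_simps)

definition hbar :: "'o \<Rightarrow> 'a" where
  "hbar X = \<epsilon> (K \<diamondop> L \<diamondop> X) \<cdot> L \<star> \<phi> X"

lemma hbar_arr [simp]:
  assumes "X \<in> Ob C"
  shows "hbar X \<in> Arr C" "Dom C (hbar X) = L \<diamondop> S \<diamondop> X" "Cod C (hbar X) = K \<diamondop> L \<diamondop> X"
  using assms by (auto simp: hbar_def)

text \<open>This and the next two lemmas transpose the conditions on \<open>\<phi>\<close> for the
  unit, the multiplication and the generators.\<close>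

lemma hbar_unit:
  assumes [simp]: "X \<in> Ob C"
  shows "hbar X \<cdot> L \<star> munit S X = munit K (L \<diamondop> X)"
proof -
  have "\<phi> X \<cdot> munit S X = R \<star> munit K (L \<diamondop> X) \<cdot> \<eta> X"
    using \<phi> by (simp add: monad_morphism_def rkl_simps)
  then have "hbar X \<cdot> L \<star> munit S X = \<epsilon> (K \<diamondop> L \<diamondop> X) \<cdot> L \<star> (R \<star> munit K (L \<diamondop> X) \<cdot> \<eta> X)"
    by (simp add: hbar_def L.Cmp_rev)
  also have "\<dots> = munit K (L \<diamondop> X)"
    by (simp add: L.Cmp \<epsilon>_nat' triangle_L)
  finally show ?thesis .
qed

lemma hbar_mult:
  assumes [simp]: "X \<in> Ob C"
  shows "hbar X \<cdot> L \<star> mmult S X = mmult K (L \<diamondop> X) \<cdot> (K \<star> hbar X \<cdot> hbar (S \<diamondop> X))"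
proof -
  let ?A = "K \<diamondop> L \<diamondop> X"
  have "\<phi> X \<cdot> mmult S X = R \<star> (mmult K (L \<diamondop> X) \<cdot> K \<star> \<epsilon> ?A) \<cdot> (R \<star> K \<star> L \<star> \<phi> X \<cdot> \<phi> (S \<diamondop> X))"
    using \<phi> by (simp add: monad_morphism_def rkl_simps)
  also have "\<dots> = R \<star> (mmult K (L \<diamondop> X) \<cdot> K \<star> hbar X) \<cdot> \<phi> (S \<diamondop> X)"
    by (simp add: hbar_def K.Cmp R.Cmp)
  finally have "hbar X \<cdot> L \<star> mmult S X = \<epsilon> ?A \<cdot> L \<star> (R \<star> (mmult K (L \<diamondop> X) \<cdot> K \<star> hbar X) \<cdot> \<phi> (S \<diamondop> X))"
    by (simp add: hbar_def L.Cmp_rev)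
  also have "\<dots> = (mmult K (L \<diamondop> X) \<cdot> K \<star> hbar X) \<cdot> (\<epsilon> (K \<diamondop> L \<diamondop> S \<diamondop> X) \<cdot> L \<star> \<phi> (S \<diamondop> X))"
    using \<epsilon>_nat'[of "mmult K (L \<diamondop> X) \<cdot> K \<star> hbar X" ?A "L \<star> \<phi> (S \<diamondop> X)"]
    by (simp add: L.Cmp)
  finally show ?thesis by (simp add: hbar_def)
qed

lemma hbar_ins:
  assumes [simp]: "X \<in> Ob C"
  shows "hbar X \<cdot> L \<star> ins X = h X"
proof -
  have "hbar X \<cdot> L \<star> ins X = \<epsilon> (K \<diamondop> L \<diamondop> X) \<cdot> L \<star> (R \<star> h X \<cdot> \<eta> (Sig \<diamondop> X))"
    by (simp add: hbar_def L.Cmp_rev \<phi>_ins)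
  also have "\<dots> = h X"
    by (simp add: L.Cmp \<epsilon>_nat' triangle_L)
  finally show ?thesis .
qed

context
  fixes X Z :: 'o and z :: 'a
  assumes X [simp]: "X \<in> Ob C" and z: "monad_algebra C K Z z"
begin

lemmas z_arr = K.alg_arr[OF z]

text \<open>\<open>hbar X\<close> iterates \<open>h\<close> with results in the free
  \<open>K\<close>-algebra on \<open>L \<diamondop> X\<close>; \<open>K \<star> u0\<close>
  substitutes the base values and \<open>z\<close> evaluates.\<close>

lemma recursion_exists:
  assumes u0: "u0 \<in> Arr C" "Dom C u0 = L \<diamondop> X" "Cod C u0 = Z"
  defines "u \<equiv> z \<cdot> (K \<star> u0 \<cdot> hbar X)"
  shows "u \<cdot> L \<star> munit S X = u0"
    and "u \<cdot> L \<star> (mmult S X \<cdot> ins (S \<diamondop> X)) = z \<cdot> (K \<star> u \<cdot> h (S \<diamondop> X))"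
proof -
  note [simp] = z_arr u0
  have "u \<cdot> L \<star> munit S X = (z \<cdot> munit K Z) \<cdot> u0"
    by (simp add: u_def hbar_unit K.unit_nat)
  then show "u \<cdot> L \<star> munit S X = u0" by (simp add: K.alg_unit[OF z])
  have "u \<cdot> L \<star> (mmult S X \<cdot> ins (S \<diamondop> X)) = z \<cdot> (K \<star> u0 \<cdot> ((hbar X \<cdot> L \<star> mmult S X) \<cdot> L \<star> ins (S \<diamondop> X)))"
    by (simp add: u_def L.Cmp)
  also have "\<dots> = (z \<cdot> mmult K Z) \<cdot> (K \<star> K \<star> u0 \<cdot> (K \<star> hbar X \<cdot> h (S \<diamondop> X)))"
    by (simp add: hbar_mult hbar_ins K.mult_nat'[of u0])
  also have "\<dots> = z \<cdot> (K \<star> u \<cdot> h (S \<diamondop> X))"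
    by (simp add: K.alg_mult[OF z] u_def K.Cmp)
  finally show "u \<cdot> L \<star> (mmult S X \<cdot> ins (S \<diamondop> X)) = z \<cdot> (K \<star> u \<cdot> h (S \<diamondop> X))" .
qed

text \<open>Transposed, the recursion says that the transpose of \<open>u\<close> is a homomorphism
  of \<open>Sig\<close>-algebras from \<open>S \<diamondop> X\<close> to
  \<open>R \<diamondop> Z\<close>. It is then a homomorphism of \<open>S\<close>-algebras, and on a
  free algebra such a map is determined by its restriction to the unit.\<close>

lemma recursion_unique:
  assumes u: "u \<in> Arr C" "Dom C u = L \<diamondop> S \<diamondop> X" "Cod C u = Z"
    and u': "u' \<in> Arr C" "Dom C u' = L \<diamondop> S \<diamondop> X" "Cod C u' = Z"
    and rec: "u \<cdot> L \<star> (mmult S X \<cdot> ins (S \<diamondop> X)) = z \<cdot> (K \<star> u \<cdot> h (S \<diamondop> X))"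
      "u' \<cdot> L \<star> (mmult S X \<cdot> ins (S \<diamondop> X)) = z \<cdot> (K \<star> u' \<cdot> h (S \<diamondop> X))"
    and eq: "u \<cdot> L \<star> munit S X = u' \<cdot> L \<star> munit S X"
  shows "u = u'"
proof -
  note [simp] = z_arr
  \<comment> \<open>The \<open>Sig\<close>-structure on \<open>R \<diamondop> Z\<close>: the
    transpose of one step of \<open>h\<close>, applied to the counit and evaluated by
    \<open>z\<close>.\<close>
  define \<rho> where "\<rho> = R \<star> (z \<cdot> (K \<star> \<epsilon> Z \<cdot> h (R \<diamondop> Z))) \<cdot> \<eta> (Sig \<diamondop> R \<diamondop> Z)"
  have [simp]: "\<rho> \<in> Arr C" "Dom C \<rho> = Sig \<diamondop> R \<diamondop> Z" "Cod C \<rho> = R \<diamondop> Z"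
    by (simp_all add: \<rho>_def)
  obtain r where r: "monad_algebra C S (R \<diamondop> Z) r" "r \<cdot> ins (R \<diamondop> Z) = \<rho>"
    using S_alg_exists[of \<rho> "R \<diamondop> Z"] by (auto simp: in_hom)
  note [simp] = S.alg_arr[OF r(1)]
  \<comment> \<open>The right-hand side involves \<open>u\<close> only through its restriction to
    the unit, so it is the same for \<open>u\<close> and \<open>u'\<close>.\<close>
  have key: "R \<star> u \<cdot> \<eta> (S \<diamondop> X) = r \<cdot> S \<star> (R \<star> (u \<cdot> L \<star> munit S X) \<cdot> \<eta> X)"
    if u [simp]: "u \<in> Arr C" "Dom C u = L \<diamondop> S \<diamondop> X" "Cod C u = Z"
      and rec: "u \<cdot> L \<star> (mmult S X \<cdot> ins (S \<diamondop> X)) = z \<cdot> (K \<star> u \<cdot> h (S \<diamondop> X))" for u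
  proof -
    let ?v = "R \<star> u \<cdot> \<eta> (S \<diamondop> X)" and ?s = "mmult S X \<cdot> ins (S \<diamondop> X)"
    have v: "\<epsilon> Z \<cdot> L \<star> ?v = u"
      by (simp add: L.Cmp \<epsilon>_nat' triangle_L)
    have "?v \<cdot> ?s = R \<star> (u \<cdot> L \<star> ?s) \<cdot> \<eta> (Sig \<diamondop> S \<diamondop> X)"
      using \<eta>_nat[of ?s] by (simp add: R.Cmp)
    also have "u \<cdot> L \<star> ?s = z \<cdot> (K \<star> (\<epsilon> Z \<cdot> L \<star> ?v) \<cdot> h (S \<diamondop> X))"
      unfolding v rec ..
    also have "\<dots> = z \<cdot> (K \<star> \<epsilon> Z \<cdot> (h (R \<diamondop> Z) \<cdot> L \<star> Sig \<star> ?v))"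
      by (subst h_nat) (simp_all add: K.Cmp L.Cmp R.Cmp)
    also have "R \<star> \<dots> \<cdot> \<eta> (Sig \<diamondop> S \<diamondop> X) = \<rho> \<cdot> Sig \<star> ?v"
      using \<eta>_nat[of "Sig \<star> ?v"] by (simp add: \<rho>_def R.Cmp)
    finally have "?v \<cdot> mmult S X = r \<cdot> S \<star> ?v"
      using S_hom[of ?v "S \<diamondop> X" "R \<diamondop> Z" "mmult S X" r] r S.free_alg by (simp add: in_hom)
    then have "(?v \<cdot> mmult S X) \<cdot> S \<star> munit S X = (r \<cdot> S \<star> ?v) \<cdot> S \<star> munit S X" by simp
    then have "?v = r \<cdot> (S \<star> ?v \<cdot> S \<star> munit S X)"
      by (simp add: S.unit_right)
    also have "\<dots> = r \<cdot> S \<star> (R \<star> (u \<cdot> L \<star> munit S X) \<cdot> \<eta> X)"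
      by (simp add: S.Cmp_rev \<eta>_nat R.Cmp)
    finally show ?thesis .
  qed
  have "R \<star> u \<cdot> \<eta> (S \<diamondop> X) = R \<star> u' \<cdot> \<eta> (S \<diamondop> X)"
    using key[OF u rec(1)] key[OF u' rec(2)] eq by simp
  then show ?thesis
    using u u' by (intro transpose_eqI[of u u' "S \<diamondop> X"]) simp_all
qed

end

end

section \<open>The recursion principle of a law\<close>

locale inc_law = lfp C U for C :: "('o, 'a) cat" (structure) and U :: "'u itself" +
  fixes Sig :: "('o, 'a) endo" and S :: "('o, 'a) mnd" and ins :: "'o \<Rightarrow> 'a" and T :: "('o, 'a) mnd"
    and \<delta> :: "'o \<Rightarrow> 'a" and \<Gamma> :: "('o \<times> 'o, 'a \<times> 'a, 'o, 'a) ftor" and d :: "'o \<times> 'o \<Rightarrow> 'a"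
  assumes law: "incremental_structural_law C Sig S ins T \<delta> \<Gamma> d U"
begin

sublocale coprod_category C by (rule coprod_category)

lemma distributive: "distributive_law C S T \<delta>"
  using law by (simp add: incremental_structural_law_def)

sublocale S: monad C S
  using distributive by (intro monadI category_axioms) (simp add: distributive_law_def)

sublocale T: monad C T
  using distributive by (intro monadI category_axioms) (simp add: distributive_law_def)

sublocale dist_law C S T \<delta>
  by unfold_locales (rule distributive)

sublocale M: monad C "composite_monad C S T \<delta>"
  by (intro monadI category_axioms is_monad_composite)

sublocale Sig: functor_on C Sig
  by unfold_locales (use law in \<open>simp add: incremental_structural_law_def finitary_def\<close>)

lemma free_S: "free_monad C Sig S ins"
  using law by (simp add: incremental_structural_law_def)

lemma nat_ins: "nat_trans C C Sig S ins"
  using free_S by (simp add: free_monad_def)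

lemma ins_arr [simp]:
  assumes "X \<in> Ob C"
  shows "ins X \<in> Arr C" "Dom C (ins X) = Sig \<diamondop> X" "Cod C (ins X) = S \<diamondop> X"
  using nat_trans_simps[OF nat_ins assms] by auto

lemma ins_nat: "f \<in> Arr C \<Longrightarrow> Cod C f = Y \<Longrightarrow> ins Y \<cdot> Sig \<star> f = S \<star> f \<cdot> ins (Dom C f)"
  using nat_trans_nat[OF nat_ins] by simp

lemma \<Gamma>_functor: "is_functor (prod_cat C C) C \<Gamma>"
  using law by (simp add: incremental_structural_law_def)

lemma \<Gamma>_arr [simp]:
  assumes "f \<in> Arr C" "g \<in> Arr C"
  shows "\<Gamma> \<star> (f, g) \<in> Arr C" "Dom C (\<Gamma> \<star> (f, g)) = \<Gamma> \<diamondop> (Dom C f, Dom C g)"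
    "Cod C (\<Gamma> \<star> (f, g)) = \<Gamma> \<diamondop> (Cod C f, Cod C g)"
  using functor_simps(3-5)[OF \<Gamma>_functor, of "(f, g)"] assms by (simp_all add: prod_cat_def)

lemma \<Gamma>_Ob [simp]: "X \<in> Ob C \<Longrightarrow> Y \<in> Ob C \<Longrightarrow> \<Gamma> \<diamondop> (X, Y) \<in> Ob C"
  and \<Gamma>_idn [simp]: "X \<in> Ob C \<Longrightarrow> Y \<in> Ob C \<Longrightarrow> \<Gamma> \<star> (idn X, idn Y) = idn (\<Gamma> \<diamondop> (X, Y))"
  using functor_simps(1,2)[OF \<Gamma>_functor, of "(X, Y)"] by (simp_all add: prod_cat_def)

lemma \<Gamma>_Cmp [simp]:
  assumes "f \<in> Arr C" "g \<in> Arr C" "f' \<in> Arr C" "g' \<in> Arr C" "Cod C f = Dom C f'" "Cod C g = Dom C g'"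
  shows "\<Gamma> \<star> (f', g') \<cdot> \<Gamma> \<star> (f, g) = \<Gamma> \<star> (f' \<cdot> f, g' \<cdot> g)"
  using functor_Cmp[OF \<Gamma>_functor, of "(f, g)" "(f', g')"] assms by (simp add: prod_cat_def)

lemmas \<Gamma>_Cmp' [simp] = extend[OF \<Gamma>_Cmp]

lemma ST_eq: "ST C S T \<delta> = M"
  by (simp add: ST_def)

lemma nat_d: "nat_trans (prod_cat C C) C (law_source Sig \<Gamma>) (law_target C S T \<delta> \<Gamma>) d"
  using law by (simp add: incremental_structural_law_def)

lemma d_arr [simp]:
  assumes "X \<in> Ob C" "Y \<in> Ob C"
  shows "d (X, Y) \<in> Arr C" "Dom C (d (X, Y)) = \<Gamma> \<diamondop> (Sig \<diamondop> X, Y)"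
    "Cod C (d (X, Y)) = M \<diamondop> (\<Gamma> \<diamondop> (X, M \<diamondop> Y) \<oplus> X \<oplus> Y)"
  using nat_trans_simps[OF nat_d, of "(X, Y)"] assms
  by (simp_all add: prod_cat_def law_source_def law_target_def ST_eq)

lemma d_nat:
  assumes "f \<in> Arr C" "g \<in> Arr C" "Cod C f = X" "Cod C g = Y"
  shows "d (X, Y) \<cdot> \<Gamma> \<star> (Sig \<star> f, g) = M \<star> (\<Gamma> \<star> (f, M \<star> g) \<boxplus> f \<boxplus> g) \<cdot> d (Dom C f, Dom C g)"
  using nat_trans_nat[OF nat_d, of "(f, g)" "(X, Y)"] assms
  by (simp add: prod_cat_def law_source_def law_target_def ST_eq)

section \<open>The functors \<open>L Y\<close> and the monads \<open>K Y\<close>\<close>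

abbreviation L where "L \<equiv> LL C S T \<delta> \<Gamma>"
abbreviation K where "K \<equiv> KK C S T \<delta>"
abbreviation Ad where "Ad Y \<equiv> adjunction_of C (L Y)"

lemma L_simps: "L Y \<diamondop> X = \<Gamma> \<diamondop> (X, M \<diamondop> Y) \<oplus> X" "L Y \<star> f = \<Gamma> \<star> (f, idn (M \<diamondop> Y)) \<boxplus> f"
  by (simp_all add: LL_def ST_eq)

lemma K_simps: "K Y \<diamondop> A = M \<diamondop> (A \<oplus> Y)" "K Y \<star> f = M \<star> (f \<boxplus> idn Y)"
  "munit (K Y) A = munit M (A \<oplus> Y) \<cdot> inl A Y"
  "mmult (K Y) A = mmult M (A \<oplus> Y) \<cdot> M \<star> \<lbrace>idn (M \<diamondop> (A \<oplus> Y)), munit M (A \<oplus> Y) \<cdot> inr A Y\<rbrace>"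
  by (simp_all add: KK_def ST_eq)

lemma L_functor: "Y \<in> Ob C \<Longrightarrow> is_functor C C (L Y)"
  by (rule functorI[OF category_axioms]) (auto simp: L_simps coprod_arr_idn coprod_arr_Cmp)

text \<open>\<open>L Y\<close> is the sum of a functor that is cocontinuous by assumption and the
  identity; mediating arrows are found on each summand and copaired.\<close>

lemma L_cocontinuous:
  assumes Y [simp]: "Y \<in> Ob C" and J: "small_cat (J :: ('u, 'u) cat)"
  shows "preserves_colimits C C (L Y) J"
  unfolding preserves_colimits_def
proof (intro allI impI)
  fix G A c assume "is_functor J C G \<and> colimit C J G A c"
  then have G: "is_functor J C G" and A: "colimit C J G A c" by auto
  interpret J: category J using J by (simp add: small_cat_def)
  let ?F = "\<lparr>fob = (\<lambda>X. \<Gamma> \<diamondop> (X, M \<diamondop> Y)), far = (\<lambda>f. \<Gamma> \<star> (f, idn (M \<diamondop> Y)))\<rparr>"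
  have "cocontinuous U C C ?F" using law by (simp add: incremental_structural_law_def)
  then have "preserves_colimits C C ?F J" using J by (simp add: cocontinuous_def)
  then have \<Gamma>A: "colimit C J (ftor_comp ?F G) (\<Gamma> \<diamondop> (A, M \<diamondop> Y)) (\<lambda>i. \<Gamma> \<star> (c i, idn (M \<diamondop> Y)))"
    using G A by (simp add: preserves_colimits_def)
  have A_Ob [simp]: "A \<in> Ob C" using A by (simp add: colimit_def cocone_def)
  have c [simp]: "c i \<in> Arr C" "Dom C (c i) = G \<diamondop> i" "Cod C (c i) = A" if "i \<in> Ob J" for i
    using A that by (auto simp: colimit_def cocone_def in_hom)
  note G_simps [simp] = functor_simps[OF G]
  have c_comp: "c (Cod J f) \<cdot> G \<star> f = c (Dom J f)" if "f \<in> Arr J" for f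
    using A that by (simp add: colimit_def cocone_def hom_def)
  show "colimit C J (ftor_comp (L Y) G) (L Y \<diamondop> A) (\<lambda>i. L Y \<star> c i)"
    unfolding colimit_def
  proof (intro conjI allI impI)
    show "cocone C J (ftor_comp (L Y) G) (L Y \<diamondop> A) (\<lambda>i. L Y \<star> c i)"
      by (auto simp: cocone_def in_hom L_simps coprod_arr_Cmp c_comp)
    fix B b assume b: "cocone C J (ftor_comp (L Y) G) B b"
    have b_arr [simp]: "b i \<in> Arr C" "Dom C (b i) = \<Gamma> \<diamondop> (G \<diamondop> i, M \<diamondop> Y) \<oplus> G \<diamondop> i" "Cod C (b i) = B" if "i \<in> Ob J" for i
      using b that by (auto simp: cocone_def in_hom L_simps)
    have b_comp: "b (Cod J f) \<cdot> (\<Gamma> \<star> (G \<star> f, idn (M \<diamondop> Y)) \<boxplus> G \<star> f) = b (Dom J f)" if "f \<in> Arr J" for f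
      using b that by (simp add: cocone_def hom_def L_simps)
    have b_comp': "b (Cod J f) \<cdot> (inl (\<Gamma> \<diamondop> (G \<diamondop> Cod J f, M \<diamondop> Y)) (G \<diamondop> Cod J f) \<cdot> \<Gamma> \<star> (G \<star> f, idn (M \<diamondop> Y)))
          = b (Dom J f) \<cdot> inl (\<Gamma> \<diamondop> (G \<diamondop> Dom J f, M \<diamondop> Y)) (G \<diamondop> Dom J f)"
      "b (Cod J f) \<cdot> (inr (\<Gamma> \<diamondop> (G \<diamondop> Cod J f, M \<diamondop> Y)) (G \<diamondop> Cod J f) \<cdot> G \<star> f)
          = b (Dom J f) \<cdot> inr (\<Gamma> \<diamondop> (G \<diamondop> Dom J f, M \<diamondop> Y)) (G \<diamondop> Dom J f)" if "f \<in> Arr J" for f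
      using that by (simp_all flip: b_comp)
    have B [simp]: "B \<in> Ob C" using b by (simp add: cocone_def)
    have "cocone C J G B (\<lambda>i. b i \<cdot> inr (\<Gamma> \<diamondop> (G \<diamondop> i, M \<diamondop> Y)) (G \<diamondop> i))"
      by (auto simp: cocone_def in_hom b_comp')
    then obtain h2 where h2: "h2 \<in> hom C A B" "\<And>i. i \<in> Ob J \<Longrightarrow> h2 \<cdot> c i = b i \<cdot> inr (\<Gamma> \<diamondop> (G \<diamondop> i, M \<diamondop> Y)) (G \<diamondop> i)"
      and u2: "\<And>k. k \<in> hom C A B \<Longrightarrow> \<forall>i\<in>Ob J. k \<cdot> c i = b i \<cdot> inr (\<Gamma> \<diamondop> (G \<diamondop> i, M \<diamondop> Y)) (G \<diamondop> i) \<Longrightarrow> k = h2"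
      using A unfolding colimit_def by blast
    have "cocone C J (ftor_comp ?F G) B (\<lambda>i. b i \<cdot> inl (\<Gamma> \<diamondop> (G \<diamondop> i, M \<diamondop> Y)) (G \<diamondop> i))"
      by (auto simp: cocone_def in_hom b_comp')
    then obtain h1 where h1: "h1 \<in> hom C (\<Gamma> \<diamondop> (A, M \<diamondop> Y)) B"
        "\<And>i. i \<in> Ob J \<Longrightarrow> h1 \<cdot> \<Gamma> \<star> (c i, idn (M \<diamondop> Y)) = b i \<cdot> inl (\<Gamma> \<diamondop> (G \<diamondop> i, M \<diamondop> Y)) (G \<diamondop> i)"
      and u1: "\<And>k. k \<in> hom C (\<Gamma> \<diamondop> (A, M \<diamondop> Y)) B \<Longrightarrow>
        \<forall>i\<in>Ob J. k \<cdot> \<Gamma> \<star> (c i, idn (M \<diamondop> Y)) = b i \<cdot> inl (\<Gamma> \<diamondop> (G \<diamondop> i, M \<diamondop> Y)) (G \<diamondop> i) \<Longrightarrow> k = h1"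
      using \<Gamma>A unfolding colimit_def by blast
    have h_arr [simp]: "h1 \<in> Arr C" "Dom C h1 = \<Gamma> \<diamondop> (A, M \<diamondop> Y)" "Cod C h1 = B" "h2 \<in> Arr C" "Dom C h2 = A" "Cod C h2 = B"
      using h1(1) h2(1) by (auto simp: in_hom)
    show "\<exists>!h. h \<in> hom C (L Y \<diamondop> A) B \<and> (\<forall>i\<in>Ob J. h \<cdot> L Y \<star> c i = b i)"
    proof (rule ex1I[of _ "\<lbrace>h1, h2\<rbrace>"])
      have "\<lbrace>h1, h2\<rbrace> \<cdot> L Y \<star> c i = b i" if "i \<in> Ob J" for i
        by (rule coprod_eqI[of "\<Gamma> \<diamondop> (G \<diamondop> i, M \<diamondop> Y)" "G \<diamondop> i"]) (use that h1(2) h2(2) in \<open>simp_all add: L_simps\<close>)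
      then show "\<lbrace>h1, h2\<rbrace> \<in> hom C (L Y \<diamondop> A) B \<and> (\<forall>i\<in>Ob J. \<lbrace>h1, h2\<rbrace> \<cdot> L Y \<star> c i = b i)"
        by (simp add: in_hom L_simps)
      fix k assume k: "k \<in> hom C (L Y \<diamondop> A) B \<and> (\<forall>i\<in>Ob J. k \<cdot> L Y \<star> c i = b i)"
      then have [simp]: "k \<in> Arr C" "Dom C k = \<Gamma> \<diamondop> (A, M \<diamondop> Y) \<oplus> A" "Cod C k = B"
        and eq: "\<And>i. i \<in> Ob J \<Longrightarrow> b i = k \<cdot> L Y \<star> c i"
        by (auto simp: in_hom L_simps)
      have "k \<cdot> inl (\<Gamma> \<diamondop> (A, M \<diamondop> Y)) A = h1"
        by (rule u1) (auto simp: in_hom eq, auto simp: L_simps)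
      moreover have "k \<cdot> inr (\<Gamma> \<diamondop> (A, M \<diamondop> Y)) A = h2"
        by (rule u2) (auto simp: in_hom eq, auto simp: L_simps)
      ultimately show "k = \<lbrace>h1, h2\<rbrace>"
        by (intro coprod_eqI[of "\<Gamma> \<diamondop> (A, M \<diamondop> Y)" A k "\<lbrace>h1, h2\<rbrace>"]) simp_all
    qed
  qed
qed

lemma L_adjunction: "Y \<in> Ob C \<Longrightarrow> is_adjunction C (L Y) (Ad Y)"
  unfolding adjunction_of_def
  by (rule someI_ex) (rule right_adjoint_exists[OF L_functor L_cocontinuous])

lemma K_functor:
  assumes [simp]: "Y \<in> Ob C"
  shows "is_functor C C (K Y)"
proof (rule functorI[OF category_axioms])
  fix f g assume "f \<in> Arr C" "g \<in> Arr C" "Cod C f = Dom C g"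
  then show "K Y \<star> (g \<cdot> f) = K Y \<star> g \<cdot> K Y \<star> f"
    by (simp add: K_simps M.Cmp_rev coprod_arr_Cmp)
qed (auto simp: K_simps coprod_arr_idn)

text \<open>A \<open>K\<^sub>Y\<close>-algebra is an \<open>ST\<close>-algebra with a morphism from \<open>Y\<close>.\<close>

lemma K_alg_structure:
  assumes z: "monad_algebra C M Z z" and y [simp]: "y \<in> Arr C" "Cod C y = Z" "Dom C y = Y"
    and u [simp]: "u \<in> Arr C" "Cod C u = Z" "Dom C u = A"
  shows "(z \<cdot> M \<star> \<lbrace>u, y\<rbrace>) \<cdot> munit (K Y) A = u"
    and "(z \<cdot> M \<star> \<lbrace>u, y\<rbrace>) \<cdot> mmult (K Y) A = z \<cdot> M \<star> \<lbrace>z \<cdot> M \<star> \<lbrace>u, y\<rbrace>, y\<rbrace>"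
proof -
  note [simp] = M.alg_arr[OF z]
  have [simp]: "Y \<in> Ob C" "A \<in> Ob C" using Dom_Ob[of y] Dom_Ob[of u] by auto
  note zu = extend[OF M.alg_unit[OF z]]
  have "(z \<cdot> M \<star> \<lbrace>u, y\<rbrace>) \<cdot> munit (K Y) A = z \<cdot> (munit M Z \<cdot> (\<lbrace>u, y\<rbrace> \<cdot> inl A Y))"
    by (subst M.unit_nat') (simp_all add: K_simps)
  then show "(z \<cdot> M \<star> \<lbrace>u, y\<rbrace>) \<cdot> munit (K Y) A = u"
    by (simp add: zu)
  have "(z \<cdot> M \<star> \<lbrace>u, y\<rbrace>) \<cdot> mmult (K Y) A
      = (z \<cdot> mmult M Z) \<cdot> M \<star> (M \<star> \<lbrace>u, y\<rbrace> \<cdot> \<lbrace>idn (M \<diamondop> (A \<oplus> Y)), munit M (A \<oplus> Y) \<cdot> inr A Y\<rbrace>)"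
    using M.mult_nat'[of "\<lbrace>u, y\<rbrace>" Z "M \<star> \<lbrace>idn (M \<diamondop> (A \<oplus> Y)), munit M (A \<oplus> Y) \<cdot> inr A Y\<rbrace>"]
    by (simp add: K_simps M.Cmp del: Cmp_copair Cmp_copair')
  also have "\<dots> = z \<cdot> M \<star> (z \<cdot> (M \<star> \<lbrace>u, y\<rbrace> \<cdot> \<lbrace>idn (M \<diamondop> (A \<oplus> Y)), munit M (A \<oplus> Y) \<cdot> inr A Y\<rbrace>))"
    by (simp add: M.alg_mult[OF z] M.Cmp_rev)
  also have "M \<star> \<lbrace>u, y\<rbrace> \<cdot> \<lbrace>idn (M \<diamondop> (A \<oplus> Y)), munit M (A \<oplus> Y) \<cdot> inr A Y\<rbrace>
      = \<lbrace>M \<star> \<lbrace>u, y\<rbrace>, munit M Z \<cdot> (\<lbrace>u, y\<rbrace> \<cdot> inr A Y)\<rbrace>"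
    by (subst M.unit_nat') simp_all
  finally show "(z \<cdot> M \<star> \<lbrace>u, y\<rbrace>) \<cdot> mmult (K Y) A = z \<cdot> M \<star> \<lbrace>z \<cdot> M \<star> \<lbrace>u, y\<rbrace>, y\<rbrace>"
    by (simp add: zu)
qed

lemma K_ext_Cmp:
  assumes [simp]: "u \<in> Arr C" "Cod C u = Z" "Dom C u = A" "y \<in> Arr C" "Cod C y = Z" "Dom C y = Y" "f \<in> Arr C" "Cod C f = A"
    "z \<in> Arr C" "Dom C z = M \<diamondop> Z"
  shows "z \<cdot> M \<star> \<lbrace>u, y\<rbrace> \<cdot> K Y \<star> f = z \<cdot> M \<star> \<lbrace>u \<cdot> f, y\<rbrace>"
proof -
  have [simp]: "Y \<in> Ob C" using Dom_Ob[of y] by simp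
  show ?thesis by (simp add: K_simps M.Cmp_rev)
qed

text \<open>\<open>mmult (K Y)\<close> is the structure map of a free \<open>ST\<close>-algebra
  after a copairing, so its naturality, one unit law and associativity are instances of
  \<open>K_alg_structure\<close>.\<close>

lemma is_monad_K:
  assumes Y [simp]: "Y \<in> Ob C"
  shows "is_monad C (K Y)"
proof (rule is_monadI[OF category_axioms K_functor[OF Y]])
  have alg: "monad_algebra C M (M \<diamondop> (A \<oplus> Y)) (mmult M (A \<oplus> Y))" if "A \<in> Ob C" for A
    using that by (intro M.free_alg) simp
  \<comment> \<open>Writing the arrow part as an evaluation in the free algebra makes
    \<open>K_alg_structure\<close> applicable to it as well.\<close>
  have K_arr: "K Y \<star> f = mmult M (Cod C f \<oplus> Y) \<cdot> M \<star> \<lbrace>munit (K Y) (Cod C f) \<cdot> f, munit M (Cod C f \<oplus> Y) \<cdot> inr (Cod C f) Y\<rbrace>"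
    if [simp]: "f \<in> Arr C" for f
  proof -
    have "munit M (Cod C f \<oplus> Y) \<cdot> (f \<boxplus> idn Y)
        = \<lbrace>munit (K Y) (Cod C f) \<cdot> f, munit M (Cod C f \<oplus> Y) \<cdot> inr (Cod C f) Y\<rbrace>"
      by (simp add: coprod_arr_def K_simps)
    moreover have "mmult M (Cod C f \<oplus> Y) \<cdot> M \<star> (munit M (Cod C f \<oplus> Y) \<cdot> (f \<boxplus> idn Y)) = M \<star> (f \<boxplus> idn Y)"
      by (simp add: M.Cmp M.unit_right')
    ultimately show ?thesis
      by (simp add: K_simps(2))
  qed
  show "nat_trans C C id_ftor (K Y) (munit (K Y))"
  proof (rule nat_transI)
    fix f assume [simp]: "f \<in> Arr C"
    have "munit M (Cod C f \<oplus> Y) \<cdot> (inl (Cod C f) Y \<cdot> f) = munit M (Cod C f \<oplus> Y) \<cdot> ((f \<boxplus> idn Y) \<cdot> inl (Dom C f) Y)"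
      by simp
    also have "\<dots> = M \<star> (f \<boxplus> idn Y) \<cdot> (munit M (Dom C f \<oplus> Y) \<cdot> inl (Dom C f) Y)"
      by (subst M.unit_nat') simp_all
    finally show "munit (K Y) (Cod C f) \<cdot> id_ftor \<star> f = K Y \<star> f \<cdot> munit (K Y) (Dom C f)"
      by (simp add: K_simps)
  qed (auto simp: K_simps)
  show "nat_trans C C (ftor_comp (K Y) (K Y)) (K Y) (mmult (K Y))"
  proof (rule nat_transI)
    fix f assume [simp]: "f \<in> Arr C"
    let ?B = "Cod C f \<oplus> Y"
    have "K Y \<star> f \<cdot> mmult (K Y) (Dom C f) = mmult M ?B \<cdot> M \<star> \<lbrace>K Y \<star> f, munit M ?B \<cdot> inr (Cod C f) Y\<rbrace>"
      unfolding K_arr[OF \<open>f \<in> Arr C\<close>]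
      by (rule K_alg_structure(2)[OF alg]) (auto simp: K_simps)
    also have "\<dots> = mmult M ?B \<cdot> M \<star> \<lbrace>idn (M \<diamondop> ?B), munit M ?B \<cdot> inr (Cod C f) Y\<rbrace> \<cdot> K Y \<star> K Y \<star> f"
      by (subst K_ext_Cmp[where Z = "M \<diamondop> ?B" and A = "M \<diamondop> ?B"]) (auto simp: K_simps)
    finally show "mmult (K Y) (Cod C f) \<cdot> ftor_comp (K Y) (K Y) \<star> f = K Y \<star> f \<cdot> mmult (K Y) (Dom C f)"
      by (simp add: K_simps(4))
  qed (auto simp: K_simps)
  fix A assume A [simp]: "A \<in> Ob C"
  let ?B = "A \<oplus> Y" and ?y = "munit M (A \<oplus> Y) \<cdot> inr A Y"
  show "mmult (K Y) A \<cdot> munit (K Y) (K Y \<diamondop> A) = idn (K Y \<diamondop> A)"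
    unfolding K_simps(4)[of Y A]
    by (subst K_alg_structure(1)[OF alg[OF A]]) (auto simp: K_simps)
  have "mmult (K Y) A \<cdot> K Y \<star> munit (K Y) A = mmult M ?B \<cdot> M \<star> \<lbrace>munit (K Y) A, ?y\<rbrace>"
    unfolding K_simps(4)[of Y A]
    by (subst K_ext_Cmp[where Z = "M \<diamondop> ?B" and A = "M \<diamondop> ?B"]) (auto simp: K_simps)
  also have "\<dots> = K Y \<star> idn A"
    by (subst K_arr) (auto simp: K_simps)
  finally show "mmult (K Y) A \<cdot> K Y \<star> munit (K Y) A = idn (K Y \<diamondop> A)"
    using functor_simps(2)[OF K_functor[OF Y] A] by simp
  have "mmult (K Y) A \<cdot> K Y \<star> mmult (K Y) A = mmult M ?B \<cdot> M \<star> \<lbrace>mmult (K Y) A, ?y\<rbrace>"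
    unfolding K_simps(4)[of Y A]
    by (subst K_ext_Cmp[where Z = "M \<diamondop> ?B" and A = "M \<diamondop> ?B"]) (auto simp: K_simps)
  also have "\<dots> = mmult (K Y) A \<cdot> mmult (K Y) (K Y \<diamondop> A)"
    unfolding K_simps(4)[of Y A]
    by (subst K_alg_structure(2)[OF alg[OF A]]) (auto simp: K_simps)
  finally show "mmult (K Y) A \<cdot> mmult (K Y) (K Y \<diamondop> A) = mmult (K Y) A \<cdot> K Y \<star> mmult (K Y) A" ..
qed

lemma K_alg:
  assumes z: "monad_algebra C M Z z" and y [simp]: "y \<in> Arr C" "Cod C y = Z" "Dom C y = Y"
  shows "monad_algebra C (K Y) Z (z \<cdot> M \<star> \<lbrace>idn Z, y\<rbrace>)"
proof -
  note [simp] = M.alg_arr[OF z]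
  have [simp]: "Y \<in> Ob C" using Dom_Ob[of y] by auto
  show ?thesis
    unfolding monad_algebra_def
  proof (intro conjI)
    show "(z \<cdot> M \<star> \<lbrace>idn Z, y\<rbrace>) \<cdot> munit (K Y) Z = idn Z"
      by (rule K_alg_structure(1)[OF z y]) auto
    have "(z \<cdot> M \<star> \<lbrace>idn Z, y\<rbrace>) \<cdot> mmult (K Y) Z = z \<cdot> M \<star> \<lbrace>z \<cdot> M \<star> \<lbrace>idn Z, y\<rbrace>, y\<rbrace>"
      by (rule K_alg_structure(2)[OF z y]) auto
    also have "\<dots> = (z \<cdot> M \<star> \<lbrace>idn Z, y\<rbrace>) \<cdot> K Y \<star> (z \<cdot> M \<star> \<lbrace>idn Z, y\<rbrace>)"
      by (subst K_ext_Cmp[where Z = Z and A = Z]) auto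
    finally show "(z \<cdot> M \<star> \<lbrace>idn Z, y\<rbrace>) \<cdot> mmult (K Y) Z = (z \<cdot> M \<star> \<lbrace>idn Z, y\<rbrace>) \<cdot> K Y \<star> (z \<cdot> M \<star> \<lbrace>idn Z, y\<rbrace>)" .
  qed (auto simp: in_hom K_simps)
qed

text \<open>One step of the law evaluated in the \<open>ST\<close>-algebra \<open>z\<close>:
  \<open>k\<close>, \<open>f\<close> and \<open>v\<close> interpret the summands
  \<open>\<Gamma>(X, STW)\<close>, \<open>X\<close> and \<open>W\<close> in the codomain of
  \<open>d\<close>. With \<open>W = X\<close>, identities for \<open>f\<close> and \<open>v\<close>,
  and \<open>c\<close> after \<open>\<Gamma>(id, z)\<close> for \<open>k\<close>, this is the right
  side of (d2).\<close>

definition Ev :: "'a \<Rightarrow> 'a \<Rightarrow> 'a \<Rightarrow> 'a \<Rightarrow> 'o \<Rightarrow> 'o \<Rightarrow> 'a" where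
  "Ev z k f v X W = z \<cdot> (M \<star> \<lbrace>\<lbrace>k, f\<rbrace>, v\<rbrace> \<cdot> d (X, W))"

definition Ev_args :: "'o \<Rightarrow> 'a \<Rightarrow> 'a \<Rightarrow> 'a \<Rightarrow> 'a \<Rightarrow> 'o \<Rightarrow> 'o \<Rightarrow> bool" where
  "Ev_args Z z k f v X W \<longleftrightarrow> z \<in> Arr C \<and> Dom C z = M \<diamondop> Z \<and> Cod C z = Z \<and>
     k \<in> Arr C \<and> Dom C k = \<Gamma> \<diamondop> (X, M \<diamondop> W) \<and> Cod C k = Z \<and> f \<in> Arr C \<and> Dom C f = X \<and> Cod C f = Z \<and>
     v \<in> Arr C \<and> Dom C v = W \<and> Cod C v = Z"

lemma Ev_arr:
  assumes "Ev_args Z z k f v X W"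
  shows "Ev z k f v X W \<in> Arr C" "Dom C (Ev z k f v X W) = \<Gamma> \<diamondop> (Sig \<diamondop> X, W)" "Cod C (Ev z k f v X W) = Z"
  using assms by (auto simp: Ev_def Ev_args_def)

text \<open>Naturality of \<open>d\<close> in both arguments, absorbed by the components of the
  copairing.\<close>

lemma Ev_nat:
  assumes E: "Ev_args Z z k f v X W"
    and [simp]: "s \<in> Arr C" "Cod C s = X" "Dom C s = X'" "t \<in> Arr C" "Cod C t = W" "Dom C t = W'"
  shows "Ev z k f v X W \<cdot> \<Gamma> \<star> (Sig \<star> s, t) = Ev z (k \<cdot> \<Gamma> \<star> (s, M \<star> t)) (f \<cdot> s) (v \<cdot> t) X' W'"
proof -
  have [simp]: "z \<in> Arr C" "Dom C z = M \<diamondop> Z" "Cod C z = Z" "k \<in> Arr C" "Dom C k = \<Gamma> \<diamondop> (X, M \<diamondop> W)" "Cod C k = Z"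
    "f \<in> Arr C" "Dom C f = X" "Cod C f = Z" "v \<in> Arr C" "Dom C v = W" "Cod C v = Z"
    using E by (auto simp: Ev_args_def)
  have [simp]: "X \<in> Ob C" "W \<in> Ob C" "X' \<in> Ob C" "W' \<in> Ob C"
    using Dom_Ob[of f] Dom_Ob[of v] Dom_Ob[of s] Dom_Ob[of t] by auto
  have "Ev z k f v X W \<cdot> \<Gamma> \<star> (Sig \<star> s, t) = z \<cdot> (M \<star> \<lbrace>\<lbrace>k, f\<rbrace>, v\<rbrace> \<cdot> (M \<star> (\<Gamma> \<star> (s, M \<star> t) \<boxplus> s \<boxplus> t) \<cdot> d (X', W')))"
    by (simp add: Ev_def d_nat)
  also have "\<dots> = Ev z (k \<cdot> \<Gamma> \<star> (s, M \<star> t)) (f \<cdot> s) (v \<cdot> t) X' W'"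
    by (simp add: Ev_def M.Cmp_rev M.Cmp_rev')
  finally show ?thesis .
qed

lemma Ev_hom:
  assumes E: "Ev_args Z z k f v X W"
    and [simp]: "q \<in> Arr C" "Dom C q = Z" "Cod C q = Z'" "z' \<in> Arr C" "Dom C z' = M \<diamondop> Z'"
    and hom: "q \<cdot> z = z' \<cdot> M \<star> q"
  shows "q \<cdot> Ev z k f v X W = Ev z' (q \<cdot> k) (q \<cdot> f) (q \<cdot> v) X W"
proof -
  have [simp]: "z \<in> Arr C" "Dom C z = M \<diamondop> Z" "Cod C z = Z" "k \<in> Arr C" "Dom C k = \<Gamma> \<diamondop> (X, M \<diamondop> W)" "Cod C k = Z"
    "f \<in> Arr C" "Dom C f = X" "Cod C f = Z" "v \<in> Arr C" "Dom C v = W" "Cod C v = Z"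
    using E by (auto simp: Ev_args_def)
  have [simp]: "X \<in> Ob C" "W \<in> Ob C"
    using Dom_Ob[of f] Dom_Ob[of v] by auto
  show ?thesis
    by (simp add: Ev_def extend[OF hom] M.Cmp_rev')
qed

text \<open>The inclusion of \<open>S\<close> into the composite monad; restricting an
  \<open>ST\<close>-structure along it gives the underlying \<open>S\<close>-structure.\<close>

definition \<iota> :: "'o \<Rightarrow> 'a" where "\<iota> X = S \<star> munit T X"

lemma \<iota>_arr [simp]:
  assumes "X \<in> Ob C"
  shows "\<iota> X \<in> Arr C" "Dom C (\<iota> X) = S \<diamondop> X" "Cod C (\<iota> X) = M \<diamondop> X"
  using assms by (simp_all add: \<iota>_def composite_simps)

lemma \<iota>_nat:
  assumes [simp]: "f \<in> Arr C" and f: "Cod C f = Y"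
  shows "M \<star> f \<cdot> \<iota> (Dom C f) = \<iota> Y \<cdot> S \<star> f"
  unfolding f[symmetric] by (simp add: \<iota>_def composite_simps S.Cmp_rev T.unit_nat)

lemmas \<iota>_nat' = extend[OF \<iota>_nat]

abbreviation h where "h \<equiv> h_arr C S ins T \<delta> \<Gamma> d"

text \<open>Naturality of the unit and multiplication moves the last map of \<open>h_arr\<close>
  inside. The first component then is a multiplication after a relabelled \<open>d\<close>, which an
  algebra structure composed on the left can collapse.\<close>

lemma h_eq:
  assumes [simp]: "X \<in> Ob C" "Y \<in> Ob C"
  defines "B \<equiv> \<Gamma> \<diamondop> (X, M \<diamondop> Y)"
  shows "h X Y = \<lbrace>mmult M (B \<oplus> X \<oplus> Y) \<cdot> (M \<star> \<lbrace>munit M (B \<oplus> X \<oplus> Y) \<cdot> (inl (B \<oplus> X) Y \<cdot> (\<Gamma> \<star> (idn X, mmult M Y) \<boxplus> idn X)),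
      M \<star> inr (B \<oplus> X) Y\<rbrace> \<cdot> d (X, M \<diamondop> Y)), M \<star> (inl (B \<oplus> X) Y \<cdot> inr B X) \<cdot> (\<iota> X \<cdot> ins X)\<rbrace>"
proof -
  define A where "A = \<Gamma> \<diamondop> (X, M \<diamondop> M \<diamondop> Y) \<oplus> X"
  let ?w = "\<Gamma> \<star> (idn X, mmult M Y) \<boxplus> idn X \<boxplus> idn Y" and ?v = "\<lbrace>munit M (A \<oplus> Y) \<cdot> inl A Y, M \<star> inr A Y\<rbrace>"
  have [simp]: "A \<in> Ob C" "B \<in> Ob C" by (simp_all add: A_def B_def)
  have w [simp]: "?w \<in> Arr C" "Dom C ?w = A \<oplus> Y" "Cod C ?w = B \<oplus> X \<oplus> Y"
    by (simp_all add: A_def B_def)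
  have "M \<star> ?w \<cdot> (mmult M (A \<oplus> Y) \<cdot> M \<star> ?v) = mmult M (B \<oplus> X \<oplus> Y) \<cdot> M \<star> (M \<star> ?w \<cdot> ?v)"
    using M.mult_nat'[of ?w "B \<oplus> X \<oplus> Y" "M \<star> ?v"] w by (simp add: M.Cmp del: Cmp_copair Cmp_copair')
  also have "M \<star> ?w \<cdot> ?v = \<lbrace>munit M (B \<oplus> X \<oplus> Y) \<cdot> (?w \<cdot> inl A Y), M \<star> (?w \<cdot> inr A Y)\<rbrace>"
    using w by (simp add: M.unit_nat' M.Cmp_rev del: coprod_arr_inj coprod_arr_inj')
  also have "?w \<cdot> inl A Y = inl (B \<oplus> X) Y \<cdot> (\<Gamma> \<star> (idn X, mmult M Y) \<boxplus> idn X)"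
    by (simp add: A_def B_def)
  also have "?w \<cdot> inr A Y = inr (B \<oplus> X) Y"
    by (simp add: A_def B_def)
  finally have "M \<star> ?w \<cdot> (mmult M (A \<oplus> Y) \<cdot> (M \<star> ?v \<cdot> d (X, M \<diamondop> Y)))
      = mmult M (B \<oplus> X \<oplus> Y) \<cdot> (M \<star> \<lbrace>munit M (B \<oplus> X \<oplus> Y) \<cdot> (inl (B \<oplus> X) Y \<cdot> (\<Gamma> \<star> (idn X, mmult M Y) \<boxplus> idn X)),
      M \<star> inr (B \<oplus> X) Y\<rbrace> \<cdot> d (X, M \<diamondop> Y))" (is "?l = ?r")
    using extend[of "M \<star> ?w" "mmult M (A \<oplus> Y) \<cdot> M \<star> ?v" _ "d (X, M \<diamondop> Y)"] w
    by (simp add: A_def B_def)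
  moreover have "h X Y = \<lbrace>?l, M \<star> (inl (B \<oplus> X) Y \<cdot> inr B X) \<cdot> (\<iota> X \<cdot> ins X)\<rbrace>"
    using w unfolding h_arr_def Let_def ST_eq \<iota>_def[symmetric] A_def[symmetric] B_def[symmetric]
    by (simp add: A_def B_def)
  ultimately show ?thesis by simp
qed

end

text \<open>Naturality of the unit oriented against \<open>unit_nat'\<close>: the unit moves to the
  left, so that \<open>f\<close> meets the arrow \<open>k\<close>.\<close>

lemma (in monad) unit_nat_rev':
  "f \<in> Arr C \<Longrightarrow> k \<in> Arr C \<Longrightarrow> Cod C k = Dom C f \<Longrightarrow> Dom C f = A \<Longrightarrow>
     M \<star> f \<cdot> (munit M A \<cdot> k) = munit M (Cod C f) \<cdot> (f \<cdot> k)"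
  using unit_nat'[of f "Cod C f" k] by auto

context inc_law
begin

lemma h_arr_simps [simp]:
  assumes "X \<in> Ob C" "Y \<in> Ob C"
  shows "h X Y \<in> Arr C" "Dom C (h X Y) = \<Gamma> \<diamondop> (Sig \<diamondop> X, M \<diamondop> Y) \<oplus> Sig \<diamondop> X"
    "Cod C (h X Y) = M \<diamondop> (\<Gamma> \<diamondop> (X, M \<diamondop> Y) \<oplus> X \<oplus> Y)"
  using assms by (simp_all add: h_eq)

lemma nat_h:
  assumes [simp]: "Y \<in> Ob C"
  shows "nat_trans C C (ftor_comp (L Y) Sig) (ftor_comp (K Y) (L Y)) (\<lambda>X. h X Y)"
proof (rule nat_transI)
  fix f assume [simp]: "f \<in> Arr C"
  let ?X = "Dom C f" and ?X' = "Cod C f"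
  let ?B = "\<Gamma> \<diamondop> (?X, M \<diamondop> Y)" and ?B' = "\<Gamma> \<diamondop> (?X', M \<diamondop> Y)"
  let ?G = "\<Gamma> \<star> (f, idn (M \<diamondop> Y)) \<boxplus> f"
  let ?l = "?G \<boxplus> idn Y"
  have l [simp]: "?l \<in> Arr C" "Dom C ?l = ?B \<oplus> ?X \<oplus> Y" "Cod C ?l = ?B' \<oplus> ?X' \<oplus> Y" by simp_all
  let ?v = "\<lbrace>munit M (?B \<oplus> ?X \<oplus> Y) \<cdot> (inl (?B \<oplus> ?X) Y \<cdot> (\<Gamma> \<star> (idn ?X, mmult M Y) \<boxplus> idn ?X)), M \<star> inr (?B \<oplus> ?X) Y\<rbrace>"
  let ?v' = "\<lbrace>munit M (?B' \<oplus> ?X' \<oplus> Y) \<cdot> (inl (?B' \<oplus> ?X') Y \<cdot> (\<Gamma> \<star> (idn ?X', mmult M Y) \<boxplus> idn ?X')), M \<star> inr (?B' \<oplus> ?X') Y\<rbrace>"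
  let ?t = "inl (?B' \<oplus> ?X') Y \<cdot> (inr ?B' ?X' \<cdot> f)"
  \<comment> \<open>Relabelling by \<open>f\<close> commutes with \<open>?v\<close>. Together with
    naturality of \<open>d\<close> and of the multiplication this settles the
    \<open>\<Gamma>\<close>-summand.\<close>
  have lv: "M \<star> ?l \<cdot> ?v = ?v' \<cdot> (\<Gamma> \<star> (f, idn (M \<diamondop> M \<diamondop> Y)) \<boxplus> f \<boxplus> idn (M \<diamondop> Y))"
  proof -
    have "?l \<cdot> (inl (?B \<oplus> ?X) Y \<cdot> (\<Gamma> \<star> (idn ?X, mmult M Y) \<boxplus> idn ?X))
      = inl (?B' \<oplus> ?X') Y \<cdot> (\<Gamma> \<star> (idn ?X', mmult M Y) \<boxplus> idn ?X') \<cdot> (\<Gamma> \<star> (f, idn (M \<diamondop> M \<diamondop> Y)) \<boxplus> f)"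
      by (simp add: coprod_arr_Cmp)
    moreover have "?l \<cdot> inr (?B \<oplus> ?X) Y = inr (?B' \<oplus> ?X') Y" by simp
    ultimately show ?thesis
      using l by (simp add: M.unit_nat_rev' M.Cmp_rev del: coprod_arr_inj coprod_arr_inj')
  qed
  have "h ?X' Y \<cdot> L Y \<star> Sig \<star> f = \<lbrace>mmult M (?B' \<oplus> ?X' \<oplus> Y) \<cdot> (M \<star> ?v' \<cdot> (d (?X', M \<diamondop> Y) \<cdot> \<Gamma> \<star> (Sig \<star> f, idn (M \<diamondop> Y)))),
      M \<star> (inl (?B' \<oplus> ?X') Y \<cdot> inr ?B' ?X') \<cdot> (\<iota> ?X' \<cdot> (ins ?X' \<cdot> Sig \<star> f))\<rbrace>"
    by (simp add: h_eq L_simps)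
  also have "\<dots> = \<lbrace>mmult M (?B' \<oplus> ?X' \<oplus> Y) \<cdot> (M \<star> (?v' \<cdot> (\<Gamma> \<star> (f, idn (M \<diamondop> M \<diamondop> Y)) \<boxplus> f \<boxplus> idn (M \<diamondop> Y))) \<cdot> d (?X, M \<diamondop> Y)),
      M \<star> ?t \<cdot> (\<iota> ?X \<cdot> ins ?X)\<rbrace>"
  proof -
    have "M \<star> (inl (?B' \<oplus> ?X') Y \<cdot> inr ?B' ?X') \<cdot> (\<iota> ?X' \<cdot> (ins ?X' \<cdot> Sig \<star> f)) = M \<star> ?t \<cdot> (\<iota> ?X \<cdot> ins ?X)"
      using extend[OF \<iota>_nat[of f ?X'], of "ins ?X"] by (simp add: ins_nat M.Cmp)
    then show ?thesis
      by (simp add: d_nat M.Cmp del: copair_coprod_arr copair_coprod_arr')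
  qed
  also have "?v' \<cdot> (\<Gamma> \<star> (f, idn (M \<diamondop> M \<diamondop> Y)) \<boxplus> f \<boxplus> idn (M \<diamondop> Y)) = M \<star> ?l \<cdot> ?v"
    by (rule lv[symmetric])
  also have "?t = ?l \<cdot> (inl (?B \<oplus> ?X) Y \<cdot> inr ?B ?X)"
    by simp
  also have "\<lbrace>mmult M (?B' \<oplus> ?X' \<oplus> Y) \<cdot> (M \<star> (M \<star> ?l \<cdot> ?v) \<cdot> d (?X, M \<diamondop> Y)),
      M \<star> (?l \<cdot> (inl (?B \<oplus> ?X) Y \<cdot> inr ?B ?X)) \<cdot> (\<iota> ?X \<cdot> ins ?X)\<rbrace> = K Y \<star> L Y \<star> f \<cdot> h ?X Y"
  proof -
    have "mmult M (?B' \<oplus> ?X' \<oplus> Y) \<cdot> (M \<star> (M \<star> ?l \<cdot> ?v) \<cdot> d (?X, M \<diamondop> Y))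
        = M \<star> ?l \<cdot> (mmult M (?B \<oplus> ?X \<oplus> Y) \<cdot> (M \<star> ?v \<cdot> d (?X, M \<diamondop> Y)))"
      using l M.mult_nat'[of ?l "?B' \<oplus> ?X' \<oplus> Y" "M \<star> ?v \<cdot> d (?X, M \<diamondop> Y)"]
      by (simp add: M.Cmp del: Cmp_copair Cmp_copair')
    moreover have "M \<star> (?l \<cdot> (inl (?B \<oplus> ?X) Y \<cdot> inr ?B ?X)) \<cdot> (\<iota> ?X \<cdot> ins ?X)
        = M \<star> ?l \<cdot> (M \<star> (inl (?B \<oplus> ?X) Y \<cdot> inr ?B ?X) \<cdot> (\<iota> ?X \<cdot> ins ?X))"
      using l by (simp add: M.Cmp del: coprod_arr_inj coprod_arr_inj')
    ultimately show ?thesis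
      unfolding h_eq[of ?X Y, OF Dom_Ob[OF \<open>f \<in> Arr C\<close>] assms] K_simps L_simps
      using l by (simp del: coprod_arr_inj coprod_arr_inj' coprod_arr_copair)
  qed
  finally show "h ?X' Y \<cdot> ftor_comp (L Y) Sig \<star> f = ftor_comp (K Y) (L Y) \<star> f \<cdot> h ?X Y"
    by simp
qed (simp_all add: L_simps K_simps)

text \<open>Evaluation in a \<open>K Y\<close>-algebra separates the recursion: the
  \<open>\<Gamma>\<close>-summand becomes one step \<open>Ev\<close> with second argument
  \<open>STY\<close>, the other summand becomes the \<open>Sig\<close>-structure underlying
  \<open>z\<close>.\<close>

lemma K_alg_h:
  assumes z: "monad_algebra C M Z z" and [simp]: "X \<in> Ob C" "y \<in> Arr C" "Cod C y = Z" "Dom C y = Y"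
    "g \<in> Arr C" "Cod C g = Z" "Dom C g = \<Gamma> \<diamondop> (X, M \<diamondop> Y)" "f \<in> Arr C" "Cod C f = Z" "Dom C f = X"
  shows "z \<cdot> (M \<star> \<lbrace>\<lbrace>g, f\<rbrace>, y\<rbrace> \<cdot> h X Y)
    = \<lbrace>Ev z (g \<cdot> \<Gamma> \<star> (idn X, mmult M Y)) f (z \<cdot> M \<star> y) X (M \<diamondop> Y), z \<cdot> (\<iota> Z \<cdot> (ins Z \<cdot> Sig \<star> f))\<rbrace>"
proof -
  note [simp] = M.alg_arr[OF z]
  have [simp]: "Y \<in> Ob C" using Dom_Ob[of y] by simp
  let ?u = "\<lbrace>\<lbrace>g, f\<rbrace>, y\<rbrace>" and ?B = "\<Gamma> \<diamondop> (X, M \<diamondop> Y)"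
  let ?v = "\<lbrace>munit M (?B \<oplus> X \<oplus> Y) \<cdot> (inl (?B \<oplus> X) Y \<cdot> (\<Gamma> \<star> (idn X, mmult M Y) \<boxplus> idn X)), M \<star> inr (?B \<oplus> X) Y\<rbrace>"
  have u [simp]: "?u \<in> Arr C" "Dom C ?u = ?B \<oplus> X \<oplus> Y" "Cod C ?u = Z" by simp_all
  have "M \<star> ?u \<cdot> ?v = \<lbrace>munit M Z \<cdot> (?u \<cdot> (inl (?B \<oplus> X) Y \<cdot> (\<Gamma> \<star> (idn X, mmult M Y) \<boxplus> idn X))), M \<star> (?u \<cdot> inr (?B \<oplus> X) Y)\<rbrace>"
    using u by (simp add: M.unit_nat_rev' M.Cmp_rev del: copair_inj copair_inj' Cmp_copair')
  also have "\<dots> = \<lbrace>munit M Z \<cdot> \<lbrace>g \<cdot> \<Gamma> \<star> (idn X, mmult M Y), f\<rbrace>, M \<star> y\<rbrace>"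
    by simp
  finally have uv: "M \<star> ?u \<cdot> ?v = \<lbrace>munit M Z \<cdot> \<lbrace>g \<cdot> \<Gamma> \<star> (idn X, mmult M Y), f\<rbrace>, M \<star> y\<rbrace>" .
  have "z \<cdot> (M \<star> ?u \<cdot> (mmult M (?B \<oplus> X \<oplus> Y) \<cdot> (M \<star> ?v \<cdot> d (X, M \<diamondop> Y))))
      = (z \<cdot> mmult M Z) \<cdot> (M \<star> (M \<star> ?u \<cdot> ?v) \<cdot> d (X, M \<diamondop> Y))"
    using u M.mult_nat'[of ?u Z "M \<star> ?v \<cdot> d (X, M \<diamondop> Y)"] by (simp add: M.Cmp del: Cmp_copair Cmp_copair')
  also have "\<dots> = z \<cdot> (M \<star> (z \<cdot> (M \<star> ?u \<cdot> ?v)) \<cdot> d (X, M \<diamondop> Y))"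
    using u by (simp add: M.alg_mult[OF z] M.Cmp del: Cmp_copair Cmp_copair')
  also have "z \<cdot> (M \<star> ?u \<cdot> ?v) = \<lbrace>\<lbrace>g \<cdot> \<Gamma> \<star> (idn X, mmult M Y), f\<rbrace>, z \<cdot> M \<star> y\<rbrace>"
    unfolding uv using extend[OF M.alg_unit[OF z]] by simp
  finally have 1: "z \<cdot> (M \<star> ?u \<cdot> (mmult M (?B \<oplus> X \<oplus> Y) \<cdot> (M \<star> ?v \<cdot> d (X, M \<diamondop> Y))))
      = Ev z (g \<cdot> \<Gamma> \<star> (idn X, mmult M Y)) f (z \<cdot> M \<star> y) X (M \<diamondop> Y)"
    by (simp add: Ev_def)
  have "M \<star> ?u \<cdot> (M \<star> (inl (?B \<oplus> X) Y \<cdot> inr ?B X) \<cdot> (\<iota> X \<cdot> ins X)) = M \<star> (?u \<cdot> (inl (?B \<oplus> X) Y \<cdot> inr ?B X)) \<cdot> (\<iota> X \<cdot> ins X)"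
    using u by (simp add: M.Cmp del: copair_inj copair_inj')
  also have "\<dots> = \<iota> Z \<cdot> (ins Z \<cdot> Sig \<star> f)"
    using \<iota>_nat'[of f Z "ins X"] by (simp add: ins_nat)
  finally have 2: "z \<cdot> (M \<star> ?u \<cdot> (M \<star> (inl (?B \<oplus> X) Y \<cdot> inr ?B X) \<cdot> (\<iota> X \<cdot> ins X))) = z \<cdot> (\<iota> Z \<cdot> (ins Z \<cdot> Sig \<star> f))"
    by simp
  show ?thesis
    unfolding h_eq[OF \<open>X \<in> Ob C\<close> \<open>Y \<in> Ob C\<close>] 1[symmetric] 2[symmetric]
    using u by (simp del: copair_inj copair_inj')
qed

section \<open>Recursion for maps out of \<open>\<Gamma>(SX, W)\<close>\<close>

lemma adjoint_monad: "Y \<in> Ob C \<Longrightarrow> adjoint_monad C (K Y) (L Y) (Ad Y)"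
  by (intro adjoint_monad.intro adjoint_monad_axioms.intro monadI category_axioms is_monad_K L_adjunction)

lemma RKL_eq:
  assumes "Y \<in> Ob C"
  shows "RKL C S T \<delta> \<Gamma> Y = adjoint_monad.rkl C (K Y) (L Y) (Ad Y)"
  unfolding RKL_def adjoint_monad.rkl_def[OF adjoint_monad[OF assms]] ..

lemma S_alg_exists:
  assumes "\<alpha> \<in> hom C (Sig \<diamondop> X) X"
  shows "\<exists>a. monad_algebra C S X a \<and> a \<cdot> ins X = \<alpha>"
  using free_monad_alg_exists[OF Sig.is_functor free_S assms] by blast

lemma S_hom:
  "\<lbrakk>f \<in> hom C X Y; monad_algebra C S X a; monad_algebra C S Y b; f \<cdot> (a \<cdot> ins X) = (b \<cdot> ins Y) \<cdot> Sig \<star> f\<rbrakk> \<Longrightarrow>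
     f \<cdot> a = b \<cdot> S \<star> f"
  by (rule free_monad_hom[OF Sig.is_functor free_S])

abbreviation hx where "hx \<equiv> h_ext C Sig S ins T \<delta> \<Gamma> d"

text \<open>\<open>h_ext\<close> is a choice; a suitable morphism exists by freeness of
  \<open>S\<close>, applied to the transposes of \<open>h\<close>, which are natural by
  \<open>nat_h\<close>.\<close>

lemma h_ext:
  assumes Y [simp]: "Y \<in> Ob C"
  shows "monad_morphism C S (RKL C S T \<delta> \<Gamma> Y) (hx Y) \<and>
     (\<forall>X \<in> Ob C. hx Y X \<cdot> ins X = radj (Ad Y) \<star> h X Y \<cdot> aunit (Ad Y) (Sig \<diamondop> X))"
proof -
  interpret A: adjoint_monad C "K Y" "L Y" "Ad Y" by (rule adjoint_monad[OF Y])
  let ?t = "\<lambda>X. radj (Ad Y) \<star> h X Y \<cdot> aunit (Ad Y) (Sig \<diamondop> X)"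
  note nat = nat_trans_simps[OF nat_h[OF Y]] nat_trans_nat[OF nat_h[OF Y]]
  note h_arr_simps [simp del]
  have [simp]: "h X Y \<in> Arr C" "Dom C (h X Y) = L Y \<diamondop> Sig \<diamondop> X" "Cod C (h X Y) = K Y \<diamondop> L Y \<diamondop> X" if "X \<in> Ob C" for X
    using that nat by simp_all
  have "nat_trans C C Sig A.rkl ?t"
  proof (rule nat_transI)
    fix f assume [simp]: "f \<in> Arr C"
    have "?t (Cod C f) \<cdot> Sig \<star> f = radj (Ad Y) \<star> (h (Cod C f) Y \<cdot> L Y \<star> Sig \<star> f) \<cdot> aunit (Ad Y) (Sig \<diamondop> Dom C f)"
      by (simp add: A.\<eta>_nat A.R.Cmp)
    also have "\<dots> = A.rkl \<star> f \<cdot> ?t (Dom C f)"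
      using nat(4)[of f] by (simp add: A.rkl_simps A.R.Cmp)
    finally show "?t (Cod C f) \<cdot> Sig \<star> f = A.rkl \<star> f \<cdot> ?t (Dom C f)" .
  qed (simp_all add: A.rkl_simps)
  then have "\<exists>\<phi>. monad_morphism C S (RKL C S T \<delta> \<Gamma> Y) \<phi> \<and> (\<forall>X\<in>Ob C. \<phi> X \<cdot> ins X = ?t X)"
    unfolding RKL_eq[OF Y] using free_S A.is_monad_rkl unfolding free_monad_def by blast
  from someI_ex[OF this] show ?thesis unfolding h_ext_def .
qed

lemma param_recursion:
  assumes Y: "Y \<in> Ob C"
  shows "param_recursion C (K Y) (L Y) (Ad Y) S Sig ins (\<lambda>X. h X Y) (hx Y)"
  by (intro param_recursion.intro adjoint_monad[OF Y] S.monad_axioms Sig.functor_on_axioms param_recursion_axioms.intro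
      nat_ins S_alg_exists S_hom nat_h[OF Y])
    (use h_ext[OF Y] in \<open>auto simp: RKL_eq[OF Y]\<close>)

abbreviation hb where "hb \<equiv> h_bar C Sig S ins T \<delta> \<Gamma> d"

lemma hbar_eq:
  assumes Y: "Y \<in> Ob C"
  shows "param_recursion.hbar C (K Y) (L Y) (Ad Y) (hx Y) X = hb X Y"
  unfolding param_recursion.hbar_def[OF param_recursion[OF Y]] h_bar_def ..

lemma hb_arr [simp]:
  assumes "X \<in> Ob C" "Y \<in> Ob C"
  shows "hb X Y \<in> Arr C" "Dom C (hb X Y) = \<Gamma> \<diamondop> (S \<diamondop> X, M \<diamondop> Y) \<oplus> S \<diamondop> X"
    "Cod C (hb X Y) = M \<diamondop> (\<Gamma> \<diamondop> (X, M \<diamondop> Y) \<oplus> X \<oplus> Y)"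
  using param_recursion.hbar_arr[OF param_recursion[OF assms(2)] assms(1)] unfolding hbar_eq[OF assms(2)]
  by (simp_all add: L_simps K_simps)

text \<open>The free \<open>Sig\<close>-algebra structure on
  \<open>S \<diamondop> X\<close>.\<close>

abbreviation \<sigma> where "\<sigma> X \<equiv> mmult S X \<cdot> ins (S \<diamondop> X)"

lemma M_alg_S_alg: "monad_algebra C M Z z \<Longrightarrow> monad_algebra C S Z (z \<cdot> \<iota> Z)"
  using composite_alg_compat(1)[of Z z] by (simp add: compat_alg_def \<iota>_def)

context
  fixes X Y Z :: 'o and y z :: 'a
  assumes X [simp]: "X \<in> Ob C" and z: "monad_algebra C M Z z"
    and y [simp]: "y \<in> Arr C" "Dom C y = Y" "Cod C y = Z"
begin

text \<open>\<open>param_recursion\<close> produces a map on the sum of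
  \<open>\<Gamma>(SX, STY)\<close> and \<open>SX\<close>. Its part on \<open>SX\<close> is an
  \<open>S\<close>-homomorphism and can be computed, which leaves a recursion for the
  \<open>\<Gamma>\<close>-part alone.\<close>

lemma Gamma_recursion_exists:
  assumes [simp]: "g0 \<in> Arr C" "Dom C g0 = \<Gamma> \<diamondop> (X, M \<diamondop> Y)" "Cod C g0 = Z" "f0 \<in> Arr C" "Dom C f0 = X" "Cod C f0 = Z"
  defines "g \<equiv> z \<cdot> (M \<star> \<lbrace>\<lbrace>g0, f0\<rbrace>, y\<rbrace> \<cdot> (hb X Y \<cdot> inl (\<Gamma> \<diamondop> (S \<diamondop> X, M \<diamondop> Y)) (S \<diamondop> X)))"
  shows "g \<in> Arr C" "Dom C g = \<Gamma> \<diamondop> (S \<diamondop> X, M \<diamondop> Y)" "Cod C g = Z"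
    and "g \<cdot> \<Gamma> \<star> (munit S X, idn (M \<diamondop> Y)) = g0"
    and "g \<cdot> \<Gamma> \<star> (\<sigma> X, idn (M \<diamondop> Y))
       = Ev z (g \<cdot> \<Gamma> \<star> (idn (S \<diamondop> X), mmult M Y)) (z \<cdot> (\<iota> Z \<cdot> S \<star> f0)) (z \<cdot> M \<star> y) (S \<diamondop> X) (M \<diamondop> Y)"
proof -
  note [simp] = M.alg_arr[OF z]
  have Y [simp]: "Y \<in> Ob C" using Dom_Ob[of y] by simp
  interpret param_recursion C "K Y" "L Y" "Ad Y" S Sig ins "\<lambda>X. h X Y" "hx Y" by (rule param_recursion[OF Y])
  note zK = K_alg[OF z y(1,3,2)]
  let ?B = "\<Gamma> \<diamondop> (S \<diamondop> X, M \<diamondop> Y)"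
  let ?u0 = "\<lbrace>g0, f0\<rbrace>" and ?z = "z \<cdot> M \<star> \<lbrace>idn Z, y\<rbrace>"
  define u where "u = ?z \<cdot> (K Y \<star> ?u0 \<cdot> hb X Y)"
  have u_eq: "u = z \<cdot> (M \<star> \<lbrace>\<lbrace>g0, f0\<rbrace>, y\<rbrace> \<cdot> hb X Y)"
    using K_ext_Cmp[of "idn Z" Z Z y Y ?u0 z] extend[of "z \<cdot> M \<star> \<lbrace>idn Z, y\<rbrace>" "K Y \<star> ?u0" _ "hb X Y"]
    by (simp add: u_def K_simps M.Cmp_rev')
  have u_arr [simp]: "u \<in> Arr C" "Dom C u = ?B \<oplus> S \<diamondop> X" "Cod C u = Z"
    by (simp_all add: u_eq)
  have rec: "u \<cdot> L Y \<star> munit S X = ?u0" "u \<cdot> L Y \<star> \<sigma> X = ?z \<cdot> (K Y \<star> u \<cdot> h (S \<diamondop> X) Y)"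
    using recursion_exists[OF X zK, of ?u0] by (simp_all add: hbar_eq u_def[symmetric] L_simps)
  define f where "f = u \<cdot> inr ?B (S \<diamondop> X)"
  have f [simp]: "f \<in> Arr C" "Dom C f = S \<diamondop> X" "Cod C f = Z" by (simp_all add: f_def)
  have g: "g = u \<cdot> inl ?B (S \<diamondop> X)"
    by (simp add: g_def u_eq)
  show g_arr [simp]: "g \<in> Arr C" "Dom C g = \<Gamma> \<diamondop> (S \<diamondop> X, M \<diamondop> Y)" "Cod C g = Z"
    by (simp_all add: g)
  have u_gf: "u = \<lbrace>g, f\<rbrace>"
    by (rule coprod_eqI[of ?B "S \<diamondop> X"]) (simp_all add: g[symmetric] f_def[symmetric])
  have "\<lbrace>g \<cdot> \<Gamma> \<star> (munit S X, idn (M \<diamondop> Y)), f \<cdot> munit S X\<rbrace> = ?u0"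
    using rec(1) by (simp add: u_gf L_simps)
  then have unit: "g \<cdot> \<Gamma> \<star> (munit S X, idn (M \<diamondop> Y)) = g0" "f \<cdot> munit S X = f0"
    by (auto dest: arg_cong[where f = "\<lambda>u. u \<cdot> inl (\<Gamma> \<diamondop> (X, M \<diamondop> Y)) X"] arg_cong[where f = "\<lambda>u. u \<cdot> inr (\<Gamma> \<diamondop> (X, M \<diamondop> Y)) X"])
  have "\<lbrace>g \<cdot> \<Gamma> \<star> (\<sigma> X, idn (M \<diamondop> Y)), f \<cdot> \<sigma> X\<rbrace> = u \<cdot> L Y \<star> \<sigma> X"
    by (simp add: u_gf L_simps)
  also have "\<dots> = z \<cdot> (M \<star> \<lbrace>u, y\<rbrace> \<cdot> h (S \<diamondop> X) Y)"
    using K_ext_Cmp[of "idn Z" Z Z y Y u z] extend[of "z \<cdot> M \<star> \<lbrace>idn Z, y\<rbrace>" "K Y \<star> u" _ "h (S \<diamondop> X) Y"]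
    by (simp add: rec K_simps M.Cmp_rev')
  also have "\<dots> = \<lbrace>Ev z (g \<cdot> \<Gamma> \<star> (idn (S \<diamondop> X), mmult M Y)) f (z \<cdot> M \<star> y) (S \<diamondop> X) (M \<diamondop> Y), z \<cdot> (\<iota> Z \<cdot> (ins Z \<cdot> Sig \<star> f))\<rbrace>"
    unfolding u_gf by (rule K_alg_h[OF z]) simp_all
  finally have step: "\<lbrace>g \<cdot> \<Gamma> \<star> (\<sigma> X, idn (M \<diamondop> Y)), f \<cdot> \<sigma> X\<rbrace>
     = \<lbrace>Ev z (g \<cdot> \<Gamma> \<star> (idn (S \<diamondop> X), mmult M Y)) f (z \<cdot> M \<star> y) (S \<diamondop> X) (M \<diamondop> Y), z \<cdot> (\<iota> Z \<cdot> (ins Z \<cdot> Sig \<star> f))\<rbrace>" .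
  have "Ev_args Z z (g \<cdot> \<Gamma> \<star> (idn (S \<diamondop> X), mmult M Y)) f (z \<cdot> M \<star> y) (S \<diamondop> X) (M \<diamondop> Y)"
    by (simp add: Ev_args_def)
  note [simp] = Ev_arr[OF this]
  have gs: "g \<cdot> \<Gamma> \<star> (\<sigma> X, idn (M \<diamondop> Y)) = Ev z (g \<cdot> \<Gamma> \<star> (idn (S \<diamondop> X), mmult M Y)) f (z \<cdot> M \<star> y) (S \<diamondop> X) (M \<diamondop> Y)"
    using arg_cong[where f = "\<lambda>u. u \<cdot> inl (\<Gamma> \<diamondop> (Sig \<diamondop> S \<diamondop> X, M \<diamondop> Y)) (Sig \<diamondop> S \<diamondop> X)", OF step] by simp
  have fs: "f \<cdot> \<sigma> X = z \<cdot> (\<iota> Z \<cdot> (ins Z \<cdot> Sig \<star> f))"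
    using arg_cong[where f = "\<lambda>u. u \<cdot> inr (\<Gamma> \<diamondop> (Sig \<diamondop> S \<diamondop> X, M \<diamondop> Y)) (Sig \<diamondop> S \<diamondop> X)", OF step] by simp
  \<comment> \<open>The equation on the second summand makes \<open>f\<close> a homomorphism from
    the free \<open>S\<close>-algebra, hence the extension of \<open>f0\<close>.\<close>
  then have "f \<cdot> mmult S X = (z \<cdot> \<iota> Z) \<cdot> S \<star> f"
    by (intro S_hom[of f "S \<diamondop> X" Z] S.free_alg M_alg_S_alg[OF z]) (simp_all add: in_hom)
  then have "(f \<cdot> mmult S X) \<cdot> S \<star> munit S X = ((z \<cdot> \<iota> Z) \<cdot> S \<star> f) \<cdot> S \<star> munit S X" by simp
  then have "f = z \<cdot> (\<iota> Z \<cdot> S \<star> f0)"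
    by (simp add: S.unit_right S.Cmp_rev unit)
  with unit gs show "g \<cdot> \<Gamma> \<star> (munit S X, idn (M \<diamondop> Y)) = g0"
    "g \<cdot> \<Gamma> \<star> (\<sigma> X, idn (M \<diamondop> Y))
       = Ev z (g \<cdot> \<Gamma> \<star> (idn (S \<diamondop> X), mmult M Y)) (z \<cdot> (\<iota> Z \<cdot> S \<star> f0)) (z \<cdot> M \<star> y) (S \<diamondop> X) (M \<diamondop> Y)"
    by simp_all
qed

text \<open>Copairing with the same homomorphism \<open>f\<close> turns both candidates into
  solutions of one recursion on \<open>L Y \<diamondop> S \<diamondop> X\<close>.\<close>

lemma Gamma_recursion_unique_free:
  assumes f [simp]: "f \<in> Arr C" "Dom C f = S \<diamondop> X" "Cod C f = Z" and f_hom: "f \<cdot> mmult S X = (z \<cdot> \<iota> Z) \<cdot> S \<star> f"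
    and g: "g \<in> Arr C" "Dom C g = \<Gamma> \<diamondop> (S \<diamondop> X, M \<diamondop> Y)" "Cod C g = Z"
    and g': "g' \<in> Arr C" "Dom C g' = \<Gamma> \<diamondop> (S \<diamondop> X, M \<diamondop> Y)" "Cod C g' = Z"
    and rec: "g \<cdot> \<Gamma> \<star> (\<sigma> X, idn (M \<diamondop> Y)) = Ev z (g \<cdot> \<Gamma> \<star> (idn (S \<diamondop> X), mmult M Y)) f (z \<cdot> M \<star> y) (S \<diamondop> X) (M \<diamondop> Y)"
      "g' \<cdot> \<Gamma> \<star> (\<sigma> X, idn (M \<diamondop> Y)) = Ev z (g' \<cdot> \<Gamma> \<star> (idn (S \<diamondop> X), mmult M Y)) f (z \<cdot> M \<star> y) (S \<diamondop> X) (M \<diamondop> Y)"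
    and eq: "g \<cdot> \<Gamma> \<star> (munit S X, idn (M \<diamondop> Y)) = g' \<cdot> \<Gamma> \<star> (munit S X, idn (M \<diamondop> Y))"
  shows "g = g'"
proof -
  note [simp] = M.alg_arr[OF z]
  have Y [simp]: "Y \<in> Ob C" using Dom_Ob[of y] by simp
  interpret param_recursion C "K Y" "L Y" "Ad Y" S Sig ins "\<lambda>X. h X Y" "hx Y" by (rule param_recursion[OF Y])
  note zK = K_alg[OF z y(1,3,2)]
  have f_ins: "f \<cdot> \<sigma> X = z \<cdot> (\<iota> Z \<cdot> (ins Z \<cdot> Sig \<star> f))"
    using extend[OF f_hom, of "ins (S \<diamondop> X)"] by (simp add: ins_nat)
  have rec': "\<lbrace>g, f\<rbrace> \<cdot> L Y \<star> \<sigma> X = (z \<cdot> M \<star> \<lbrace>idn Z, y\<rbrace>) \<cdot> (K Y \<star> \<lbrace>g, f\<rbrace> \<cdot> h (S \<diamondop> X) Y)"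
    if [simp]: "g \<in> Arr C" "Dom C g = \<Gamma> \<diamondop> (S \<diamondop> X, M \<diamondop> Y)" "Cod C g = Z"
      and rec: "g \<cdot> \<Gamma> \<star> (\<sigma> X, idn (M \<diamondop> Y)) = Ev z (g \<cdot> \<Gamma> \<star> (idn (S \<diamondop> X), mmult M Y)) f (z \<cdot> M \<star> y) (S \<diamondop> X) (M \<diamondop> Y)"
    for g
  proof -
    have "(z \<cdot> M \<star> \<lbrace>idn Z, y\<rbrace>) \<cdot> (K Y \<star> \<lbrace>g, f\<rbrace> \<cdot> h (S \<diamondop> X) Y) = z \<cdot> (M \<star> \<lbrace>\<lbrace>g, f\<rbrace>, y\<rbrace> \<cdot> h (S \<diamondop> X) Y)"
      using K_ext_Cmp[of "idn Z" Z Z y Y "\<lbrace>g, f\<rbrace>" z] extend[of "z \<cdot> M \<star> \<lbrace>idn Z, y\<rbrace>" "K Y \<star> \<lbrace>g, f\<rbrace>" _ "h (S \<diamondop> X) Y"]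
      by (simp add: K_simps M.Cmp_rev')
    also have "\<dots> = \<lbrace>Ev z (g \<cdot> \<Gamma> \<star> (idn (S \<diamondop> X), mmult M Y)) f (z \<cdot> M \<star> y) (S \<diamondop> X) (M \<diamondop> Y), z \<cdot> (\<iota> Z \<cdot> (ins Z \<cdot> Sig \<star> f))\<rbrace>"
      by (rule K_alg_h[OF z]) simp_all
    also have "\<dots> = \<lbrace>g, f\<rbrace> \<cdot> L Y \<star> \<sigma> X"
      unfolding rec[symmetric] f_ins[symmetric] by (simp add: L_simps)
    finally show ?thesis ..
  qed
  have "\<lbrace>g, f\<rbrace> = \<lbrace>g', f\<rbrace>"
  proof (rule recursion_unique[OF X zK])
    show "\<lbrace>g, f\<rbrace> \<cdot> L Y \<star> munit S X = \<lbrace>g', f\<rbrace> \<cdot> L Y \<star> munit S X"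
      using eq g g' by (simp add: L_simps)
  qed (use g g' rec'[OF g rec(1)] rec'[OF g' rec(2)] in \<open>simp_all add: L_simps\<close>)
  then have "\<lbrace>g, f\<rbrace> \<cdot> inl (\<Gamma> \<diamondop> (S \<diamondop> X, M \<diamondop> Y)) (S \<diamondop> X) = \<lbrace>g', f\<rbrace> \<cdot> inl (\<Gamma> \<diamondop> (S \<diamondop> X, M \<diamondop> Y)) (S \<diamondop> X)"
    by simp
  then show ?thesis using g g' by simp
qed

end

text \<open>Precomposition with \<open>w\<close> in the second argument replaces \<open>W\<close> by
  the free algebra on it: since \<open>v\<close> is a homomorphism, the result solves the recursion
  with parameter \<open>z \<cdot> M \<star> v\<close>. The unit of \<open>ST\<close> splits
  \<open>w\<close> and cancels it at the end.\<close>

lemma Gamma_recursion_unique: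
  assumes X [simp]: "X \<in> Ob C" and z: "monad_algebra C M Z z" and w: "monad_algebra C M W w"
    and v [simp]: "v \<in> Arr C" "Dom C v = W" "Cod C v = Z" and v_hom: "v \<cdot> w = z \<cdot> M \<star> v"
    and f [simp]: "f \<in> Arr C" "Dom C f = S \<diamondop> X" "Cod C f = Z" and f_hom: "f \<cdot> mmult S X = (z \<cdot> \<iota> Z) \<cdot> S \<star> f"
    and k: "k \<in> Arr C" "Dom C k = \<Gamma> \<diamondop> (S \<diamondop> X, W)" "Cod C k = Z"
    and k': "k' \<in> Arr C" "Dom C k' = \<Gamma> \<diamondop> (S \<diamondop> X, W)" "Cod C k' = Z"
    and rec: "k \<cdot> \<Gamma> \<star> (\<sigma> X, idn W) = Ev z (k \<cdot> \<Gamma> \<star> (idn (S \<diamondop> X), w)) f v (S \<diamondop> X) W"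
      "k' \<cdot> \<Gamma> \<star> (\<sigma> X, idn W) = Ev z (k' \<cdot> \<Gamma> \<star> (idn (S \<diamondop> X), w)) f v (S \<diamondop> X) W"
    and eq: "k \<cdot> \<Gamma> \<star> (munit S X, idn W) = k' \<cdot> \<Gamma> \<star> (munit S X, idn W)"
  shows "k = k'"
proof -
  note [simp] = M.alg_arr[OF z] M.alg_arr[OF w]
  let ?w = "\<Gamma> \<star> (idn (S \<diamondop> X), w)"
  have rec': "(k \<cdot> ?w) \<cdot> \<Gamma> \<star> (\<sigma> X, idn (M \<diamondop> W))
      = Ev z ((k \<cdot> ?w) \<cdot> \<Gamma> \<star> (idn (S \<diamondop> X), mmult M W)) f (z \<cdot> M \<star> v) (S \<diamondop> X) (M \<diamondop> W)"
    if [simp]: "k \<in> Arr C" "Dom C k = \<Gamma> \<diamondop> (S \<diamondop> X, W)" "Cod C k = Z"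
      and rec: "k \<cdot> \<Gamma> \<star> (\<sigma> X, idn W) = Ev z (k \<cdot> \<Gamma> \<star> (idn (S \<diamondop> X), w)) f v (S \<diamondop> X) W" for k
  proof -
    have E: "Ev_args Z z (k \<cdot> ?w) f v (S \<diamondop> X) W" by (simp add: Ev_args_def)
    have "(k \<cdot> ?w) \<cdot> \<Gamma> \<star> (\<sigma> X, idn (M \<diamondop> W)) = (k \<cdot> \<Gamma> \<star> (\<sigma> X, idn W)) \<cdot> \<Gamma> \<star> (Sig \<star> idn (S \<diamondop> X), w)"
      by simp
    also have "\<dots> = Ev z (k \<cdot> (?w \<cdot> \<Gamma> \<star> (idn (S \<diamondop> X), M \<star> w))) f (v \<cdot> w) (S \<diamondop> X) (M \<diamondop> W)"
      unfolding rec by (subst Ev_nat[OF E]) simp_all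
    also have "\<dots> = Ev z ((k \<cdot> ?w) \<cdot> \<Gamma> \<star> (idn (S \<diamondop> X), mmult M W)) f (z \<cdot> M \<star> v) (S \<diamondop> X) (M \<diamondop> W)"
      by (simp add: v_hom M.alg_mult[OF w])
    finally show ?thesis .
  qed
  have "k \<cdot> ?w = k' \<cdot> ?w"
  proof (rule Gamma_recursion_unique_free[OF X z v f f_hom])
    have "(k \<cdot> \<Gamma> \<star> (munit S X, idn W)) \<cdot> \<Gamma> \<star> (idn X, w) = (k' \<cdot> \<Gamma> \<star> (munit S X, idn W)) \<cdot> \<Gamma> \<star> (idn X, w)"
      by (simp only: eq)
    then show "(k \<cdot> ?w) \<cdot> \<Gamma> \<star> (munit S X, idn (M \<diamondop> W)) = (k' \<cdot> ?w) \<cdot> \<Gamma> \<star> (munit S X, idn (M \<diamondop> W))"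
      using k k' by simp
  qed (use k k' rec'[OF k rec(1)] rec'[OF k' rec(2)] in simp_all)
  then have "(k \<cdot> ?w) \<cdot> \<Gamma> \<star> (idn (S \<diamondop> X), munit M W) = (k' \<cdot> ?w) \<cdot> \<Gamma> \<star> (idn (S \<diamondop> X), munit M W)" by simp
  then show ?thesis using k k' by (simp add: M.alg_unit[OF w])
qed

end

section \<open>The lifting and its algebras\<close>

lemma (in dist_law) compat_alg_\<iota>:
  assumes ab: "compat_alg X a b"
  shows "(a \<cdot> S \<star> b) \<cdot> S \<star> munit T X = a"
proof -
  note [simp] = compat_algD(4-)[OF ab]
  show ?thesis by (simp add: S.Cmp_rev T.alg_unit[OF compat_algD(2)[OF ab]])
qed

context inc_law
begin

text \<open>Fusing the maps after \<open>d\<close> in (d2) exhibits its right side as a single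
  \<open>Ev\<close>; the codiagonal accounts for the two identities.\<close>

lemma law_algebra_iff:
  "law_algebra C S ins T \<delta> \<Gamma> d X a b c \<longleftrightarrow>
     compat_alg X a b \<and> c \<in> Arr C \<and> Dom C c = \<Gamma> \<diamondop> (X, X) \<and> Cod C c = X \<and>
     c \<cdot> \<Gamma> \<star> (a \<cdot> ins X, idn X) = Ev (a \<cdot> S \<star> b) (c \<cdot> \<Gamma> \<star> (idn X, a \<cdot> S \<star> b)) (idn X) (idn X) X X"
proof -
  have "a \<cdot> S \<star> b \<cdot> M \<star> \<lbrace>c, idn X\<rbrace> \<cdot> M \<star> plus_codiag C (\<Gamma> \<star> (idn X, a \<cdot> S \<star> b)) X \<cdot> d (X, X)
      = Ev (a \<cdot> S \<star> b) (c \<cdot> \<Gamma> \<star> (idn X, a \<cdot> S \<star> b)) (idn X) (idn X) X X"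
    if ab: "compat_alg X a b" and [simp]: "c \<in> Arr C" "Dom C c = \<Gamma> \<diamondop> (X, X)" "Cod C c = X"
  proof -
    note [simp] = compat_algD(4)[OF ab]
    note z = compat_alg_composite[OF ab]
    note [simp] = M.alg_arr(2-)[OF z]
    have "\<lbrace>c, idn X\<rbrace> \<cdot> plus_codiag C (\<Gamma> \<star> (idn X, a \<cdot> S \<star> b)) X = \<lbrace>\<lbrace>c \<cdot> \<Gamma> \<star> (idn X, a \<cdot> S \<star> b), idn X\<rbrace>, idn X\<rbrace>"
      by (simp add: plus_codiag_def)
    then show ?thesis
      by (simp add: Ev_def M.Cmp_rev' plus_codiag_def)
  qed
  note 1 = this
  have 2: "compat_alg X a b \<longleftrightarrow> monad_algebra C S X a \<and> monad_algebra C T X b \<and> b \<cdot> T \<star> a = a \<cdot> S \<star> b \<cdot> \<delta> X"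
  proof (cases "monad_algebra C S X a \<and> monad_algebra C T X b")
    case True
    then show ?thesis using S.alg_arr[of X a] T.alg_arr[of X b] by (simp add: compat_alg_def)
  qed (auto simp: compat_alg_def)
  show ?thesis
  proof (cases "compat_alg X a b \<and> c \<in> Arr C \<and> Dom C c = \<Gamma> \<diamondop> (X, X) \<and> Cod C c = X")
    case True
    then show ?thesis using 1 2 by (simp only: law_algebra_def ST_eq in_hom simp_thms)
  next
    case False
    then show ?thesis using 2 by (simp only: law_algebra_def in_hom) blast
  qed
qed

lemma law_algebraD:
  assumes "law_algebra C S ins T \<delta> \<Gamma> d X a b c"
  shows "compat_alg X a b" "c \<in> Arr C" "Dom C c = \<Gamma> \<diamondop> (X, X)" "Cod C c = X"
    "c \<cdot> \<Gamma> \<star> (a \<cdot> ins X, idn X) = Ev (a \<cdot> S \<star> b) (c \<cdot> \<Gamma> \<star> (idn X, a \<cdot> S \<star> b)) (idn X) (idn X) X X"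
  using assms by (simp_all add: law_algebra_iff)

abbreviation lT where "lT \<equiv> lift_T C S \<delta>"
abbreviation lG where "lG \<equiv> lift_Gamma C Sig S ins T \<delta> \<Gamma> d"

lemma lT_eq: "lT X b = S \<star> b \<cdot> \<delta> X"
  by (simp add: lift_T_def)

text \<open>The composite \<open>ST\<close>-structure on \<open>S \<diamondop> X\<close> that comes
  from \<open>lift_compat_alg\<close>.\<close>

definition zS :: "'o \<Rightarrow> 'a \<Rightarrow> 'a" where
  "zS X b = mmult S X \<cdot> S \<star> lT X b"

text \<open>The recursion is solved here with second argument \<open>STX\<close>, the free kind that
  the universal property offers. The base value evaluates \<open>STX\<close> to \<open>SX\<close> by
  \<open>S \<star> b\<close>, then applies \<open>c\<close> and the unit.\<close>

definition lrec :: "'o \<Rightarrow> 'a \<Rightarrow> 'a \<Rightarrow> 'a" where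
  "lrec X b c = zS X b \<cdot> (M \<star> \<lbrace>\<lbrace>munit S X \<cdot> (c \<cdot> \<Gamma> \<star> (idn X, S \<star> b)), munit S X\<rbrace>, munit S X\<rbrace>
     \<cdot> (hb X X \<cdot> inl (\<Gamma> \<diamondop> (S \<diamondop> X, M \<diamondop> X)) (S \<diamondop> X)))"

text \<open>\<open>\<iota> X\<close> is a section of \<open>S \<star> b\<close>. That this
  restriction loses nothing, because \<open>lrec\<close> factors through \<open>S \<star> b\<close>,
  is shown in \<open>lrec_lfree\<close>.\<close>

definition lfree :: "'o \<Rightarrow> 'a \<Rightarrow> 'a \<Rightarrow> 'a" where
  "lfree X b c = lrec X b c \<cdot> \<Gamma> \<star> (idn (S \<diamondop> X), \<iota> X)"

context
  fixes X :: 'o and b c :: 'a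
  assumes b: "monad_algebra C T X b"
    and c [simp]: "c \<in> Arr C" "Dom C c = \<Gamma> \<diamondop> (X, S \<diamondop> X)" "Cod C c = X"
begin

lemma compat_SX: "compat_alg (S \<diamondop> X) (mmult S X) (lT X b)"
  unfolding lT_eq by (rule lift_compat_alg[OF b])

lemma zS_alg: "monad_algebra C M (S \<diamondop> X) (zS X b)"
  unfolding zS_def by (rule compat_alg_composite[OF compat_SX])

lemmas b_arr [simp] = T.alg_arr[OF b]
lemmas zS_arr [simp] = M.alg_arr(2-4)[OF zS_alg]

lemma Sb_arr [simp]: "Dom C (S \<star> b) = M \<diamondop> X"
  by (simp add: composite_simps)

lemma zS_\<iota>: "zS X b \<cdot> \<iota> (S \<diamondop> X) = mmult S X"
  unfolding zS_def \<iota>_def by (rule compat_alg_\<iota>[OF compat_SX])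

lemma zS_unit: "zS X b \<cdot> M \<star> munit S X = S \<star> b"
proof -
  have "zS X b \<cdot> M \<star> munit S X = mmult S X \<cdot> S \<star> (S \<star> b \<cdot> (\<delta> X \<cdot> T \<star> munit S X))"
    by (simp add: zS_def lT_eq composite_simps S.Cmp)
  also have "\<dots> = mmult S X \<cdot> (S \<star> munit S X \<cdot> S \<star> b)"
    by (simp add: \<delta>_unit_S S.unit_nat S.Cmp_rev)
  finally show ?thesis by (simp add: S.unit_right' composite_simps)
qed

lemma Sb_\<iota>: "S \<star> b \<cdot> \<iota> X = idn (S \<diamondop> X)"
  by (simp add: \<iota>_def S.Cmp_rev T.alg_unit[OF b])

text \<open>\<open>b\<close> is a homomorphism from the free \<open>T\<close>-algebra on
  \<open>X\<close>, and lifting to carriers under \<open>S\<close> acts on homomorphisms.\<close>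

lemma Sb_hom: "S \<star> b \<cdot> mmult M X = zS X b \<cdot> M \<star> S \<star> b"
proof -
  have "S \<star> b \<cdot> mmult M X = mmult S X \<cdot> S \<star> (S \<star> (b \<cdot> mmult T X) \<cdot> \<delta> (T \<diamondop> X))"
    by (simp add: mult_ST S.Cmp S.mult_nat' composite_simps(1))
  also have "\<dots> = mmult S X \<cdot> S \<star> (S \<star> b \<cdot> (\<delta> X \<cdot> T \<star> S \<star> b))"
    by (simp add: T.alg_mult[OF b] \<delta>_nat S.Cmp composite_simps(1))
  also have "\<dots> = zS X b \<cdot> M \<star> S \<star> b"
    by (simp add: zS_def lT_eq composite_simps S.Cmp)
  finally show ?thesis .
qed

lemma lrec:
  shows lrec_arr [simp]: "lrec X b c \<in> Arr C" "Dom C (lrec X b c) = \<Gamma> \<diamondop> (S \<diamondop> X, M \<diamondop> X)" "Cod C (lrec X b c) = S \<diamondop> X"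
    and lrec_unit: "lrec X b c \<cdot> \<Gamma> \<star> (munit S X, idn (M \<diamondop> X)) = munit S X \<cdot> (c \<cdot> \<Gamma> \<star> (idn X, S \<star> b))"
    and lrec_step: "lrec X b c \<cdot> \<Gamma> \<star> (\<sigma> X, idn (M \<diamondop> X))
       = Ev (zS X b) (lrec X b c \<cdot> \<Gamma> \<star> (idn (S \<diamondop> X), mmult M X)) (idn (S \<diamondop> X)) (S \<star> b) (S \<diamondop> X) (M \<diamondop> X)"
proof -
  note * = Gamma_recursion_exists[OF b_arr(1) zS_alg, of "munit S X" X
      "munit S X \<cdot> (c \<cdot> \<Gamma> \<star> (idn X, S \<star> b))" "munit S X", folded lrec_def]
  \<comment> \<open>The \<open>S\<close>-part of the recursion extends the unit and is therefore the
    identity; this gives the third argument of \<open>Ev\<close> in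
    \<open>lrec_step\<close>.\<close>
  have 1: "zS X b \<cdot> (\<iota> (S \<diamondop> X) \<cdot> S \<star> munit S X) = idn (S \<diamondop> X)"
    using extend[OF zS_\<iota>, of "S \<star> munit S X"] by (simp add: S.unit_right)
  show "lrec X b c \<in> Arr C" "Dom C (lrec X b c) = \<Gamma> \<diamondop> (S \<diamondop> X, M \<diamondop> X)" "Cod C (lrec X b c) = S \<diamondop> X"
    "lrec X b c \<cdot> \<Gamma> \<star> (munit S X, idn (M \<diamondop> X)) = munit S X \<cdot> (c \<cdot> \<Gamma> \<star> (idn X, S \<star> b))"
    "lrec X b c \<cdot> \<Gamma> \<star> (\<sigma> X, idn (M \<diamondop> X))
       = Ev (zS X b) (lrec X b c \<cdot> \<Gamma> \<star> (idn (S \<diamondop> X), mmult M X)) (idn (S \<diamondop> X)) (S \<star> b) (S \<diamondop> X) (M \<diamondop> X)"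
    using * by (simp_all add: 1 zS_unit)
qed

lemma lrec_args:
  "Ev_args (S \<diamondop> X) (zS X b) (lrec X b c \<cdot> \<Gamma> \<star> (idn (S \<diamondop> X), mmult M X)) (idn (S \<diamondop> X)) (S \<star> b) (S \<diamondop> X) (M \<diamondop> X)"
  by (simp add: Ev_args_def)

text \<open>For a homomorphism \<open>m\<close> from a free algebra into \<open>STX\<close>, base
  value and step of the recursion depend on \<open>m\<close> only through
  \<open>S \<star> b \<cdot> m\<close>, so uniqueness with parameter object \<open>Y\<close>
  identifies the two sides.\<close>

lemma lrec_hom_cong:
  assumes Y [simp]: "Y \<in> Ob C"
    and m: "m \<in> Arr C" "Dom C m = M \<diamondop> Y" "Cod C m = M \<diamondop> X" "m \<cdot> mmult M Y = mmult M X \<cdot> M \<star> m"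
    and m': "m' \<in> Arr C" "Dom C m' = M \<diamondop> Y" "Cod C m' = M \<diamondop> X" "m' \<cdot> mmult M Y = mmult M X \<cdot> M \<star> m'"
    and eq: "S \<star> b \<cdot> m = S \<star> b \<cdot> m'"
  shows "lrec X b c \<cdot> \<Gamma> \<star> (idn (S \<diamondop> X), m) = lrec X b c \<cdot> \<Gamma> \<star> (idn (S \<diamondop> X), m')"
proof -
  let ?g = "lrec X b c" and ?y = "S \<star> b \<cdot> m \<cdot> munit M Y"
  \<comment> \<open>A homomorphism out of the free algebra on \<open>Y\<close> is recovered from its
    restriction along the unit; \<open>?y\<close> is the parameter for the uniqueness lemma.\<close>
  have y: "zS X b \<cdot> M \<star> ?y = S \<star> b \<cdot> m"
  proof -
    note [simp] = m(1-3)
    have "zS X b \<cdot> M \<star> ?y = S \<star> b \<cdot> (mmult M X \<cdot> M \<star> m) \<cdot> M \<star> munit M Y"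
      using extend[OF Sb_hom, of "M \<star> m \<cdot> M \<star> munit M Y"] by (simp add: M.Cmp)
    also have "\<dots> = S \<star> b \<cdot> m"
      unfolding m(4)[symmetric] by (simp add: M.unit_right)
    finally show ?thesis .
  qed
  have rec: "(?g \<cdot> \<Gamma> \<star> (idn (S \<diamondop> X), m)) \<cdot> \<Gamma> \<star> (munit S X, idn (M \<diamondop> Y)) = munit S X \<cdot> (c \<cdot> \<Gamma> \<star> (idn X, S \<star> b \<cdot> m))"
    "(?g \<cdot> \<Gamma> \<star> (idn (S \<diamondop> X), m)) \<cdot> \<Gamma> \<star> (\<sigma> X, idn (M \<diamondop> Y))
       = Ev (zS X b) ((?g \<cdot> \<Gamma> \<star> (idn (S \<diamondop> X), m)) \<cdot> \<Gamma> \<star> (idn (S \<diamondop> X), mmult M Y)) (idn (S \<diamondop> X)) (S \<star> b \<cdot> m) (S \<diamondop> X) (M \<diamondop> Y)"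
    if [simp]: "m \<in> Arr C" "Dom C m = M \<diamondop> Y" "Cod C m = M \<diamondop> X" and hom: "m \<cdot> mmult M Y = mmult M X \<cdot> M \<star> m" for m
  proof -
    have "(?g \<cdot> \<Gamma> \<star> (idn (S \<diamondop> X), m)) \<cdot> \<Gamma> \<star> (munit S X, idn (M \<diamondop> Y)) = (?g \<cdot> \<Gamma> \<star> (munit S X, idn (M \<diamondop> X))) \<cdot> \<Gamma> \<star> (idn X, m)"
      by simp
    then show "(?g \<cdot> \<Gamma> \<star> (idn (S \<diamondop> X), m)) \<cdot> \<Gamma> \<star> (munit S X, idn (M \<diamondop> Y)) = munit S X \<cdot> (c \<cdot> \<Gamma> \<star> (idn X, S \<star> b \<cdot> m))"
      unfolding lrec_unit by simp
    have "(?g \<cdot> \<Gamma> \<star> (idn (S \<diamondop> X), m)) \<cdot> \<Gamma> \<star> (\<sigma> X, idn (M \<diamondop> Y))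
        = (?g \<cdot> \<Gamma> \<star> (\<sigma> X, idn (M \<diamondop> X))) \<cdot> \<Gamma> \<star> (Sig \<star> idn (S \<diamondop> X), m)"
      by simp
    also have "\<dots> = Ev (zS X b) (?g \<cdot> \<Gamma> \<star> (idn (S \<diamondop> X), mmult M X \<cdot> M \<star> m)) (idn (S \<diamondop> X)) (S \<star> b \<cdot> m) (S \<diamondop> X) (M \<diamondop> Y)"
      unfolding lrec_step by (subst Ev_nat[OF lrec_args]) simp_all
    finally show "(?g \<cdot> \<Gamma> \<star> (idn (S \<diamondop> X), m)) \<cdot> \<Gamma> \<star> (\<sigma> X, idn (M \<diamondop> Y))
       = Ev (zS X b) ((?g \<cdot> \<Gamma> \<star> (idn (S \<diamondop> X), m)) \<cdot> \<Gamma> \<star> (idn (S \<diamondop> X), mmult M Y)) (idn (S \<diamondop> X)) (S \<star> b \<cdot> m) (S \<diamondop> X) (M \<diamondop> Y)"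
      unfolding hom[symmetric] by simp
  qed
  show ?thesis
  proof (rule Gamma_recursion_unique_free[OF b_arr(1) zS_alg, of ?y Y "idn (S \<diamondop> X)"])
    show "idn (S \<diamondop> X) \<cdot> mmult S X = (zS X b \<cdot> \<iota> (S \<diamondop> X)) \<cdot> S \<star> idn (S \<diamondop> X)"
      unfolding zS_\<iota> by simp
    show "(?g \<cdot> \<Gamma> \<star> (idn (S \<diamondop> X), m)) \<cdot> \<Gamma> \<star> (munit S X, idn (M \<diamondop> Y)) = (?g \<cdot> \<Gamma> \<star> (idn (S \<diamondop> X), m')) \<cdot> \<Gamma> \<star> (munit S X, idn (M \<diamondop> Y))"
      unfolding rec(1)[OF m] rec(1)[OF m'] eq ..
    show "(?g \<cdot> \<Gamma> \<star> (idn (S \<diamondop> X), m)) \<cdot> \<Gamma> \<star> (\<sigma> X, idn (M \<diamondop> Y))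
       = Ev (zS X b) ((?g \<cdot> \<Gamma> \<star> (idn (S \<diamondop> X), m)) \<cdot> \<Gamma> \<star> (idn (S \<diamondop> X), mmult M Y)) (idn (S \<diamondop> X)) (zS X b \<cdot> M \<star> ?y) (S \<diamondop> X) (M \<diamondop> Y)"
      unfolding y by (rule rec(2)[OF m])
    show "(?g \<cdot> \<Gamma> \<star> (idn (S \<diamondop> X), m')) \<cdot> \<Gamma> \<star> (\<sigma> X, idn (M \<diamondop> Y))
       = Ev (zS X b) ((?g \<cdot> \<Gamma> \<star> (idn (S \<diamondop> X), m')) \<cdot> \<Gamma> \<star> (idn (S \<diamondop> X), mmult M Y)) (idn (S \<diamondop> X)) (zS X b \<cdot> M \<star> ?y) (S \<diamondop> X) (M \<diamondop> Y)"
      unfolding y by (rule rec(2)[OF m', folded eq])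
  qed (use m(1-3) m'(1-3) in simp_all)
qed

text \<open>
  With \<open>q = \<eta> \<cdot> b\<close>, both \<open>\<mu>\<close> and \<open>\<mu> \<cdot> M q\<close> are \<open>ST\<close>-homomorphisms \<open>M M X \<rightarrow> M X\<close> with the same composite
  with \<open>S b\<close>. Restricting along the unit shows that \<open>lrec\<close> is invariant under \<open>q\<close>, so it factors through
  the split epimorphism \<open>S b\<close>, which is not split by an \<open>ST\<close>-homomorphism.
\<close>

lemma lrec_lfree: "lrec X b c = lfree X b c \<cdot> \<Gamma> \<star> (idn (S \<diamondop> X), S \<star> b)"
proof -
  let ?g = "lrec X b c" and ?q = "\<iota> X \<cdot> S \<star> b"
  have "?g \<cdot> \<Gamma> \<star> (idn (S \<diamondop> X), mmult M X) = ?g \<cdot> \<Gamma> \<star> (idn (S \<diamondop> X), mmult M X \<cdot> M \<star> ?q)"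
  proof (rule lrec_hom_cong[of "M \<diamondop> X"])
    show "(mmult M X \<cdot> M \<star> ?q) \<cdot> mmult M (M \<diamondop> X) = mmult M X \<cdot> M \<star> (mmult M X \<cdot> M \<star> ?q)"
      using M.mult_nat[of ?q "M \<diamondop> X"] M.mult_assoc'[of X "M \<star> M \<star> ?q"] by (simp add: M.Cmp)
    have "S \<star> b \<cdot> (mmult M X \<cdot> M \<star> ?q) = zS X b \<cdot> M \<star> (S \<star> b \<cdot> ?q)"
      using extend[OF Sb_hom, of "M \<star> ?q"] by (simp add: M.Cmp)
    also have "S \<star> b \<cdot> ?q = S \<star> b"
      using extend[OF Sb_\<iota>, of "S \<star> b"] by simp
    finally show "S \<star> b \<cdot> mmult M X = S \<star> b \<cdot> (mmult M X \<cdot> M \<star> ?q)"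
      by (simp add: Sb_hom)
  qed (simp_all add: M.mult_assoc)
  then have "(?g \<cdot> \<Gamma> \<star> (idn (S \<diamondop> X), mmult M X)) \<cdot> \<Gamma> \<star> (idn (S \<diamondop> X), munit M (M \<diamondop> X))
      = (?g \<cdot> \<Gamma> \<star> (idn (S \<diamondop> X), mmult M X \<cdot> M \<star> ?q)) \<cdot> \<Gamma> \<star> (idn (S \<diamondop> X), munit M (M \<diamondop> X))" by simp
  moreover have "mmult M X \<cdot> (M \<star> ?q \<cdot> munit M (M \<diamondop> X)) = ?q"
    using M.unit_nat[of ?q "M \<diamondop> X"] M.unit_left'[of X ?q] by simp
  ultimately show ?thesis
    by (simp add: M.unit_left lfree_def)
qed

lemma lfree_arr [simp]: "lfree X b c \<in> Arr C" "Dom C (lfree X b c) = \<Gamma> \<diamondop> (S \<diamondop> X, S \<diamondop> X)" "Cod C (lfree X b c) = S \<diamondop> X"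
  by (simp_all add: lfree_def)

lemma lfree_unit: "lfree X b c \<cdot> \<Gamma> \<star> (munit S X, idn (S \<diamondop> X)) = munit S X \<cdot> c"
proof -
  have "lfree X b c \<cdot> \<Gamma> \<star> (munit S X, idn (S \<diamondop> X)) = (lrec X b c \<cdot> \<Gamma> \<star> (munit S X, idn (M \<diamondop> X))) \<cdot> \<Gamma> \<star> (idn X, \<iota> X)"
    by (simp add: lfree_def)
  also have "\<dots> = munit S X \<cdot> c"
    unfolding lrec_unit by (simp add: Sb_\<iota>)
  finally show ?thesis .
qed

text \<open>\<open>lrec_lfree\<close> allows \<open>lrec\<close> to be replaced by
  \<open>lfree\<close> under \<open>Ev\<close>, and the evaluation of the second argument becomes
  \<open>zS X b\<close> because \<open>S \<star> b\<close> is a homomorphism split by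
  \<open>\<iota> X\<close>.\<close>

lemma lfree_step:
  "lfree X b c \<cdot> \<Gamma> \<star> (\<sigma> X, idn (S \<diamondop> X))
   = Ev (zS X b) (lfree X b c \<cdot> \<Gamma> \<star> (idn (S \<diamondop> X), zS X b)) (idn (S \<diamondop> X)) (idn (S \<diamondop> X)) (S \<diamondop> X) (S \<diamondop> X)"
proof -
  have "lfree X b c \<cdot> \<Gamma> \<star> (\<sigma> X, idn (S \<diamondop> X)) = (lrec X b c \<cdot> \<Gamma> \<star> (\<sigma> X, idn (M \<diamondop> X))) \<cdot> \<Gamma> \<star> (Sig \<star> idn (S \<diamondop> X), \<iota> X)"
    by (simp add: lfree_def)
  also have "\<dots> = Ev (zS X b) (lrec X b c \<cdot> \<Gamma> \<star> (idn (S \<diamondop> X), mmult M X \<cdot> M \<star> \<iota> X)) (idn (S \<diamondop> X)) (idn (S \<diamondop> X)) (S \<diamondop> X) (S \<diamondop> X)"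
    unfolding lrec_step by (subst Ev_nat[OF lrec_args]) (simp_all add: Sb_\<iota>)
  also have "lrec X b c \<cdot> \<Gamma> \<star> (idn (S \<diamondop> X), mmult M X \<cdot> M \<star> \<iota> X)
      = lfree X b c \<cdot> \<Gamma> \<star> (idn (S \<diamondop> X), (S \<star> b \<cdot> mmult M X) \<cdot> M \<star> \<iota> X)"
    by (subst lrec_lfree) simp
  also have "(S \<star> b \<cdot> mmult M X) \<cdot> M \<star> \<iota> X = zS X b"
    unfolding Sb_hom by (simp add: M.Cmp_rev Sb_\<iota>)
  finally show ?thesis .
qed

text \<open>\<open>lfree_step\<close> is (d2) in the form of \<open>law_algebra_iff\<close>.\<close>

lemma law_algebra_free: "law_algebra C S ins T \<delta> \<Gamma> d (S \<diamondop> X) (mmult S X) (lT X b) (lfree X b c)"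
  using lfree_step by (simp add: law_algebra_iff compat_SX flip: zS_def)

text \<open>\<open>lift_Gamma\<close> evaluates the result of \<open>d_hat\<close> by
  \<open>S \<star> b\<close>, whereas \<open>lrec\<close> first embeds into
  \<open>S \<diamondop> X\<close> and evaluates by \<open>zS\<close>. They agree because
  \<open>zS X b\<close> restricted along the unit of \<open>S\<close> is
  \<open>S \<star> b\<close>.\<close>

lemma lG_eq: "lG X b c = lfree X b c \<cdot> \<Gamma> \<star> (idn (S \<diamondop> X), mmult S X)"
proof -
  let ?c = "plus_codiag C (\<Gamma> \<star> (idn X, S \<star> b)) X" and ?w = "\<lbrace>\<lbrace>c \<cdot> \<Gamma> \<star> (idn X, S \<star> b), idn X\<rbrace>, idn X\<rbrace>"
  let ?r = "hb X X \<cdot> inl (\<Gamma> \<diamondop> (S \<diamondop> X, M \<diamondop> X)) (S \<diamondop> X)"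
  have c_arr: "?c \<in> Arr C" "Dom C ?c = \<Gamma> \<diamondop> (X, M \<diamondop> X) \<oplus> X \<oplus> X" "Cod C ?c = \<Gamma> \<diamondop> (X, S \<diamondop> X) \<oplus> X"
    by (simp_all add: plus_codiag_def)
  have "\<lbrace>c, idn X\<rbrace> \<cdot> ?c = ?w"
    by (simp add: plus_codiag_def)
  moreover have "S \<star> b \<cdot> M \<star> ?w = zS X b \<cdot> M \<star> (munit S X \<cdot> ?w)"
    using extend[OF zS_unit, of "M \<star> ?w"] by (simp add: M.Cmp del: Cmp_copair Cmp_copair')
  ultimately have "S \<star> b \<cdot> (M \<star> \<lbrace>c, idn X\<rbrace> \<cdot> (M \<star> ?c \<cdot> ?r)) = lrec X b c"
    using c_arr extend[of "S \<star> b" "M \<star> ?w" "zS X b \<cdot> M \<star> (munit S X \<cdot> ?w)" ?r] 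
    by (simp add: M.Cmp_rev' lrec_def)
  then show ?thesis
    using c_arr extend[of "S \<star> b" "M \<star> \<lbrace>c, idn X\<rbrace> \<cdot> (M \<star> ?c \<cdot> ?r)" "lrec X b c"]
    unfolding lift_Gamma_def ST_eq d_hat_def \<iota>_def[symmetric] lfree_def by simp
qed

text \<open>By this universal property \<open>S \<diamondop> X\<close> is the free algebra of the law on the \<open>T \<oplus> T'\<close>-algebra \<open>X\<close>.\<close>

lemma extend_to_free:
  assumes A: "law_algebra C S ins T \<delta> \<Gamma> d A a b' c'"
    and f [simp]: "f \<in> Arr C" "Dom C f = X" "Cod C f = A"
    and f_b: "f \<cdot> b = b' \<cdot> T \<star> f" and f_c: "f \<cdot> c = c' \<cdot> \<Gamma> \<star> (f, a \<cdot> S \<star> f)"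
  defines "F \<equiv> a \<cdot> S \<star> f"
  shows "F \<cdot> lT X b = b' \<cdot> T \<star> F" "F \<cdot> lfree X b c = c' \<cdot> \<Gamma> \<star> (F, F)"
proof -
  note ab = law_algebraD(1)[OF A]
  note [simp] = compat_algD(4-)[OF ab] law_algebraD(2-4)[OF A]
  note a = compat_algD(1)[OF ab]
  let ?z = "a \<cdot> S \<star> b'"
  note z = compat_alg_composite[OF ab]
  note z_arr = M.alg_arr(2-4)[OF z]
  have F [simp]: "F \<in> Arr C" "Dom C F = S \<diamondop> X" "Cod C F = A" by (simp_all add: F_def)
  have F_unit: "F \<cdot> munit S X = f"
    using S.unit_nat[of f A] extend[OF S.alg_unit[OF a], of f] by (simp add: F_def)
  have F_mult: "F \<cdot> mmult S X = a \<cdot> S \<star> F"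
    using S.mult_nat[of f A] extend[OF S.alg_mult[OF a], of "S \<star> S \<star> f"] by (simp add: F_def S.Cmp)
  have F_T: "F \<cdot> lT X b = b' \<cdot> T \<star> F"
  proof -
    have "F \<cdot> lT X b = a \<cdot> (S \<star> (f \<cdot> b) \<cdot> \<delta> X)"
      by (simp add: F_def lT_eq S.Cmp composite_simps)
    also have "\<dots> = (a \<cdot> (S \<star> b' \<cdot> \<delta> A)) \<cdot> T \<star> S \<star> f"
      by (simp add: f_b S.Cmp \<delta>_nat)
    also have "\<dots> = b' \<cdot> T \<star> F"
      unfolding compat_algD(3)[OF ab, symmetric] by (simp add: F_def T.Cmp)
    finally show ?thesis .
  qed
  have [simp]: "lT X b \<in> Arr C" "Dom C (lT X b) = T \<diamondop> S \<diamondop> X" "Cod C (lT X b) = S \<diamondop> X"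
    by (simp_all add: lT_eq composite_simps(1))
  have F_z: "F \<cdot> zS X b = ?z \<cdot> M \<star> F"
  proof -
    have "F \<cdot> zS X b = (F \<cdot> mmult S X) \<cdot> S \<star> lT X b"
      by (simp add: zS_def)
    also have "\<dots> = a \<cdot> S \<star> (F \<cdot> lT X b)"
      unfolding F_mult by (simp add: S.Cmp)
    finally show ?thesis unfolding F_T by (simp add: S.Cmp composite_simps)
  qed
  have z_\<iota>: "?z \<cdot> \<iota> A = a"
    unfolding \<iota>_def by (rule compat_alg_\<iota>[OF ab])
  have F_\<sigma>: "F \<cdot> \<sigma> X = (a \<cdot> ins A) \<cdot> Sig \<star> F"
    using extend[OF F_mult, of "ins (S \<diamondop> X)"] by (simp add: ins_nat)
  \<comment> \<open>An opaque name keeps the simplifier from reassociating the composite structure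
    map.\<close>
  define z where "z = ?z"
  note zd = z_def[symmetric]
  note [simp] = z_arr[unfolded zd]
  \<comment> \<open>Both sides solve the recursion with values in \<open>A\<close> and parameter
    \<open>F\<close>: the left because \<open>F\<close> carries \<open>lfree_step\<close> forward,
    the right because \<open>c'\<close> satisfies (d2). On the unit they agree by
    \<open>f_c\<close>.\<close>
  have "F \<cdot> lfree X b c = c' \<cdot> \<Gamma> \<star> (F, F)"
  proof (rule Gamma_recursion_unique[OF b_arr(1) z zS_alg F F_z F])
    show "F \<cdot> mmult S X = (?z \<cdot> \<iota> A) \<cdot> S \<star> F"
      unfolding z_\<iota> by (rule F_mult)
    have E: "Ev_args (S \<diamondop> X) (zS X b) (lfree X b c \<cdot> \<Gamma> \<star> (idn (S \<diamondop> X), zS X b)) (idn (S \<diamondop> X)) (idn (S \<diamondop> X)) (S \<diamondop> X) (S \<diamondop> X)"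
      by (simp add: Ev_args_def)
    have "(F \<cdot> lfree X b c) \<cdot> \<Gamma> \<star> (\<sigma> X, idn (S \<diamondop> X)) = F \<cdot> (lfree X b c \<cdot> \<Gamma> \<star> (\<sigma> X, idn (S \<diamondop> X)))"
      by simp
    also have "\<dots> = Ev z ((F \<cdot> lfree X b c) \<cdot> \<Gamma> \<star> (idn (S \<diamondop> X), zS X b)) F F (S \<diamondop> X) (S \<diamondop> X)"
      unfolding lfree_step by (subst Ev_hom[OF E, of F A z]) (use F_z in \<open>simp_all add: zd\<close>)
    finally show "(F \<cdot> lfree X b c) \<cdot> \<Gamma> \<star> (\<sigma> X, idn (S \<diamondop> X))
      = Ev ?z ((F \<cdot> lfree X b c) \<cdot> \<Gamma> \<star> (idn (S \<diamondop> X), zS X b)) F F (S \<diamondop> X) (S \<diamondop> X)"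
      unfolding zd .
    have E': "Ev_args A z (c' \<cdot> \<Gamma> \<star> (idn A, z)) (idn A) (idn A) A A"
      by (simp add: Ev_args_def)
    have "(c' \<cdot> \<Gamma> \<star> (F, F)) \<cdot> \<Gamma> \<star> (\<sigma> X, idn (S \<diamondop> X)) = c' \<cdot> \<Gamma> \<star> (F \<cdot> \<sigma> X, F)"
      by simp
    also have "\<dots> = (c' \<cdot> \<Gamma> \<star> (a \<cdot> ins A, idn A)) \<cdot> \<Gamma> \<star> (Sig \<star> F, F)"
      unfolding F_\<sigma> by simp
    also have "\<dots> = Ev z (c' \<cdot> \<Gamma> \<star> (F, z \<cdot> M \<star> F)) F F (S \<diamondop> X) (S \<diamondop> X)"
      unfolding law_algebraD(5)[OF A] zd by (subst Ev_nat[OF E']) simp_all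
    also have "z \<cdot> M \<star> F = F \<cdot> zS X b" unfolding F_z zd ..
    finally show "(c' \<cdot> \<Gamma> \<star> (F, F)) \<cdot> \<Gamma> \<star> (\<sigma> X, idn (S \<diamondop> X))
      = Ev ?z ((c' \<cdot> \<Gamma> \<star> (F, F)) \<cdot> \<Gamma> \<star> (idn (S \<diamondop> X), zS X b)) F F (S \<diamondop> X) (S \<diamondop> X)"
      unfolding zd by simp
    have "(F \<cdot> lfree X b c) \<cdot> \<Gamma> \<star> (munit S X, idn (S \<diamondop> X)) = (F \<cdot> munit S X) \<cdot> c"
      by (simp add: lfree_unit)
    also have "\<dots> = c' \<cdot> \<Gamma> \<star> (F \<cdot> munit S X, F)"
      unfolding F_unit f_c by (simp add: F_def)
    finally show "(F \<cdot> lfree X b c) \<cdot> \<Gamma> \<star> (munit S X, idn (S \<diamondop> X)) = (c' \<cdot> \<Gamma> \<star> (F, F)) \<cdot> \<Gamma> \<star> (munit S X, idn (S \<diamondop> X))"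
      by simp
  qed simp_all
  then show "F \<cdot> lT X b = b' \<cdot> T \<star> F" "F \<cdot> lfree X b c = c' \<cdot> \<Gamma> \<star> (F, F)"
    using F_T by simp_all
qed

end

end

section \<open>Algebras of the coproduct monad and the lifting of \<open>S\<close> to them\<close>

locale inc_law_coproduct = inc_law C U Sig S ins T \<delta> \<Gamma> d
  for C :: "('o, 'a) cat" (structure) and U :: "'u itself" and Sig S ins T \<delta> \<Gamma> d +
  fixes T' P :: "('o, 'a) mnd" and in1 in2 e :: "'o \<Rightarrow> 'a"
  assumes free_T': "free_monad C (Gamma_S S \<Gamma>) T' e" and coprod_P: "monad_coproduct C T T' P in1 in2"
begin

lemma Gamma_S_simps: "Gamma_S S \<Gamma> \<diamondop> X = \<Gamma> \<diamondop> (X, S \<diamondop> X)" "Gamma_S S \<Gamma> \<star> f = \<Gamma> \<star> (f, S \<star> f)"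
  by (simp_all add: Gamma_S_def)

lemma Gamma_S_functor: "is_functor C C (Gamma_S S \<Gamma>)"
  by (rule functorI[OF category_axioms]) (auto simp: Gamma_S_simps S.Cmp)

sublocale P: monad C P
  by (intro monadI category_axioms monad_coproduct_monads(3)[OF coprod_P])

sublocale T': monad C T'
  by (intro monadI category_axioms monad_coproduct_monads(2)[OF coprod_P])

lemmas nat_in1 = monad_coproduct_nat(1)[OF coprod_P]
lemmas nat_in2 = monad_coproduct_nat(2)[OF coprod_P]
lemmas nat_e = free_monad_nat[OF Gamma_S_functor free_T']
lemmas in1_arr [simp] = nat_trans_simps[OF nat_in1]
lemmas in2_arr [simp] = nat_trans_simps[OF nat_in2]
lemmas e_arr [simp] = nat_trans_simps[OF nat_e, unfolded Gamma_S_simps]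

definition Pb :: "'o \<Rightarrow> 'a \<Rightarrow> 'a" where "Pb X p = p \<cdot> in1 X"
definition Pc :: "'o \<Rightarrow> 'a \<Rightarrow> 'a" where "Pc X p = p \<cdot> in2 X \<cdot> e X"

lemma Pb_alg: "monad_algebra C P X p \<Longrightarrow> monad_algebra C T X (Pb X p)"
  unfolding Pb_def
  by (rule restrict_alg[OF P.is_monad T.is_monad monad_coproduct_morphisms(1)[OF coprod_P]])

lemma Pc_arr [simp]:
  assumes "monad_algebra C P X p"
  shows "Pc X p \<in> Arr C" "Dom C (Pc X p) = \<Gamma> \<diamondop> (X, S \<diamondop> X)" "Cod C (Pc X p) = X"
  using P.alg_arr[OF assms] by (simp_all add: Pc_def)

text \<open>Uniqueness for the coproduct reduces equality to the parts over \<open>T\<close> and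
  \<open>T'\<close>; uniqueness for the free monad reduces the latter to \<open>Pc\<close>.\<close>

lemma P_alg_eqI:
  assumes p: "monad_algebra C P X p" and q: "monad_algebra C P X q" and eq: "Pb X p = Pb X q" "Pc X p = Pc X q"
  shows "p = q"
proof (rule monad_coproduct_alg_unique[OF coprod_P p q])
  note r = restrict_alg[OF P.is_monad T'.is_monad monad_coproduct_morphisms(2)[OF coprod_P]]
  show "p \<cdot> in1 X = q \<cdot> in1 X" using eq by (simp add: Pb_def)
  show "p \<cdot> in2 X = q \<cdot> in2 X"
    by (rule free_monad_alg_unique[OF Gamma_S_functor free_T' r[OF p] r[OF q]]) (use eq in \<open>simp add: Pc_def\<close>)
qed

lemma P_alg_exists:
  assumes b: "monad_algebra C T X b" and c: "c \<in> Arr C" "Dom C c = \<Gamma> \<diamondop> (X, S \<diamondop> X)" "Cod C c = X"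
  shows "\<exists>p. monad_algebra C P X p \<and> Pb X p = b \<and> Pc X p = c"
proof -
  have "c \<in> hom C (Gamma_S S \<Gamma> \<diamondop> X) X" using c by (simp add: in_hom Gamma_S_simps)
  then obtain c' where c': "monad_algebra C T' X c'" "c' \<cdot> e X = c"
    by (rule free_monad_alg_exists[OF Gamma_S_functor free_T'])
  obtain p where "monad_algebra C P X p" "p \<cdot> in1 X = b" "p \<cdot> in2 X = c'"
    by (rule monad_coproduct_alg_exists[OF coprod_P b c'(1)])
  with c' show ?thesis by (auto simp: Pb_def Pc_def)
qed

abbreviation Pstr where "Pstr \<equiv> P_structure C P in1 in2 e"

lemma Pstr:
  assumes b: "monad_algebra C T X b" and c: "c \<in> Arr C" "Dom C c = \<Gamma> \<diamondop> (X, S \<diamondop> X)" "Cod C c = X"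
  shows "monad_algebra C P X (Pstr X b c)" "Pb X (Pstr X b c) = b" "Pc X (Pstr X b c) = c"
proof -
  have "\<exists>!p. monad_algebra C P X p \<and> Pb X p = b \<and> Pc X p = c"
    by (rule ex_ex1I[OF P_alg_exists[OF assms]]) (elim conjE, rule P_alg_eqI[of X], simp_all)
  from theI'[OF this] show "monad_algebra C P X (Pstr X b c)" "Pb X (Pstr X b c) = b" "Pc X (Pstr X b c) = c"
    unfolding P_structure_def Pb_def Pc_def by blast+
qed

text \<open>One direction is naturality of the canonical transformations, the other applies the
  homomorphism criteria for the coproduct and for the free monad.\<close>

lemma P_hom_iff:
  assumes f: "f \<in> hom C X Y" and p: "monad_algebra C P X p" and q: "monad_algebra C P Y q"
  shows "f \<cdot> p = q \<cdot> P \<star> f \<longleftrightarrow> f \<cdot> Pb X p = Pb Y q \<cdot> T \<star> f \<and> f \<cdot> Pc X p = Pc Y q \<cdot> \<Gamma> \<star> (f, S \<star> f)"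
proof -
  note r = restrict_alg[OF P.is_monad T'.is_monad monad_coproduct_morphisms(2)[OF coprod_P]]
  note [simp] = P.alg_arr[OF p] P.alg_arr[OF q]
  have [simp]: "f \<in> Arr C" "Dom C f = X" "Cod C f = Y" using f by (auto simp: in_hom)
  have n1: "in1 Y \<cdot> T \<star> f = P \<star> f \<cdot> in1 X" using nat_trans_nat[OF nat_in1, of f Y] by simp
  have n2: "in2 Y \<cdot> T' \<star> f = P \<star> f \<cdot> in2 X" using nat_trans_nat[OF nat_in2, of f Y] by simp
  have n3: "e Y \<cdot> \<Gamma> \<star> (f, S \<star> f) = T' \<star> f \<cdot> e X" using nat_trans_nat[OF nat_e, of f Y] by (simp add: Gamma_S_simps)
  show ?thesis
  proof
    assume h: "f \<cdot> p = q \<cdot> P \<star> f"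
    show "f \<cdot> Pb X p = Pb Y q \<cdot> T \<star> f \<and> f \<cdot> Pc X p = Pc Y q \<cdot> \<Gamma> \<star> (f, S \<star> f)"
      using extend[OF h, of "in1 X"] extend[OF h, of "in2 X \<cdot> e X"] extend[OF n2, of "e X"]
      by (simp add: Pb_def Pc_def n1 n3)
  next
    assume h: "f \<cdot> Pb X p = Pb Y q \<cdot> T \<star> f \<and> f \<cdot> Pc X p = Pc Y q \<cdot> \<Gamma> \<star> (f, S \<star> f)"
    show "f \<cdot> p = q \<cdot> P \<star> f"
    proof (rule monad_coproduct_hom[OF coprod_P f p q])
      show "f \<cdot> (p \<cdot> in1 X) = (q \<cdot> in1 Y) \<cdot> T \<star> f" using h by (simp add: Pb_def)
      show "f \<cdot> (p \<cdot> in2 X) = (q \<cdot> in2 Y) \<cdot> T' \<star> f"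
        by (rule free_monad_hom[OF Gamma_S_functor free_T' f r[OF p] r[OF q]])
          (use h in \<open>simp add: Pc_def Gamma_S_simps\<close>)
    qed
  qed
qed

text \<open>Evaluating the second argument by \<open>a\<close> turns the operation on
  \<open>\<Gamma>(X, X)\<close> into one on \<open>\<Gamma>(X, SX)\<close>; this is the
  \<open>P\<close>-structure underlying a law algebra.\<close>

lemma law_algebra_Pstr:
  assumes A: "law_algebra C S ins T \<delta> \<Gamma> d X a b c"
  defines "p \<equiv> Pstr X b (c \<cdot> \<Gamma> \<star> (idn X, a))"
  shows "monad_algebra C P X p" "Pb X p = b" "Pc X p = c \<cdot> \<Gamma> \<star> (idn X, a)"
proof -
  note ab = law_algebraD(1)[OF A]
  note [simp] = compat_algD(4-)[OF ab] law_algebraD(2-4)[OF A]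
  show "monad_algebra C P X p" "Pb X p = b" "Pc X p = c \<cdot> \<Gamma> \<star> (idn X, a)"
    unfolding p_def using Pstr[OF compat_algD(2)[OF ab], of "c \<cdot> \<Gamma> \<star> (idn X, a)"] by simp_all
qed

text \<open>Built with \<open>lift_Gamma\<close>, so that its distributive law is
  \<open>induced_law\<close> by unfolding; \<open>lG_eq\<close> provides the access to
  \<open>lfree\<close>.\<close>

definition plift :: "'o \<Rightarrow> 'a \<Rightarrow> 'a" where
  "plift X p = Pstr (S \<diamondop> X) (lT X (Pb X p)) (lG X (Pb X p) (Pc X p))"

lemma plift:
  assumes p: "monad_algebra C P X p"
  defines "l \<equiv> lfree X (Pb X p) (Pc X p)"
  shows "law_algebra C S ins T \<delta> \<Gamma> d (S \<diamondop> X) (mmult S X) (lT X (Pb X p)) l"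
    "monad_algebra C P (S \<diamondop> X) (plift X p)" "Pb (S \<diamondop> X) (plift X p) = lT X (Pb X p)"
    "Pc (S \<diamondop> X) (plift X p) = l \<cdot> \<Gamma> \<star> (idn (S \<diamondop> X), mmult S X)"
proof -
  note b = Pb_alg[OF p] and c = Pc_arr[OF p]
  show A: "law_algebra C S ins T \<delta> \<Gamma> d (S \<diamondop> X) (mmult S X) (lT X (Pb X p)) l"
    unfolding l_def by (rule law_algebra_free[OF b c])
  show "monad_algebra C P (S \<diamondop> X) (plift X p)" "Pb (S \<diamondop> X) (plift X p) = lT X (Pb X p)"
    "Pc (S \<diamondop> X) (plift X p) = l \<cdot> \<Gamma> \<star> (idn (S \<diamondop> X), mmult S X)"
    using law_algebra_Pstr[OF A] unfolding plift_def lG_eq[OF b c] l_def by simp_all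
qed

text \<open>\<open>extend_to_free\<close> in terms of \<open>P\<close>-homomorphisms. The extension
  of \<open>f\<close> also respects \<open>plift\<close> because it is an
  \<open>S\<close>-homomorphism, which takes care of \<open>mmult S X\<close> in the second argument
  of \<open>lift_Gamma\<close>.\<close>

lemma plift_extend:
  assumes A: "law_algebra C S ins T \<delta> \<Gamma> d A a b' c'" and q: "monad_algebra C P A q" "Pb A q = b'" "Pc A q = c' \<cdot> \<Gamma> \<star> (idn A, a)"
    and p: "monad_algebra C P X p" and f: "f \<in> hom C X A" "f \<cdot> p = q \<cdot> P \<star> f"
  shows "(a \<cdot> S \<star> f) \<cdot> lT X (Pb X p) = b' \<cdot> T \<star> (a \<cdot> S \<star> f)"
    "(a \<cdot> S \<star> f) \<cdot> lfree X (Pb X p) (Pc X p) = c' \<cdot> \<Gamma> \<star> (a \<cdot> S \<star> f, a \<cdot> S \<star> f)"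
    "(a \<cdot> S \<star> f) \<cdot> plift X p = q \<cdot> P \<star> (a \<cdot> S \<star> f)"
proof -
  note ab = law_algebraD(1)[OF A]
  note [simp] = compat_algD(4-)[OF ab] law_algebraD(2-4)[OF A] P.alg_arr[OF p]
  have [simp]: "f \<in> Arr C" "Dom C f = X" "Cod C f = A" using f by (auto simp: in_hom)
  note b = Pb_alg[OF p] and c = Pc_arr[OF p]
  have "f \<cdot> Pb X p = b' \<cdot> T \<star> f" "f \<cdot> Pc X p = c' \<cdot> \<Gamma> \<star> (f, a \<cdot> S \<star> f)"
    using P_hom_iff[OF f(1) p q(1)] f(2) by (simp_all add: q)
  note F = extend_to_free[OF b c A _ _ _ this, simplified]
  show "(a \<cdot> S \<star> f) \<cdot> lT X (Pb X p) = b' \<cdot> T \<star> (a \<cdot> S \<star> f)"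
    "(a \<cdot> S \<star> f) \<cdot> lfree X (Pb X p) (Pc X p) = c' \<cdot> \<Gamma> \<star> (a \<cdot> S \<star> f, a \<cdot> S \<star> f)"
    using F lfree_arr[OF b c] by (simp_all add: lT_eq)
  let ?F = "a \<cdot> S \<star> f"
  have F_mult: "?F \<cdot> mmult S X = a \<cdot> S \<star> ?F"
    using S.mult_nat[of f A] extend[OF S.alg_mult[OF compat_algD(1)[OF ab]], of "S \<star> S \<star> f"] by (simp add: S.Cmp)
  have "?F \<cdot> Pc (S \<diamondop> X) (plift X p) = (?F \<cdot> lfree X (Pb X p) (Pc X p)) \<cdot> \<Gamma> \<star> (idn (S \<diamondop> X), mmult S X)"
    using lfree_arr[OF b c] by (simp add: plift[OF p])
  also have "\<dots> = c' \<cdot> \<Gamma> \<star> (?F, ?F \<cdot> mmult S X)"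
    unfolding \<open>?F \<cdot> lfree X (Pb X p) (Pc X p) = _\<close> by simp
  also have "\<dots> = Pc A q \<cdot> \<Gamma> \<star> (?F, S \<star> ?F)"
    unfolding F_mult q by simp
  finally show "?F \<cdot> plift X p = q \<cdot> P \<star> ?F"
    using P_hom_iff[OF _ plift(2)[OF p] q(1), of ?F] \<open>?F \<cdot> lT X (Pb X p) = _\<close>
    by (simp add: in_hom plift(3)[OF p] q(2))
qed

lemma plift_unit:
  assumes p: "monad_algebra C P X p"
  shows "munit S X \<cdot> p = plift X p \<cdot> P \<star> munit S X"
proof -
  note b = Pb_alg[OF p] and c = Pc_arr[OF p]
  note [simp] = P.alg_arr[OF p] T.alg_arr[OF b] c lfree_arr[OF b c]
  have "munit S X \<cdot> Pb X p = lT X (Pb X p) \<cdot> T \<star> munit S X"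
    by (simp add: lT_eq \<delta>_unit_S S.unit_nat)
  moreover have "munit S X \<cdot> Pc X p = (lfree X (Pb X p) (Pc X p) \<cdot> \<Gamma> \<star> (idn (S \<diamondop> X), mmult S X)) \<cdot> \<Gamma> \<star> (munit S X, S \<star> munit S X)"
    using lfree_unit[OF b c] by (simp add: S.unit_right)
  ultimately show ?thesis
    using P_hom_iff[OF _ p plift(2)[OF p], of "munit S X"] by (simp add: in_hom plift[OF p])
qed

sublocale PL: lifting C S P plift
proof
  fix X Y p q f assume p: "monad_algebra C P X p" and q: "monad_algebra C P Y q"
    and f: "f \<in> hom C X Y" and hom: "f \<cdot> p = q \<cdot> P \<star> f"
  note [simp] = P.alg_arr[OF p] P.alg_arr[OF q]
  have [simp]: "f \<in> Arr C" "Dom C f = X" "Cod C f = Y" using f by (auto simp: in_hom)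
  note [simp] = P.alg_arr[OF plift(2)[OF q]]
  \<comment> \<open>\<open>S \<star> f\<close> is the extension of the unit after \<open>f\<close>,
    and the unit is already known to be a \<open>P\<close>-homomorphism.\<close>
  let ?f = "munit S Y \<cdot> f"
  have "?f \<cdot> p = plift Y q \<cdot> P \<star> ?f"
    using extend[OF plift_unit[OF q], of "P \<star> f"] by (simp add: hom P.Cmp)
  then have "(mmult S Y \<cdot> S \<star> ?f) \<cdot> plift X p = plift Y q \<cdot> P \<star> (mmult S Y \<cdot> S \<star> ?f)"
    by (intro plift_extend(3)[OF plift(1,2,3,4)[OF q] p]) (simp_all add: in_hom)
  then show "S \<star> f \<cdot> plift X p = plift Y q \<cdot> P \<star> S \<star> f"
    by (simp add: S.Cmp S.unit_right')
next
  fix X p assume p: "monad_algebra C P X p"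
  note [simp] = P.alg_arr[OF p] P.alg_arr[OF plift(2)[OF p]]
  show "monad_algebra C P (S \<diamondop> X) (plift X p)" by (rule plift(2)[OF p])
  show "munit S X \<cdot> p = plift X p \<cdot> P \<star> munit S X" by (rule plift_unit[OF p])
  \<comment> \<open>The multiplication of \<open>S\<close> is the extension of the identity on
    \<open>S \<diamondop> X\<close>.\<close>
  show "mmult S X \<cdot> plift (S \<diamondop> X) (plift X p) = plift X p \<cdot> P \<star> mmult S X"
    using plift_extend(3)[OF plift(1,2,3,4)[OF p] plift(2)[OF p], of "idn (S \<diamondop> X)"] by (simp add: in_hom)
qed

abbreviation \<Lambda> where "\<Lambda> \<equiv> induced_law C Sig S ins T \<delta> \<Gamma> d P in1 in2 e"

lemma induced_law_eq: "\<Lambda> = PL.law"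
  by (rule HOL.ext) (simp add: induced_law_def PL.law_def plift_def Pb_def Pc_def Let_def)

sublocale SP: dist_law C S P \<Lambda>
  by unfold_locales (simp add: induced_law_eq PL.distributive_law)

abbreviation SP where "SP \<equiv> composite_monad C S P \<Lambda>"

lemma SP_alg_arr:
  assumes "monad_algebra C SP X x"
  shows "X \<in> Ob C" "x \<in> Arr C" "Dom C x = S \<diamondop> P \<diamondop> X" "Cod C x = X"
  using assms unfolding monad_algebra_def in_hom SP.composite_simps by blast+

text \<open>By \<open>lift_eq_law\<close>, Beck's compatibility of \<open>a\<close> and
  \<open>p\<close> says that \<open>a\<close> is a \<open>P\<close>-homomorphism from the lifted
  algebra.\<close>

lemma SP_compat_iff:
  "SP.compat_alg X a p \<longleftrightarrow> monad_algebra C S X a \<and> monad_algebra C P X p \<and> p \<cdot> P \<star> a = a \<cdot> plift X p"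
  unfolding SP.compat_alg_def by (auto simp: induced_law_eq PL.lift_eq_law)

text \<open>\<open>a\<close> is a \<open>P\<close>-homomorphism from the lifted structure.
  Restricting its equation \<open>ac\<close> along units in both arguments shows that
  \<open>c\<close> determines \<open>Pc X p\<close>, and along the unit in the second argument that
  \<open>a\<close> carries \<open>lfree\<close> to \<open>c\<close>. Then (d2) for
  \<open>lfree\<close> passes to \<open>X\<close>, as \<open>a\<close> is split by the unit of
  \<open>S\<close>.\<close>

lemma SP_compat_law_algebra:
  assumes ap: "SP.compat_alg X a p"
  defines "c \<equiv> Pc X p \<cdot> \<Gamma> \<star> (idn X, munit S X)"
  shows "law_algebra C S ins T \<delta> \<Gamma> d X a (Pb X p) c" "Pc X p = c \<cdot> \<Gamma> \<star> (idn X, a)"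
proof -
  note [simp] = SP.compat_algD(4-7)[OF ap]
  have a: "monad_algebra C S X a" and p: "monad_algebra C P X p" and hom: "a \<cdot> plift X p = p \<cdot> P \<star> a"
    using ap by (auto simp: SP_compat_iff)
  note b = Pb_alg[OF p] and c = Pc_arr[OF p]
  let ?l = "lfree X (Pb X p) (Pc X p)" and ?b = "Pb X p" and ?c = "Pc X p"
  note [simp] = T.alg_arr(2-)[OF b] c lfree_arr[OF b c]
  have "a \<cdot> lT X ?b = ?b \<cdot> T \<star> a" and ac: "a \<cdot> (?l \<cdot> \<Gamma> \<star> (idn (S \<diamondop> X), mmult S X)) = ?c \<cdot> \<Gamma> \<star> (a, S \<star> a)"
    using P_hom_iff[OF _ plift(2)[OF p] p, of a] hom by (simp_all add: in_hom plift[OF p])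
  then have ab: "compat_alg X a ?b"
    using a b by (simp add: compat_alg_def lT_eq)
  let ?z = "a \<cdot> S \<star> ?b"
  note z = compat_alg_composite[OF ab]
  define z where "z = ?z"
  note zd = z_def[symmetric]
  note [simp] = M.alg_arr(2-4)[OF z, unfolded zd] zS_arr[OF b c]
  have c_arr [simp]: "c \<in> Arr C" "Dom C c = \<Gamma> \<diamondop> (X, X)" "Cod C c = X"
    by (simp_all add: c_def)
  have unit: "a \<cdot> (munit S X \<cdot> f) = f" if "f \<in> Arr C" "Cod C f = X" for f
    using extend[OF S.alg_unit[OF a], of f] that by simp
  \<comment> \<open>Two instances are used: \<open>t\<close> is the unit at
    \<open>S \<diamondop> X\<close>, and \<open>s\<close> is the unit at \<open>X\<close> or the
    identity.\<close>
  have ac': "a \<cdot> (?l \<cdot> \<Gamma> \<star> (s, mmult S X \<cdot> t)) = ?c \<cdot> \<Gamma> \<star> (a \<cdot> s, S \<star> a \<cdot> t)"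
    if "s \<in> Arr C" "Cod C s = S \<diamondop> X" "t \<in> Arr C" "Cod C t = S \<diamondop> S \<diamondop> X" for s t
    using extend[OF ac, of "\<Gamma> \<star> (s, t)"] that by simp
  show cc: "?c = c \<cdot> \<Gamma> \<star> (idn X, a)"
  proof -
    have "a \<cdot> (?l \<cdot> \<Gamma> \<star> (munit S X, mmult S X \<cdot> munit S (S \<diamondop> X))) = ?c"
      using lfree_unit[OF b c] by (simp add: S.unit_left unit)
    also have "a \<cdot> (?l \<cdot> \<Gamma> \<star> (munit S X, mmult S X \<cdot> munit S (S \<diamondop> X))) = ?c \<cdot> \<Gamma> \<star> (idn X, munit S X \<cdot> a)"
      by (subst ac') (simp_all add: S.unit_nat S.alg_unit[OF a])
    finally show ?thesis by (simp add: c_def)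
  qed
  have al: "a \<cdot> ?l = c \<cdot> \<Gamma> \<star> (a, a)"
  proof -
    have "a \<cdot> (?l \<cdot> \<Gamma> \<star> (idn (S \<diamondop> X), mmult S X \<cdot> munit S (S \<diamondop> X))) = ?c \<cdot> \<Gamma> \<star> (a, munit S X \<cdot> a)"
      by (subst ac') (simp_all add: S.unit_nat)
    then show ?thesis by (simp add: S.unit_left c_def)
  qed
  have a_z: "a \<cdot> zS X ?b = z \<cdot> M \<star> a"
  proof -
    have "a \<cdot> zS X ?b = (a \<cdot> mmult S X) \<cdot> S \<star> lT X ?b"
      by (simp add: zS_def lT_eq)
    also have "\<dots> = a \<cdot> S \<star> (a \<cdot> lT X ?b)"
      unfolding S.alg_mult[OF a] by (simp add: S.Cmp lT_eq)
    also have "\<dots> = z \<cdot> M \<star> a"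
      unfolding \<open>a \<cdot> lT X ?b = _\<close> by (simp add: S.Cmp composite_simps z_def)
    finally show ?thesis .
  qed
  \<comment> \<open>Inserting \<open>a \<cdot> munit S X = idn X\<close> presents an operation on
    \<open>X\<close> as the image under \<open>a\<close> of an operation on variables in
    \<open>S \<diamondop> X\<close>, where \<open>lfree_step\<close> is available.\<close>
  have "c \<cdot> \<Gamma> \<star> (a \<cdot> ins X, idn X) = c \<cdot> \<Gamma> \<star> (a \<cdot> (\<sigma> X \<cdot> Sig \<star> munit S X), a \<cdot> munit S X)"
    by (simp add: ins_nat S.unit_right' S.alg_unit[OF a])
  also have "\<dots> = (a \<cdot> (?l \<cdot> \<Gamma> \<star> (\<sigma> X, idn (S \<diamondop> X)))) \<cdot> \<Gamma> \<star> (Sig \<star> munit S X, munit S X)"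
    using extend[OF al, of "\<Gamma> \<star> (\<sigma> X \<cdot> Sig \<star> munit S X, munit S X)"] by simp
  also have "\<dots> = Ev z (a \<cdot> (?l \<cdot> \<Gamma> \<star> (idn (S \<diamondop> X), zS X ?b))) a a (S \<diamondop> X) (S \<diamondop> X) \<cdot> \<Gamma> \<star> (Sig \<star> munit S X, munit S X)"
  proof -
    have "Ev_args (S \<diamondop> X) (zS X ?b) (?l \<cdot> \<Gamma> \<star> (idn (S \<diamondop> X), zS X ?b)) (idn (S \<diamondop> X)) (idn (S \<diamondop> X)) (S \<diamondop> X) (S \<diamondop> X)"
      by (simp add: Ev_args_def)
    from Ev_hom[OF this, of a X z] show ?thesis
      unfolding lfree_step[OF b c] using a_z by simp
  qed
  also have "a \<cdot> (?l \<cdot> \<Gamma> \<star> (idn (S \<diamondop> X), zS X ?b)) = c \<cdot> \<Gamma> \<star> (a, z \<cdot> M \<star> a)"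
    using extend[OF al, of "\<Gamma> \<star> (idn (S \<diamondop> X), zS X ?b)"] by (simp add: a_z)
  also have "Ev z (c \<cdot> \<Gamma> \<star> (a, z \<cdot> M \<star> a)) a a (S \<diamondop> X) (S \<diamondop> X) \<cdot> \<Gamma> \<star> (Sig \<star> munit S X, munit S X)
      = Ev z (c \<cdot> \<Gamma> \<star> (idn X, z)) (idn X) (idn X) X X"
  proof -
    have "Ev_args X z (c \<cdot> \<Gamma> \<star> (a, z \<cdot> M \<star> a)) a a (S \<diamondop> X) (S \<diamondop> X)"
      by (simp add: Ev_args_def)
    from Ev_nat[OF this, of "munit S X" X "munit S X" X] show ?thesis
      by (simp add: S.alg_unit[OF a] M.Cmp_rev)
  qed
  finally show "law_algebra C S ins T \<delta> \<Gamma> d X a ?b c"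
    using ab by (simp add: law_algebra_iff zd)
qed

text \<open>Freeness of \<open>S \<diamondop> X\<close> applied to the identity of \<open>X\<close>:
  its extension is \<open>a\<close>, so \<open>a\<close> is a homomorphism from the lifted
  structure.\<close>

lemma law_algebra_SP_compat:
  assumes A: "law_algebra C S ins T \<delta> \<Gamma> d X a b c"
  shows "SP.compat_alg X a (Pstr X b (c \<cdot> \<Gamma> \<star> (idn X, a)))"
proof -
  note ab = law_algebraD(1)[OF A]
  note [simp] = compat_algD(4-)[OF ab]
  note p = law_algebra_Pstr[OF A]
  note [simp] = P.alg_arr[OF p(1)]
  show ?thesis
    unfolding SP_compat_iff
    using compat_algD(1)[OF ab] p(1) plift_extend(3)[OF A p p(1), of "idn X"] by (simp add: in_hom)
qed

lemma can_eq:
  assumes [simp]: "X \<in> Ob C" "x \<in> Arr C" "Dom C x = S \<diamondop> P \<diamondop> X"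
  shows "x \<cdot> can_S S P X = x \<cdot> S \<star> munit P X"
    "x \<cdot> can_T C S P in1 X = Pb X (x \<cdot> munit S (P \<diamondop> X))"
    "x \<cdot> can_Gamma C S \<Gamma> P in2 e X = Pc X (x \<cdot> munit S (P \<diamondop> X)) \<cdot> \<Gamma> \<star> (idn X, munit S X)"
  by (simp_all add: can_S_def can_T_def can_Gamma_def Pb_def Pc_def)

text \<open>Beck's decomposition of \<open>x\<close>, followed by
  \<open>SP_compat_law_algebra\<close>. The second claim, that \<open>x\<close> is rebuilt from its
  three restrictions, is one half of the bijection on objects.\<close>

lemma SP_alg_law_algebra:
  assumes x: "monad_algebra C SP X x"
  shows "law_algebra C S ins T \<delta> \<Gamma> d X (x \<cdot> can_S S P X) (x \<cdot> can_T C S P in1 X) (x \<cdot> can_Gamma C S \<Gamma> P in2 e X)"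
    "x = (x \<cdot> can_S S P X) \<cdot> S \<star> Pstr X (x \<cdot> can_T C S P in1 X) ((x \<cdot> can_Gamma C S \<Gamma> P in2 e X) \<cdot> \<Gamma> \<star> (idn X, x \<cdot> can_S S P X))"
proof -
  let ?a = "x \<cdot> S \<star> munit P X" and ?p = "x \<cdot> munit S (P \<diamondop> X)"
  have [simp]: "X \<in> Ob C" "x \<in> Arr C" "Dom C x = S \<diamondop> P \<diamondop> X"
    using SP_alg_arr[OF x] by simp_all
  note can = can_eq[OF \<open>X \<in> Ob C\<close> \<open>x \<in> Arr C\<close> \<open>Dom C x = S \<diamondop> P \<diamondop> X\<close>]
  note ap = SP.composite_alg_compat[OF x]
  note A = SP_compat_law_algebra[OF ap(1)]
  show L: "law_algebra C S ins T \<delta> \<Gamma> d X (x \<cdot> can_S S P X) (x \<cdot> can_T C S P in1 X) (x \<cdot> can_Gamma C S \<Gamma> P in2 e X)"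
    unfolding can by (rule A(1))
  have "?p = Pstr X (Pb X ?p) ((Pc X ?p \<cdot> \<Gamma> \<star> (idn X, munit S X)) \<cdot> \<Gamma> \<star> (idn X, ?a))"
    by (rule P_alg_eqI[OF SP.compat_algD(2)[OF ap(1)] law_algebra_Pstr(1)[OF A(1)]
          law_algebra_Pstr(2)[OF A(1), symmetric] trans[OF A(2) law_algebra_Pstr(3)[OF A(1), symmetric]]])
  with ap(2) show "x = (x \<cdot> can_S S P X) \<cdot> S \<star> Pstr X (x \<cdot> can_T C S P in1 X) ((x \<cdot> can_Gamma C S \<Gamma> P in2 e X) \<cdot> \<Gamma> \<star> (idn X, x \<cdot> can_S S P X))"
    unfolding can by simp
qed

text \<open>The other half of the bijection: \<open>c\<close> is recovered from its extension to
  \<open>\<Gamma>(X, SX)\<close> because \<open>a\<close> cancels the unit of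
  \<open>S\<close>.\<close>

lemma law_algebra_SP_alg:
  assumes A: "law_algebra C S ins T \<delta> \<Gamma> d X a b c"
  defines "x \<equiv> a \<cdot> S \<star> Pstr X b (c \<cdot> \<Gamma> \<star> (idn X, a))"
  shows "monad_algebra C SP X x" "x \<cdot> can_S S P X = a" "x \<cdot> can_T C S P in1 X = b" "x \<cdot> can_Gamma C S \<Gamma> P in2 e X = c"
proof -
  let ?p = "Pstr X b (c \<cdot> \<Gamma> \<star> (idn X, a))"
  note ap = law_algebra_SP_compat[OF A]
  note [simp] = SP.compat_algD(4-)[OF ap] law_algebraD(2-4)[OF A]
  note P = law_algebra_Pstr[OF A]
  show "monad_algebra C SP X x"
    unfolding x_def by (rule SP.compat_alg_composite[OF ap])
  have [simp]: "x \<in> Arr C" "Dom C x = S \<diamondop> P \<diamondop> X" by (simp_all add: x_def)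
  have p: "x \<cdot> munit S (P \<diamondop> X) = ?p"
    using S.unit_nat[of ?p X] extend[OF S.alg_unit[OF SP.compat_algD(1)[OF ap]], of ?p] by (simp add: x_def)
  have a: "x \<cdot> S \<star> munit P X = a"
    unfolding x_def by (rule SP.compat_alg_\<iota>[OF ap])
  show "x \<cdot> can_S S P X = a" "x \<cdot> can_T C S P in1 X = b" "x \<cdot> can_Gamma C S \<Gamma> P in2 e X = c"
    using S.alg_unit[OF SP.compat_algD(1)[OF ap]] by (simp_all add: can_eq p a P)
qed

text \<open>Both sides split into conditions on components. Once \<open>f\<close> respects the
  \<open>S\<close>-structures, the conditions for \<open>Pc\<close> and for \<open>c\<close> imply
  each other, since each of these maps is obtained from the other.\<close>

lemma SP_hom_iff:
  assumes x: "monad_algebra C SP X x" and y: "monad_algebra C SP Y y" and f: "f \<in> hom C X Y"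
  shows "f \<cdot> x = y \<cdot> SP \<star> f \<longleftrightarrow>
     f \<cdot> (x \<cdot> can_S S P X) = (y \<cdot> can_S S P Y) \<cdot> S \<star> f \<and>
     f \<cdot> (x \<cdot> can_T C S P in1 X) = (y \<cdot> can_T C S P in1 Y) \<cdot> T \<star> f \<and>
     f \<cdot> (x \<cdot> can_Gamma C S \<Gamma> P in2 e X) = (y \<cdot> can_Gamma C S \<Gamma> P in2 e Y) \<cdot> \<Gamma> \<star> (f, f)"
proof -
  have [simp]: "X \<in> Ob C" "x \<in> Arr C" "Dom C x = S \<diamondop> P \<diamondop> X" "Cod C x = X" "Y \<in> Ob C" "y \<in> Arr C" "Dom C y = S \<diamondop> P \<diamondop> Y" "Cod C y = Y"
    "f \<in> Arr C" "Dom C f = X" "Cod C f = Y"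
    using SP_alg_arr[OF x] SP_alg_arr[OF y] f by (simp_all add: in_hom)
  define a p c where "a = x \<cdot> S \<star> munit P X" and "p = x \<cdot> munit S (P \<diamondop> X)" and "c = Pc X p \<cdot> \<Gamma> \<star> (idn X, munit S X)"
  define a' p' c' where "a' = y \<cdot> S \<star> munit P Y" and "p' = y \<cdot> munit S (P \<diamondop> Y)" and "c' = Pc Y p' \<cdot> \<Gamma> \<star> (idn Y, munit S Y)"
  note ap = SP.composite_alg_compat[OF x, folded a_def p_def] and ap' = SP.composite_alg_compat[OF y, folded a'_def p'_def]
  note A = SP_compat_law_algebra[OF ap(1), folded c_def] and A' = SP_compat_law_algebra[OF ap'(1), folded c'_def]
  note [simp] = SP.compat_algD(4-)[OF ap(1)] SP.compat_algD(4-)[OF ap'(1)] law_algebraD(2-4)[OF A(1)] law_algebraD(2-4)[OF A'(1)]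
  have p: "monad_algebra C P X p" and p': "monad_algebra C P Y p'"
    using ap(1) ap'(1) by (simp_all add: SP.compat_algD(2))
  note [simp] = Pc_arr[OF p] Pc_arr[OF p']
  have can: "x \<cdot> can_S S P X = a" "x \<cdot> can_T C S P in1 X = Pb X p" "x \<cdot> can_Gamma C S \<Gamma> P in2 e X = c"
    "y \<cdot> can_S S P Y = a'" "y \<cdot> can_T C S P in1 Y = Pb Y p'" "y \<cdot> can_Gamma C S \<Gamma> P in2 e Y = c'"
    by (simp_all add: can_eq a_def p_def c_def a'_def p'_def c'_def)
  \<comment> \<open>The condition on \<open>a\<close> enters in passing from \<open>c\<close> to
    \<open>Pc X p\<close>, which is \<open>c\<close> with its second argument evaluated by
    \<open>a\<close>.\<close>
  have P_iff: "f \<cdot> p = p' \<cdot> P \<star> f \<longleftrightarrow> f \<cdot> Pb X p = Pb Y p' \<cdot> T \<star> f \<and> f \<cdot> c = c' \<cdot> \<Gamma> \<star> (f, f)"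
    if fa: "f \<cdot> a = a' \<cdot> S \<star> f"
  proof -
    have "f \<cdot> Pc X p = Pc Y p' \<cdot> \<Gamma> \<star> (f, S \<star> f) \<longleftrightarrow> f \<cdot> c = c' \<cdot> \<Gamma> \<star> (f, f)"
    proof
      assume h: "f \<cdot> Pc X p = Pc Y p' \<cdot> \<Gamma> \<star> (f, S \<star> f)"
      show "f \<cdot> c = c' \<cdot> \<Gamma> \<star> (f, f)"
        using extend[OF h, of "\<Gamma> \<star> (idn X, munit S X)"] by (simp add: c_def c'_def S.unit_nat)
    next
      assume h: "f \<cdot> c = c' \<cdot> \<Gamma> \<star> (f, f)"
      have "f \<cdot> Pc X p = f \<cdot> (c \<cdot> \<Gamma> \<star> (idn X, a))" by (simp flip: A(2))
      also have "\<dots> = c' \<cdot> \<Gamma> \<star> (f, f \<cdot> a)"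
        using extend[OF h, of "\<Gamma> \<star> (idn X, a)"] by simp
      also have "\<dots> = (c' \<cdot> \<Gamma> \<star> (idn Y, a')) \<cdot> \<Gamma> \<star> (f, S \<star> f)"
        unfolding fa by simp
      finally show "f \<cdot> Pc X p = Pc Y p' \<cdot> \<Gamma> \<star> (f, S \<star> f)"
        by (simp only: A'(2))
    qed
    then show ?thesis using P_hom_iff[OF f p p'] by simp
  qed
  have "f \<cdot> x = y \<cdot> SP \<star> f \<longleftrightarrow> f \<cdot> a = a' \<cdot> S \<star> f \<and> f \<cdot> p = p' \<cdot> P \<star> f"
  proof
    assume h: "f \<cdot> x = y \<cdot> SP \<star> f"
    have "f \<cdot> a = y \<cdot> (S \<star> P \<star> f \<cdot> S \<star> munit P X)"
      using extend[OF h, of "S \<star> munit P X"] by (simp add: a_def SP.composite_simps)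
    moreover have "f \<cdot> p = y \<cdot> (S \<star> P \<star> f \<cdot> munit S (P \<diamondop> X))"
      using extend[OF h, of "munit S (P \<diamondop> X)"] by (simp add: p_def SP.composite_simps)
    ultimately show "f \<cdot> a = a' \<cdot> S \<star> f \<and> f \<cdot> p = p' \<cdot> P \<star> f"
      by (simp add: a'_def p'_def S.Cmp_rev P.unit_nat S.unit_nat)
  next
    assume h: "f \<cdot> a = a' \<cdot> S \<star> f \<and> f \<cdot> p = p' \<cdot> P \<star> f"
    have "f \<cdot> x = (f \<cdot> a) \<cdot> S \<star> p" by (subst ap(2)) simp
    also have "\<dots> = a' \<cdot> S \<star> (f \<cdot> p)" using h by (simp add: S.Cmp_rev)
    also have "\<dots> = (a' \<cdot> S \<star> p') \<cdot> SP \<star> f" using h by (simp add: S.Cmp SP.composite_simps)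
    finally show "f \<cdot> x = y \<cdot> SP \<star> f" by (simp only: ap'(2)[symmetric])
  qed
  then show ?thesis unfolding can using P_iff by blast
qed

end

text \<open>A functor that keeps underlying arrows is determined by its object part, so inverse maps
  on objects that match the two notions of homomorphism suffice.\<close>

lemma iso_of_structured_cats:
  assumes "category C"
    and F: "\<And>x. x \<in> obs \<Longrightarrow> F x \<in> obs' \<and> u' (F x) = u x \<and> G (F x) = x"
    and G: "\<And>y. y \<in> obs' \<Longrightarrow> G y \<in> obs \<and> F (G y) = y"
    and u: "\<And>x. x \<in> obs \<Longrightarrow> u x \<in> Ob C"
    and hm: "\<And>x y f. x \<in> obs \<Longrightarrow> y \<in> obs \<Longrightarrow> f \<in> hom C (u x) (u y) \<Longrightarrow> hm x y f \<longleftrightarrow> hm' (F x) (F y) f"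
  shows "iso_of_cats (structured_cat C obs u hm) (structured_cat C obs' u' hm') \<lparr>fob = F, far = (\<lambda>(x, f, y). (F x, f, F y))\<rparr>"
proof -
  have uG: "u (G y) = u' y" if "y \<in> obs'" for y using F[of "G y"] G[OF that] by simp
  have hmG: "hm (G x) (G y) f \<longleftrightarrow> hm' x y f" if "x \<in> obs'" "y \<in> obs'" "f \<in> hom C (u' x) (u' y)" for x y f
    using hm[of "G x" "G y" f] G that uG by simp
  have 1: "is_functor (structured_cat C obs u hm) (structured_cat C obs' u' hm') \<lparr>fob = F, far = (\<lambda>(x, f, y). (F x, f, F y))\<rparr>"
    unfolding is_functor_def hom_structured_cat
    using F hm by (auto simp: structured_cat_def)
  have 2: "is_functor (structured_cat C obs' u' hm') (structured_cat C obs u hm) \<lparr>fob = G, far = (\<lambda>(x, f, y). (G x, f, G y))\<rparr>"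
    unfolding is_functor_def hom_structured_cat
    using G uG hmG by (auto simp: structured_cat_def)
  show ?thesis
    unfolding iso_of_cats_def
    using F G by (intro conjI exI[of _ "\<lparr>fob = G, far = (\<lambda>(x, f, y). (G x, f, G y))\<rparr>"] 1 2)
      (auto simp: structured_cat_def)
qed

theorem theorem4p13:
  fixes C :: "('o, 'a) cat"
    and Sig :: "('o, 'a) endo"
    and S T T' P :: "('o, 'a) mnd"
    and ins \<delta> e in1 in2 :: "'o \<Rightarrow> 'a"
    and \<Gamma> :: "('o \<times> 'o, 'a \<times> 'a, 'o, 'a) ftor"
    and d :: "'o \<times> 'o \<Rightarrow> 'a"
  assumes "universe TYPE('u)"
    and "locally_finitely_presentable TYPE('u) C"
    and "incremental_structural_law C Sig S ins T \<delta> \<Gamma> d TYPE('u)"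
    and "free_monad C (Gamma_S S \<Gamma>) T' e"
    and "monad_coproduct C T T' P in1 in2"
  defines "SP \<equiv> composite_monad C S P (induced_law C Sig S ins T \<delta> \<Gamma> d P in1 in2 e)"
    and "dAlg \<equiv> law_Alg C S ins T \<delta> \<Gamma> d"
  shows "(\<forall>X x. monad_algebra C SP X x \<longrightarrow>
            law_algebra C S ins T \<delta> \<Gamma> d X
              (x \<cdot>\<^bsub>C\<^esub> can_S S P X) (x \<cdot>\<^bsub>C\<^esub> can_T C S P in1 X) (x \<cdot>\<^bsub>C\<^esub> can_Gamma C S \<Gamma> P in2 e X))
       \<and> (\<exists>F. (\<forall>X x. (X, x) \<in> Ob (Alg C SP) \<longrightarrow>
                 F \<diamondop> (X, x) = (X, x \<cdot>\<^bsub>C\<^esub> can_S S P X, x \<cdot>\<^bsub>C\<^esub> can_T C S P in1 X,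
                               x \<cdot>\<^bsub>C\<^esub> can_Gamma C S \<Gamma> P in2 e X))
            \<and> commutes_over (Alg C SP) F forgetful forgetful
            \<and> iso_of_cats (Alg C SP) dAlg F)"
proof -
  have "category C" using assms(2) by (simp add: locally_finitely_presentable_def)
  then interpret inc_law_coproduct C "TYPE('u)" Sig S ins T \<delta> \<Gamma> d T' P in1 in2 e
    using assms(1-5)
    by (intro inc_law_coproduct.intro inc_law.intro lfp.intro univ.intro lfp_axioms.intro inc_law_axioms.intro
        inc_law_coproduct_axioms.intro)
  define F where "F = (\<lambda>(X, x). (X, x \<cdot>\<^bsub>C\<^esub> can_S S P X, x \<cdot>\<^bsub>C\<^esub> can_T C S P in1 X, x \<cdot>\<^bsub>C\<^esub> can_Gamma C S \<Gamma> P in2 e X))"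
  \<comment> \<open>The inverse on objects: \<open>b\<close> and \<open>c\<close> are assembled into
    a \<open>P\<close>-structure, which is then composed with \<open>a\<close> as in Beck's
    description.\<close>
  define G where "G = (\<lambda>(X, a, b, c). (X, a \<cdot>\<^bsub>C\<^esub> S \<star> Pstr X b (c \<cdot>\<^bsub>C\<^esub> \<Gamma> \<star> (idn\<^bsub>C\<^esub> X, a))))"
  let ?F = "\<lparr>fob = F, far = (\<lambda>(x, f, y). (F x, f, F y))\<rparr>"
  have "iso_of_cats (Alg C SP) dAlg ?F"
    unfolding Alg_def dAlg_def law_Alg_def
  proof (rule iso_of_structured_cats[OF \<open>category C\<close>, where G = G])
    fix x assume "x \<in> {(X, x). monad_algebra C SP X x}"
    then show "F x \<in> {(X, a, b, c). law_algebra C S ins T \<delta> \<Gamma> d X a b c} \<and> fst (F x) = fst x \<and> G (F x) = x"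
      using SP_alg_law_algebra by (auto simp: F_def G_def SP_def)
  next
    fix y assume "y \<in> {(X, a, b, c). law_algebra C S ins T \<delta> \<Gamma> d X a b c}"
    then show "G y \<in> {(X, x). monad_algebra C SP X x} \<and> F (G y) = y"
      using law_algebra_SP_alg by (auto simp: F_def G_def SP_def)
  next
    fix x y f assume "x \<in> {(X, x). monad_algebra C SP X x}" "y \<in> {(X, x). monad_algebra C SP X x}"
      "f \<in> hom C (fst x) (fst y)"
    then show "(case x of (X, x) \<Rightarrow> \<lambda>(Y, y) f. f \<cdot>\<^bsub>C\<^esub> x = y \<cdot>\<^bsub>C\<^esub> SP \<star> f) y f
      \<longleftrightarrow> (case F x of (X, a, b, c) \<Rightarrow> \<lambda>(X', a', b', c') f.
        f \<cdot>\<^bsub>C\<^esub> a = a' \<cdot>\<^bsub>C\<^esub> S \<star> f \<and> f \<cdot>\<^bsub>C\<^esub> b = b' \<cdot>\<^bsub>C\<^esub> T \<star> f \<and> f \<cdot>\<^bsub>C\<^esub> c = c' \<cdot>\<^bsub>C\<^esub> \<Gamma> \<star> (f, f)) (F y) f"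
      using SP_hom_iff by (auto simp: F_def SP_def)
  qed (auto simp: monad_algebra_def)
  moreover have "commutes_over (Alg C SP) ?F forgetful forgetful"
    by (auto simp: commutes_over_def F_def forgetful_def Alg_def structured_cat_def)
  moreover have "\<forall>X x. (X, x) \<in> Ob (Alg C SP) \<longrightarrow> ?F \<diamondop> (X, x) = (X, x \<cdot>\<^bsub>C\<^esub> can_S S P X, x \<cdot>\<^bsub>C\<^esub> can_T C S P in1 X,
      x \<cdot>\<^bsub>C\<^esub> can_Gamma C S \<Gamma> P in2 e X)"
    by (simp add: F_def)
  ultimately show ?thesis
    using SP_alg_law_algebra(1) unfolding SP_def by blast
qed

end
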